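(* Let $k$ be a field and let $G$ be an affine algebraic $k$-group. There exists a largest unipotent normal subgroup $\mathrm{Rad}_u(G)$ of $G$, that is, a unipotent normal subgroup of $G$ which contains all other unipotent normal subgroups of $G$. Moreover, the formation of $\mathrm{Rad}_u(G)$ commutes with base change by separable algebraic field extensions: for every separable algebraic field extension $k'/k$ one has $\mathrm{Rad}_u(G)_{k'} = \mathrm{Rad}_u(G_{k'})$ as subgroups of $G_{k'}$.
   Context: An affine algebraic $k$-group is an affine group scheme of finite type over $k$; it is not assumed smooth or connected. A subgroup means a (automatically closed) $k$-subgroup scheme, not assumed smooth or connected. An algebraic $k$-group is unipotent if it is isomorphic to a closed subgroup scheme of the $k$-group of upper unitriangular matrices in $\mathrm{GL}_n$ for some integer $n\geq 1$. *)

theory Defs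
  imports
    "HOL-Library.Poly_Mapping"
    "HOL-Computational_Algebra.Polynomial"
begin

section \<open>Polynomial rings and their ideals\<close>

text \<open>
  The polynomial ring \<open>k[x\<^sub>v : v :: 'v]\<close> is the monoid algebra of the finitely supported
  exponents \<open>'v \<Rightarrow>\<^sub>0 nat\<close>; the type \<open>'v\<close> of variables may be infinite.
\<close>

type_synonym ('v, 'k) mpoly = "('v \<Rightarrow>\<^sub>0 nat) \<Rightarrow>\<^sub>0 'k"

definition Const :: "'k::field \<Rightarrow> ('v, 'k) mpoly" where
  "Const c = Poly_Mapping.single 0 c"

definition Var :: "'v \<Rightarrow> ('v, 'k::field) mpoly" where
  "Var v = Poly_Mapping.single (Poly_Mapping.single v 1) 1"

definition eval_mpoly ::
    "('k::field \<Rightarrow> 'r::comm_ring_1) \<Rightarrow> ('v \<Rightarrow> 'r) \<Rightarrow> ('v, 'k) mpoly \<Rightarrow> 'r" where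
  "eval_mpoly \<phi> a p =
     (\<Sum>m\<in>Poly_Mapping.keys p. \<phi> (Poly_Mapping.lookup p m) *
        (\<Prod>v\<in>Poly_Mapping.keys m. a v ^ Poly_Mapping.lookup m v))"

abbreviation subst :: "('w \<Rightarrow> ('v, 'k::field) mpoly) \<Rightarrow> ('w, 'k) mpoly \<Rightarrow> ('v, 'k) mpoly" where
  "subst \<equiv> eval_mpoly Const"

text \<open>Ideals are the submodules of the ring viewed as a module over itself.\<close>

abbreviation is_ideal :: "'r::comm_ring_1 set \<Rightarrow> bool" where
  "is_ideal \<equiv> module.subspace (*)"

abbreviation ideal_gen :: "'r::comm_ring_1 set \<Rightarrow> 'r set" where
  "ideal_gen \<equiv> module.span (*)"


section \<open>Affine schemes over a field\<close>

text \<open>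
  An affine \<open>k\<close>-scheme \<open>X = Spec k[x\<^sub>v : v :: 'v]/I\<close> is given by the ideal \<open>I\<close>. Since \<open>'v\<close>
  is arbitrary, every \<open>k\<close>-algebra \<open>A\<close> has this form (take the elements of \<open>A\<close> as variables).
  Closed subschemes of \<open>X\<close> are the ideals \<open>J \<supseteq> I\<close>; inclusion of subschemes reverses
  inclusion of ideals.

  A morphism \<open>Spec k[x]/I \<rightarrow> Spec k[y\<^sub>w : w :: 'w]/J\<close> is given by a tuple \<open>f\<close> of polynomials
  in \<open>x\<close>, such that \<open>y\<^sub>w \<mapsto> f w\<close> maps \<open>J\<close> into \<open>I\<close>; two tuples define the same morphism iff
  they are congruent modulo \<open>I\<close>. Equivalently, \<open>f\<close> is a \<open>k[x]/I\<close>-valued point of the target.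
\<close>

definition morphism ::
    "('v, 'k::field) mpoly set \<Rightarrow> ('w, 'k) mpoly set \<Rightarrow> ('w \<Rightarrow> ('v, 'k) mpoly) \<Rightarrow> bool" where
  "morphism I J f \<longleftrightarrow> (\<forall>p\<in>J. subst f p \<in> I)"

definition same_morphism ::
    "('v, 'k::field) mpoly set \<Rightarrow> ('w \<Rightarrow> ('v, 'k) mpoly) \<Rightarrow> ('w \<Rightarrow> ('v, 'k) mpoly) \<Rightarrow> bool" where
  "same_morphism I f g \<longleftrightarrow> (\<forall>w. f w - g w \<in> I)"

definition comp_morphism ::
    "('u \<Rightarrow> ('w, 'k::field) mpoly) \<Rightarrow> ('w \<Rightarrow> ('v, 'k) mpoly) \<Rightarrow> 'u \<Rightarrow> ('v, 'k) mpoly" where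
  "comp_morphism g f = (\<lambda>u. subst f (g u))"

text \<open>
  Projections from a product, and the product itself: its coordinate ring is
  \<open>k[x]/I \<otimes> k[y]/J = k[x, y]/(I, J)\<close>.
\<close>

abbreviation pr1 :: "'v \<Rightarrow> ('v + 'w, 'k::field) mpoly" where
  "pr1 v \<equiv> Var (Inl v)"

abbreviation pr2 :: "'w \<Rightarrow> ('v + 'w, 'k::field) mpoly" where
  "pr2 w \<equiv> Var (Inr w)"

definition prod_scheme ::
    "('v, 'k::field) mpoly set \<Rightarrow> ('w, 'k) mpoly set \<Rightarrow> ('v + 'w, 'k) mpoly set" where
  "prod_scheme I J = ideal_gen (subst pr1 ` I \<union> subst pr2 ` J)"

definition finite_type :: "('v, 'k::field) mpoly set \<Rightarrow> bool" where
  "finite_type I \<longleftrightarrow>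
     (\<exists>(n::nat) (g :: nat \<Rightarrow> ('v, 'k) mpoly). \<forall>p. \<exists>q :: (nat, 'k) mpoly.
        (\<forall>m\<in>Poly_Mapping.keys q. Poly_Mapping.keys m \<subseteq> {..<n}) \<and> p - subst g q \<in> I)"


section \<open>Affine algebraic groups\<close>

record (overloaded) ('v, 'k) group_data =
  defideal :: "('v, 'k::zero) mpoly set"
  gmult :: "'v \<Rightarrow> ('v + 'v, 'k) mpoly"
  gunit :: "'v \<Rightarrow> 'k"
  ginv :: "'v \<Rightarrow> ('v, 'k) mpoly"

text \<open>Product of two points, unit and inverse, with coordinates in a polynomial ring.\<close>

definition pmult ::
    "('v, 'k::field) group_data \<Rightarrow> ('v \<Rightarrow> ('t, 'k) mpoly) \<Rightarrow> ('v \<Rightarrow> ('t, 'k) mpoly)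
       \<Rightarrow> 'v \<Rightarrow> ('t, 'k) mpoly" where
  "pmult G a b = comp_morphism (gmult G) (case_sum a b)"

definition punit :: "('v, 'k::field) group_data \<Rightarrow> 'v \<Rightarrow> ('t, 'k) mpoly" where
  "punit G = (\<lambda>v. Const (gunit G v))"

definition pinv ::
    "('v, 'k::field) group_data \<Rightarrow> ('v \<Rightarrow> ('t, 'k) mpoly) \<Rightarrow> 'v \<Rightarrow> ('t, 'k) mpoly" where
  "pinv G a = comp_morphism (ginv G) a"

text \<open>
  Group objects in affine \<open>k\<close>-schemes. The axioms are those for the generic points: \<open>Var\<close> is the
  identity of \<open>G\<close>, and \<open>pr1\<close>, \<open>pr2 \<circ> Inl\<close>, \<open>pr2 \<circ> Inr\<close> are the three projections from
  \<open>G \<times> (G \<times> G)\<close>.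
\<close>

definition affine_group :: "('v, 'k::field) group_data \<Rightarrow> bool" where
  "affine_group G \<longleftrightarrow>
     (let I = defideal G;
          x = pr1; y = (\<lambda>v. pr2 (Inl v)); z = (\<lambda>v. pr2 (Inr v))
      in is_ideal I \<and>
         morphism (prod_scheme I I) I (gmult G) \<and>
         (\<forall>p\<in>I. eval_mpoly id (gunit G) p = 0) \<and>
         morphism I I (ginv G) \<and>
         same_morphism (prod_scheme I (prod_scheme I I))
           (pmult G (pmult G x y) z) (pmult G x (pmult G y z)) \<and>
         same_morphism I (pmult G (punit G) Var) Var \<and>
         same_morphism I (pmult G Var (punit G)) Var \<and>
         same_morphism I (pmult G (pinv G Var) Var) (punit G) \<and>
         same_morphism I (pmult G Var (pinv G Var)) (punit G))"

definition affine_algebraic_group :: "('v, 'k::field) group_data \<Rightarrow> bool" where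
  "affine_algebraic_group G \<longleftrightarrow> affine_group G \<and> finite_type (defideal G)"

text \<open>The closed subscheme \<open>J\<close> contains the unit and is stable under product and inverse.\<close>

definition closed_subgroup :: "('v, 'k::field) group_data \<Rightarrow> ('v, 'k) mpoly set \<Rightarrow> bool" where
  "closed_subgroup G J \<longleftrightarrow>
     is_ideal J \<and> defideal G \<subseteq> J \<and>
     morphism (prod_scheme J J) J (gmult G) \<and>
     (\<forall>p\<in>J. eval_mpoly id (gunit G) p = 0) \<and>
     morphism J J (ginv G)"

definition subgroup_group ::
    "('v, 'k::field) group_data \<Rightarrow> ('v, 'k) mpoly set \<Rightarrow> ('v, 'k) group_data" where
  "subgroup_group G J = G\<lparr>defideal := J\<rparr>"

text \<open>Conjugation \<open>G \<times> N \<rightarrow> G\<close>, \<open>(g, n) \<mapsto> g n g\<^sup>-\<^sup>1\<close>, factors through \<open>N\<close>.\<close>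

definition normal_subgroup :: "('v, 'k::field) group_data \<Rightarrow> ('v, 'k) mpoly set \<Rightarrow> bool" where
  "normal_subgroup G N \<longleftrightarrow>
     closed_subgroup G N \<and>
     morphism (prod_scheme (defideal G) N) N (pmult G (pmult G pr1 pr2) (pinv G pr1))"

definition group_morphism ::
    "('v, 'k::field) group_data \<Rightarrow> ('w, 'k) group_data \<Rightarrow> ('w \<Rightarrow> ('v, 'k) mpoly) \<Rightarrow> bool" where
  "group_morphism G H f \<longleftrightarrow>
     morphism (defideal G) (defideal H) f \<and>
     same_morphism (prod_scheme (defideal G) (defideal G))
       (comp_morphism f (gmult G))
       (pmult H (comp_morphism f pr1) (comp_morphism f pr2))"

definition isomorphic_groups ::
    "('v, 'k::field) group_data \<Rightarrow> ('w, 'k) group_data \<Rightarrow> bool" where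
  "isomorphic_groups G H \<longleftrightarrow>
     (\<exists>f g. group_morphism G H f \<and> group_morphism H G g \<and>
        same_morphism (defideal G) (comp_morphism g f) Var \<and>
        same_morphism (defideal H) (comp_morphism f g) Var)"


section \<open>Unipotent groups\<close>

text \<open>
  The upper unitriangular \<open>n \<times> n\<close> matrices. The coordinates are the entries of an
  \<open>\<nat> \<times> \<nat>\<close> matrix, those outside the upper left \<open>n \<times> n\<close> block being set to \<open>0\<close>.
  The inverse of such a matrix \<open>X = 1 - M\<close> is \<open>\<Sum>l<n. M\<^sup>l\<close>, as \<open>M\<close> is strictly upper triangular.
\<close>

definition mat_mult :: "nat \<Rightarrow> (nat \<times> nat \<Rightarrow> 'r::comm_ring_1) \<Rightarrow> (nat \<times> nat \<Rightarrow> 'r) \<Rightarrow> nat \<times> nat \<Rightarrow> 'r" where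
  "mat_mult n A B = (\<lambda>(i, j). \<Sum>l<n. A (i, l) * B (l, j))"

definition mat_id :: "nat \<Rightarrow> nat \<times> nat \<Rightarrow> 'r::comm_ring_1" where
  "mat_id n = (\<lambda>(i, j). if i = j \<and> i < n then 1 else 0)"

definition unitriangular :: "nat \<Rightarrow> (nat \<times> nat, 'k::field) group_data" where
  "unitriangular n =
     \<lparr> defideal = ideal_gen
         ({Var (i, j) | i j. i \<ge> n \<or> j \<ge> n} \<union>
          {Var (i, j) | i j. j < i \<and> i < n} \<union>
          {Var (i, i) - 1 | i. i < n}),
       gmult = mat_mult n pr1 pr2,
       gunit = mat_id n,
       ginv = (\<lambda>ij. \<Sum>l<n. (mat_mult n (\<lambda>ij. mat_id n ij - Var ij) ^^ l) (mat_id n) ij) \<rparr>"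

definition unipotent :: "('v, 'k::field) group_data \<Rightarrow> bool" where
  "unipotent G \<longleftrightarrow>
     (\<exists>n\<ge>1. \<exists>J. closed_subgroup (unitriangular n) J \<and>
        isomorphic_groups G (subgroup_group (unitriangular n) J))"

definition unipotent_normal_subgroup ::
    "('v, 'k::field) group_data \<Rightarrow> ('v, 'k) mpoly set \<Rightarrow> bool" where
  "unipotent_normal_subgroup G N \<longleftrightarrow> normal_subgroup G N \<and> unipotent (subgroup_group G N)"

text \<open>\<open>N\<close> contains \<open>N'\<close> as a subscheme iff \<open>N \<subseteq> N'\<close> as ideals.\<close>

definition largest_unipotent_normal_subgroup ::
    "('v, 'k::field) group_data \<Rightarrow> ('v, 'k) mpoly set \<Rightarrow> bool" where
  "largest_unipotent_normal_subgroup G N \<longleftrightarrow>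
     unipotent_normal_subgroup G N \<and> (\<forall>N'. unipotent_normal_subgroup G N' \<longrightarrow> N \<subseteq> N')"

definition Rad_u :: "('v, 'k::field) group_data \<Rightarrow> ('v, 'k) mpoly set" where
  "Rad_u G = (THE N. largest_unipotent_normal_subgroup G N)"


section \<open>Base change along field extensions\<close>

definition field_embedding :: "('k::field \<Rightarrow> 'l::field) \<Rightarrow> bool" where
  "field_embedding \<iota> \<longleftrightarrow>
     \<iota> 1 = 1 \<and> (\<forall>a b. \<iota> (a + b) = \<iota> a + \<iota> b) \<and> (\<forall>a b. \<iota> (a * b) = \<iota> a * \<iota> b)"

text \<open>The irreducible \<open>f\<close> is the minimal polynomial of \<open>a\<close> up to a constant.\<close>

definition separable_algebraic_extension :: "('k::field \<Rightarrow> 'l::field) \<Rightarrow> bool" where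
  "separable_algebraic_extension \<iota> \<longleftrightarrow>
     field_embedding \<iota> \<and>
     (\<forall>a. \<exists>f :: 'k poly. irreducible f \<and> coprime f (pderiv f) \<and> poly (map_poly \<iota> f) a = 0)"

abbreviation map_coeffs :: "('k::field \<Rightarrow> 'l::field) \<Rightarrow> ('v, 'k) mpoly \<Rightarrow> ('v, 'l) mpoly" where
  "map_coeffs \<equiv> Poly_Mapping.map"

text \<open>\<open>k' \<otimes> k[x]/I = k'[x]/I k'[x]\<close>\<close>

definition base_change_scheme ::
    "('k::field \<Rightarrow> 'l::field) \<Rightarrow> ('v, 'k) mpoly set \<Rightarrow> ('v, 'l) mpoly set" where
  "base_change_scheme \<iota> I = ideal_gen (map_coeffs \<iota> ` I)"

definition base_change_group ::
    "('k::field \<Rightarrow> 'l::field) \<Rightarrow> ('v, 'k) group_data \<Rightarrow> ('v, 'l) group_data" where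
  "base_change_group \<iota> G =
     \<lparr> defideal = base_change_scheme \<iota> (defideal G),
       gmult = (\<lambda>v. map_coeffs \<iota> (gmult G v)),
       gunit = (\<lambda>v. \<iota> (gunit G v)),
       ginv = (\<lambda>v. map_coeffs \<iota> (ginv G v)) \<rparr>"

end

theory Submission
  imports Defs "HOL-Computational_Algebra.Polynomial_Factorial"
begin

text \<open>
  The unipotent radical is the subgroup \<open>N\<close> of all elements acting trivially on every irreducible
  representation of \<open>G\<close>. It is unipotent because a faithful representation of \<open>G\<close> becomes
  unitriangular on \<open>N\<close> in a basis adapted to a composition series. Conversely, let \<open>N'\<close> be a normal
  unipotent subgroup of \<open>G\<^sub>k\<^sub>'\<close> and \<open>V\<close> an irreducible representation of \<open>G\<close> over \<open>k\<close>. The fixed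
  vectors \<open>W\<close> of \<open>N'\<close> in \<open>V\<^sub>k\<^sub>'\<close> form a subrepresentation of \<open>G\<^sub>k\<^sub>'\<close>. As \<open>k'/k\<close> is separable, a
  \<open>G\<close>-equivariant \<open>k\<close>-linear projection \<open>V\<^sub>k\<^sub>' \<rightarrow> W\<close> can be averaged so as to commute with any finite
  set of scalars of \<open>k'\<close>, and since \<open>N'\<close> acts by unipotent operators this forces \<open>W = V\<^sub>k\<^sub>'\<close>. So
  \<open>N'\<close> is contained in \<open>N\<^sub>k\<^sub>'\<close>, which gives both maximality (for \<open>k' = k\<close>) and base change.
\<close>

subsection \<open>Polynomial rings\<close>

text \<open>\<open>G\<close> is not assumed smooth, so its rational points may carry too little
  information. Linear functionals \<alpha> on the coordinate ring replace group elements: \<alpha>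
  acts on a representation with matrix \<open>R\<close> by the scalar matrix
  \<alpha>(\<open>R\<close>), and \<alpha> applied to one factor of the comultiplication plays the
  role of a translation. Closure and normality are tested on points with values in an arbitrary
  coordinate ring, as congruences modulo its ideal. The fixed space \<open>W\<close> need not come
  from a subspace over k, so irreducibility over k does not apply to it directly; what it does yield
  is a k-linear complement of \<open>W\<close>. Averaging treats one scalar at a time, so for an
  infinite extension it does not reach linearity over k'. Finitely many scalars suffice: a product
  of operators involves finitely many matrix entries, and on finitely many functions over k a
  functional over k' is a combination of k-functionals. Long products of operators of N' with
  \<alpha>(1) = 0 vanish because the coordinates of a unitriangular matrix carry a weight, which
  each such operator lowers.\<close>

lemma lookup_map_coeffs:
  "\<iota> 0 = 0 \<Longrightarrow> Poly_Mapping.lookup (Poly_Mapping.map \<iota> p) m = \<iota> (Poly_Mapping.lookup p m)"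
  by (simp add: Poly_Mapping.map.rep_eq when_def)

lemma Const_0 [simp]: "Const 0 = 0"
  by (simp add: Const_def)

lemma Const_1 [simp]: "Const 1 = 1"
  by (simp add: Const_def)

lemma Const_add: "Const (a + b) = Const a + Const b"
  by (simp add: Const_def single_add)

lemma Const_diff: "Const (a - b) = Const a - Const b"
  by (simp add: Const_def single_diff)

lemma Const_mult: "Const (a * b) = Const a * Const b"
  by (simp add: Const_def mult_single)

lemma Const_sum: "Const (sum f A) = (\<Sum>x\<in>A. Const (f x))"
  by (induction A rule: infinite_finite_induct) (auto simp: Const_add)

definition rhom :: "('a::comm_ring_1 \<Rightarrow> 'b::comm_ring_1) \<Rightarrow> bool" where
  "rhom h \<longleftrightarrow> h 1 = 1 \<and> (\<forall>a b. h (a + b) = h a + h b) \<and> (\<forall>a b. h (a * b) = h a * h b)"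

lemma rhomD:
  assumes "rhom h"
  shows rhom_1: "h 1 = 1" and rhom_add: "h (a + b) = h a + h b" and rhom_mult: "h (a * b) = h a * h b"
    and rhom_0: "h 0 = 0" and rhom_diff: "h (a - b) = h a - h b"
    and rhom_uminus: "h (- a) = - h a"
    and rhom_sum: "h (sum f A) = (\<Sum>x\<in>A. h (f x))"
    and rhom_power: "h (a ^ n) = h a ^ n"
proof -
  have 1: "h 1 = 1" and a: "\<And>a b. h (a + b) = h a + h b" and m: "\<And>a b. h (a * b) = h a * h b"
    using assms by (auto simp: rhom_def)
  have z: "h 0 = 0" using a[of 0 0] by simp
  show "h 1 = 1" "h (a + b) = h a + h b" "h (a * b) = h a * h b" "h 0 = 0"
    using 1 a m z by auto
  show d: "h (a - b) = h a - h b" for a b using a[of "a - b" b] by (simp add: algebra_simps)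
  show "h (- a) = - h a" using d[of 0 a] z by simp
  show "h (sum f A) = (\<Sum>x\<in>A. h (f x))"
    by (induction A rule: infinite_finite_induct) (auto simp: a z)
  show "h (a ^ n) = h a ^ n" by (induction n) (auto simp: 1 m)
qed

lemma rhom_Const: "rhom Const"
  by (simp add: rhom_def Const_add Const_mult)

lemma rhom_id: "rhom id" "rhom (\<lambda>x. x)"
  by (simp_all add: rhom_def)

lemma rhom_comp: "rhom g \<Longrightarrow> rhom h \<Longrightarrow> rhom (\<lambda>x. g (h x))"
  by (simp add: rhom_def)

definition monom_val :: "('v \<Rightarrow> 'r::comm_ring_1) \<Rightarrow> ('v \<Rightarrow>\<^sub>0 nat) \<Rightarrow> 'r" where
  "monom_val a m = (\<Prod>v\<in>Poly_Mapping.keys m. a v ^ Poly_Mapping.lookup m v)"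

lemma monom_val_superset:
  assumes "finite K" "Poly_Mapping.keys m \<subseteq> K"
  shows "monom_val a m = (\<Prod>v\<in>K. a v ^ Poly_Mapping.lookup m v)"
  unfolding monom_val_def using assms
  by (intro prod.mono_neutral_left) (auto simp: in_keys_iff)

lemma monom_val_add: "monom_val a (m + m') = monom_val a m * monom_val a m'"
proof -
  let ?K = "Poly_Mapping.keys m \<union> Poly_Mapping.keys m'"
  show ?thesis
    using keys_add[of m m']
    by (simp add: monom_val_superset[of ?K] lookup_add power_add prod.distrib)
qed

lemma eval_mpoly_superset:
  assumes "finite K" "Poly_Mapping.keys p \<subseteq> K" "\<phi> 0 = 0"
  shows "eval_mpoly \<phi> a p = (\<Sum>m\<in>K. \<phi> (Poly_Mapping.lookup p m) * monom_val a m)"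
  unfolding eval_mpoly_def monom_val_def[symmetric] using assms
  by (intro sum.mono_neutral_left) (auto simp: in_keys_iff)

lemma eval_mpoly_single:
  "\<phi> 0 = 0 \<Longrightarrow> eval_mpoly \<phi> a (Poly_Mapping.single m c) = \<phi> c * monom_val a m"
  by (subst eval_mpoly_superset[of "{m}"]) auto

lemma eval_mpoly_add:
  assumes "rhom \<phi>"
  shows "eval_mpoly \<phi> a (p + q) = eval_mpoly \<phi> a p + eval_mpoly \<phi> a q"
proof -
  let ?K = "Poly_Mapping.keys p \<union> Poly_Mapping.keys q"
  show ?thesis
    using keys_add[of p q] rhom_0[OF assms]
    by (simp add: eval_mpoly_superset[of ?K] lookup_add rhom_add[OF assms] sum.distrib algebra_simps)
qed

text \<open>Splitting off one entry at a time serves on two levels: for the terms of a polynomial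
  and for the exponents of a monomial.\<close>

lemma mpoly_add_induct [case_names zero add]:
  assumes "P 0" "\<And>m c p. P p \<Longrightarrow> P (Poly_Mapping.single m c + p)"
  shows "P (p :: 'a \<Rightarrow>\<^sub>0 'b::comm_monoid_add)"
proof (induction p rule: update_induct)
  case const
  then show ?case using assms(1) by simp
next
  case (update f a b)
  have "Poly_Mapping.update a b f = Poly_Mapping.single a b + f"
    using update(1)
    by (intro poly_mapping_eqI)
       (auto simp: lookup_update lookup_add lookup_single when_def in_keys_iff)
  then show ?case using assms(2) update by simp
qed

lemma eval_mpoly_mult:
  assumes h: "rhom \<phi>"
  shows "eval_mpoly \<phi> a (p * q) = eval_mpoly \<phi> a p * eval_mpoly \<phi> a q"
proof (induction p rule: mpoly_add_induct)
  case zero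
  show ?case by (simp add: eval_mpoly_def)
next
  case (add m c p)
  have "eval_mpoly \<phi> a (Poly_Mapping.single m c * q) = eval_mpoly \<phi> a (Poly_Mapping.single m c) * eval_mpoly \<phi> a q"
  proof (induction q rule: mpoly_add_induct)
    case zero
    show ?case by (simp add: eval_mpoly_def)
  next
    case (add m' d q)
    then show ?case
      by (simp add: distrib_left eval_mpoly_add[OF h] mult_single eval_mpoly_single[of \<phi>] rhom_0[OF h]
          rhom_mult[OF h] monom_val_add mult_ac)
  qed
  then show ?case using add by (simp add: distrib_right eval_mpoly_add[OF h])
qed

lemma rhom_eval_mpoly: "rhom \<phi> \<Longrightarrow> rhom (eval_mpoly \<phi> a)"
  using eval_mpoly_single[of \<phi> a 0 1]
  by (auto simp: rhom_def[of "eval_mpoly \<phi> a"] eval_mpoly_add eval_mpoly_mult rhom_0 rhom_1 monom_val_def)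

lemma eval_mpoly_Const [simp]: "rhom \<phi> \<Longrightarrow> eval_mpoly \<phi> a (Const c) = \<phi> c"
  by (simp add: Const_def eval_mpoly_single rhom_0 monom_val_def)

lemma eval_mpoly_Var [simp]: "rhom \<phi> \<Longrightarrow> eval_mpoly \<phi> a (Var v) = a v"
  by (simp add: Var_def eval_mpoly_single rhom_0 rhom_1 monom_val_def)

lemmas subst_simps =
  rhomD[OF rhom_eval_mpoly[OF rhom_Const]] eval_mpoly_Const[OF rhom_Const] eval_mpoly_Var[OF rhom_Const]

lemma Var_power: "Var v ^ n = (Poly_Mapping.single (Poly_Mapping.single v n) 1 :: ('v, 'k::field) mpoly)"
  by (induction n) (auto simp: Var_def mult_single simp flip: single_add)

lemma mpoly_induct [case_names Const Var add mult]:
  fixes p :: "('v, 'k::field) mpoly"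
  assumes C: "\<And>c. P (Const c)" and V: "\<And>v. P (Var v)"
    and A: "\<And>p q. P p \<Longrightarrow> P q \<Longrightarrow> P (p + q)" and M: "\<And>p q. P p \<Longrightarrow> P q \<Longrightarrow> P (p * q)"
  shows "P p"
proof (induction p rule: mpoly_add_induct)
  case zero
  show ?case using C[of 0] by simp
next
  case (add m c p)
  have pw: "P (Var v ^ n)" for v n
  proof (induction n)
    case 0
    show ?case using C[of 1] by simp
  qed (auto intro: M V)
  have "P (Poly_Mapping.single m c)"
  proof (induction m rule: mpoly_add_induct)
    case zero
    show ?case using C[of c] by (simp add: Const_def)
  next
    case (add v n m)
    have "Poly_Mapping.single (Poly_Mapping.single v n + m) c = Var v ^ n * Poly_Mapping.single m c"
      by (simp add: Var_power mult_single)
    then show ?case using M pw add by simp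
  qed
  then show ?case using A add by blast
qed

text \<open>The uniqueness half of the universal property of a polynomial ring; identities between
  substitutions are reduced by it to constants and variables.\<close>

lemma rhom_mpoly_eqI:
  fixes g h :: "('v, 'k::field) mpoly \<Rightarrow> 'r::comm_ring_1"
  assumes "rhom g" "rhom h" "\<And>c. g (Const c) = h (Const c)" "\<And>v. g (Var v) = h (Var v)"
  shows "g p = h p"
  by (induction p rule: mpoly_induct) (use assms in \<open>auto simp: rhomD\<close>)

lemma subst_subst: "subst f (subst g p) = subst (\<lambda>w. subst f (g w)) p"
  by (rule rhom_mpoly_eqI) (auto intro!: rhom_comp[of "subst f" "subst g"] rhom_eval_mpoly rhom_Const simp: subst_simps)

lemma subst_Var [simp]: "subst Var p = p"
  by (rule rhom_mpoly_eqI[of _ "\<lambda>p. p"]) (auto intro!: rhom_eval_mpoly rhom_Const rhom_id simp: subst_simps)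

lemma eval_subst: "eval_mpoly id a (subst f p) = eval_mpoly id (\<lambda>w. eval_mpoly id a (f w)) p"
  by (rule rhom_mpoly_eqI[OF rhom_comp[OF rhom_eval_mpoly[OF rhom_id(1)] rhom_eval_mpoly[OF rhom_Const]] rhom_eval_mpoly[OF rhom_id(1)]])
     (simp_all add: subst_simps rhom_id)

lemma subst_Const_point: "subst (\<lambda>v. Const (u v)) p = Const (eval_mpoly id u p)"
  by (rule rhom_mpoly_eqI[of "subst (\<lambda>v. Const (u v))" "\<lambda>p. Const (eval_mpoly id u p)"])
     (simp_all add: subst_simps rhom_id rhom_eval_mpoly rhom_Const rhom_comp[OF rhom_Const rhom_eval_mpoly[OF rhom_id(1)]])

section \<open>Extension of scalars on the coefficients of polynomials\<close>

lemma rhom_map_coeffs: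
  assumes "rhom \<iota>"
  shows "rhom (Poly_Mapping.map \<iota> :: (('v \<Rightarrow>\<^sub>0 nat) \<Rightarrow>\<^sub>0 'k::comm_ring_1) \<Rightarrow> (('v \<Rightarrow>\<^sub>0 nat) \<Rightarrow>\<^sub>0 'l::comm_ring_1))"
proof -
  have z: "\<iota> 0 = 0" using rhom_0[OF assms] .
  have "Poly_Mapping.map \<iota> 1 = (1 :: ('v \<Rightarrow>\<^sub>0 nat) \<Rightarrow>\<^sub>0 'l)"
    by (intro poly_mapping_eqI) (auto simp: lookup_map_coeffs z lookup_one when_def rhom_1[OF assms])
  moreover have "Poly_Mapping.map \<iota> (p + q) = Poly_Mapping.map \<iota> p + Poly_Mapping.map \<iota> q" for p q :: "('v \<Rightarrow>\<^sub>0 nat) \<Rightarrow>\<^sub>0 'k"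
    by (intro poly_mapping_eqI) (auto simp: lookup_map_coeffs z lookup_add rhom_add[OF assms])
  note a = this
  have m1: "Poly_Mapping.map \<iota> (Poly_Mapping.single m c * q) = Poly_Mapping.map \<iota> (Poly_Mapping.single m c) * Poly_Mapping.map \<iota> q"
    for q :: "('v \<Rightarrow>\<^sub>0 nat) \<Rightarrow>\<^sub>0 'k" and m c
  proof (induction q rule: mpoly_add_induct)
    case zero
    have "Poly_Mapping.map \<iota> 0 = (0 :: ('v \<Rightarrow>\<^sub>0 nat) \<Rightarrow>\<^sub>0 'l)" by (simp add: map_eq_zero_iff)
    then show ?case by simp
  next
    case (add m' d q)
    then show ?case by (simp add: a distrib_left mult_single map_single z rhom_mult[OF assms])
  qed
  have "Poly_Mapping.map \<iota> (p * q) = Poly_Mapping.map \<iota> p * Poly_Mapping.map \<iota> q" for p q :: "('v \<Rightarrow>\<^sub>0 nat) \<Rightarrow>\<^sub>0 'k"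
  proof (induction p rule: mpoly_add_induct)
    case zero
    have "Poly_Mapping.map \<iota> 0 = (0 :: ('v \<Rightarrow>\<^sub>0 nat) \<Rightarrow>\<^sub>0 'l)" by (simp add: map_eq_zero_iff)
    then show ?case by simp
  next
    case (add m d p)
    then show ?case by (simp add: a distrib_right m1)
  qed
  ultimately show ?thesis using a by (auto simp: rhom_def)
qed

lemma map_coeffs_Const [simp]: "\<iota> 0 = 0 \<Longrightarrow> map_coeffs \<iota> (Const c) = Const (\<iota> c)"
  by (simp add: Const_def map_single)

lemma map_coeffs_Var: "rhom \<iota> \<Longrightarrow> map_coeffs \<iota> (Var v) = Var v"
  by (simp add: Var_def map_single rhom_0 rhom_1)

lemma map_coeffs_subst:
  assumes "rhom \<iota>"
  shows "map_coeffs \<iota> (subst f p) = subst (\<lambda>w. map_coeffs \<iota> (f w)) (map_coeffs \<iota> p)"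
  by (rule rhom_mpoly_eqI)
     (auto intro!: rhom_comp[OF rhom_map_coeffs rhom_eval_mpoly] rhom_comp[OF rhom_eval_mpoly rhom_map_coeffs]
        rhom_Const assms simp: subst_simps rhom_0[OF assms] map_coeffs_Var assms)

lemma map_coeffs_eval:
  assumes "rhom \<iota>"
  shows "eval_mpoly id (\<lambda>v. \<iota> (u v)) (map_coeffs \<iota> p) = \<iota> (eval_mpoly id u p)"
  by (rule rhom_mpoly_eqI)
     (auto intro!: rhom_comp[OF assms rhom_eval_mpoly] rhom_comp[OF rhom_eval_mpoly rhom_map_coeffs]
        rhom_id assms simp: rhom_id rhom_0[OF assms] map_coeffs_Var assms)

subsection \<open>Ideals\<close>

lemma ring_module: "module ((*) :: 'r::comm_ring_1 \<Rightarrow> 'r \<Rightarrow> 'r)"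
  by unfold_locales (auto simp: algebra_simps)

lemma is_idealI:
  "0 \<in> I \<Longrightarrow> (\<And>a b. a \<in> I \<Longrightarrow> b \<in> I \<Longrightarrow> a + b \<in> I) \<Longrightarrow> (\<And>r a. a \<in> I \<Longrightarrow> r * a \<in> I) \<Longrightarrow> is_ideal I"
  by (simp add: module.subspace_def[OF ring_module])

lemma idealD:
  assumes "is_ideal I"
  shows ideal_0: "0 \<in> I" and ideal_add: "a \<in> I \<Longrightarrow> b \<in> I \<Longrightarrow> a + b \<in> I"
    and ideal_mult: "a \<in> I \<Longrightarrow> r * a \<in> I" and ideal_mult2: "a \<in> I \<Longrightarrow> a * r \<in> I"
    and ideal_diff: "a \<in> I \<Longrightarrow> b \<in> I \<Longrightarrow> a - b \<in> I"
    and ideal_uminus: "a \<in> I \<Longrightarrow> - a \<in> I"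
    and ideal_sum: "(\<And>x. x \<in> A \<Longrightarrow> f x \<in> I) \<Longrightarrow> sum f A \<in> I"
  using assms module.subspace_0[OF ring_module] module.subspace_add[OF ring_module] module.subspace_scale[OF ring_module]
    module.subspace_diff[OF ring_module] module.subspace_neg[OF ring_module] module.subspace_sum[OF ring_module assms, of A f]
  by (auto simp: mult.commute[of a r])

lemma ideal_gen_ideal: "is_ideal (ideal_gen S)"
  by (rule module.subspace_span[OF ring_module])

lemma ideal_gen_base: "x \<in> S \<Longrightarrow> x \<in> ideal_gen S"
  by (rule module.span_base[OF ring_module])

lemma ideal_gen_least: "is_ideal J \<Longrightarrow> S \<subseteq> J \<Longrightarrow> ideal_gen S \<subseteq> J"
  by (rule module.span_minimal[OF ring_module])

lemma is_ideal_vimage: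
  "rhom h \<Longrightarrow> is_ideal K \<Longrightarrow> is_ideal {p. h p \<in> K}"
  by (rule is_idealI) (auto simp: rhomD idealD)

lemma rhom_ideal_gen_subset:
  assumes "rhom h" "is_ideal K" "\<And>x. x \<in> S \<Longrightarrow> h x \<in> K" "p \<in> ideal_gen S"
  shows "h p \<in> K"
  using ideal_gen_least[OF is_ideal_vimage[OF assms(1,2)], of S] assms(3,4) by auto

section \<open>Congruence modulo an ideal, and the ideal of a product\<close>

definition eqm :: "'r::comm_ring_1 set \<Rightarrow> 'r \<Rightarrow> 'r \<Rightarrow> bool" where
  "eqm I a b \<longleftrightarrow> a - b \<in> I"

context
  fixes I :: "'r::comm_ring_1 set"
  assumes I: "is_ideal I"
begin

lemma eqm_refl: "eqm I a a"
  using I by (simp add: eqm_def idealD)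

lemma eqm_sym: "eqm I a b \<Longrightarrow> eqm I b a"
  using ideal_uminus[OF I, of "a - b"] by (simp add: eqm_def)

lemma eqm_trans: "eqm I a b \<Longrightarrow> eqm I b c \<Longrightarrow> eqm I a c"
  using ideal_add[OF I, of "a - b" "b - c"] by (simp add: eqm_def)

lemma eqm_add: "eqm I a b \<Longrightarrow> eqm I c d \<Longrightarrow> eqm I (a + c) (b + d)"
  using ideal_add[OF I, of "a - b" "c - d"] by (simp add: eqm_def algebra_simps)

lemma eqm_mult: "eqm I a b \<Longrightarrow> eqm I c d \<Longrightarrow> eqm I (a * c) (b * d)"
  using ideal_add[OF I ideal_mult[OF I, of "c - d" a] ideal_mult[OF I, of "a - b" d]]
  by (simp add: eqm_def algebra_simps)

lemma eqm_sum: "(\<And>x. x \<in> A \<Longrightarrow> eqm I (f x) (g x)) \<Longrightarrow> eqm I (sum f A) (sum g A)"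
  by (induction A rule: infinite_finite_induct) (auto simp: eqm_refl eqm_add)

lemma eqm_mem: "eqm I a b \<Longrightarrow> a \<in> I \<longleftrightarrow> b \<in> I"
  using idealD(2)[OF I, of "a - b" b] idealD(5)[OF I, of a "a - b"] by (auto simp: eqm_def)

end

lemma eqm_mono: "I \<subseteq> J \<Longrightarrow> eqm I a b \<Longrightarrow> eqm J a b"
  by (auto simp: eqm_def)

lemma eqm_subst:
  assumes I: "is_ideal I" and fg: "\<And>v. eqm I (f v) (g v)"
  shows "eqm I (subst f p) (subst g p)"
  by (induction p rule: mpoly_induct) (auto simp: subst_simps fg intro: eqm_refl[OF I] eqm_add[OF I] eqm_mult[OF I])

lemma prod_scheme_ideal [simp]: "is_ideal (prod_scheme I J)"
  by (simp add: prod_scheme_def ideal_gen_ideal)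

lemma prod_scheme_pr1: "p \<in> I \<Longrightarrow> subst pr1 p \<in> prod_scheme I J"
  by (auto simp: prod_scheme_def intro: ideal_gen_base)

lemma prod_scheme_pr2: "p \<in> J \<Longrightarrow> subst pr2 p \<in> prod_scheme I J"
  by (auto simp: prod_scheme_def intro: ideal_gen_base)

lemma rhom_prod_scheme_subset:
  assumes "rhom h" "is_ideal K" "\<And>p. p \<in> I \<Longrightarrow> h (subst pr1 p) \<in> K" "\<And>p. p \<in> J \<Longrightarrow> h (subst pr2 p) \<in> K"
    and "q \<in> prod_scheme I J"
  shows "h q \<in> K"
  by (rule rhom_ideal_gen_subset[OF assms(1,2) _ assms(5)[unfolded prod_scheme_def]]) (use assms in auto)

lemma prod_scheme_mono: "I \<subseteq> I' \<Longrightarrow> J \<subseteq> J' \<Longrightarrow> prod_scheme I J \<subseteq> prod_scheme I' J'"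
  unfolding prod_scheme_def by (intro module.span_mono[OF ring_module]) auto

subsection \<open>Linear functionals\<close>

definition lin :: "(('v, 'k::field) mpoly \<Rightarrow> 'k) \<Rightarrow> bool" where
  "lin \<alpha> \<longleftrightarrow> (\<forall>p q. \<alpha> (p + q) = \<alpha> p + \<alpha> q) \<and> (\<forall>c p. \<alpha> (Const c * p) = c * \<alpha> p)"

lemma linD:
  assumes "lin \<alpha>"
  shows lin_add: "\<alpha> (p + q) = \<alpha> p + \<alpha> q" and lin_scale: "\<alpha> (Const c * p) = c * \<alpha> p"
    and lin_scale2: "\<alpha> (p * Const c) = c * \<alpha> p"
    and lin_0: "\<alpha> 0 = 0" and lin_diff: "\<alpha> (p - q) = \<alpha> p - \<alpha> q"
    and lin_sum: "\<alpha> (sum f A) = (\<Sum>x\<in>A. \<alpha> (f x))"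
    and lin_Const: "\<alpha> (Const c) = c * \<alpha> 1"
proof -
  have a: "\<And>p q. \<alpha> (p + q) = \<alpha> p + \<alpha> q" and s: "\<And>c p. \<alpha> (Const c * p) = c * \<alpha> p"
    using assms by (auto simp: lin_def)
  show "\<alpha> (p + q) = \<alpha> p + \<alpha> q" "\<alpha> (Const c * p) = c * \<alpha> p" "\<alpha> (p * Const c) = c * \<alpha> p" "\<alpha> (Const c) = c * \<alpha> 1"
    using a s s[of c 1] by (auto simp: mult.commute[of p "Const c"])
  show z: "\<alpha> 0 = 0" using s[of 0 0] by simp
  show "\<alpha> (p - q) = \<alpha> p - \<alpha> q" using a[of "p - q" q] by (simp add: algebra_simps)
  show "\<alpha> (sum f A) = (\<Sum>x\<in>A. \<alpha> (f x))"
    by (induction A rule: infinite_finite_induct) (auto simp: a z)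
qed

lemma mpoly_vs: "vector_space (\<lambda>c (p :: ('v, 'k::field) mpoly). Const c * p)"
  by unfold_locales (auto simp: algebra_simps Const_add Const_mult)

lemma field_vs: "vector_space ((*) :: 'k::field \<Rightarrow> 'k \<Rightarrow> 'k)"
  by unfold_locales (auto simp: algebra_simps)

lemma mpoly_vs_pair: "vector_space_pair (\<lambda>c (p :: ('v, 'k::field) mpoly). Const c * p) ((*) :: 'k \<Rightarrow> 'k \<Rightarrow> 'k)"
  by (intro vector_space_pair.intro mpoly_vs field_vs)

lemma mpoly_module: "module (\<lambda>c (p :: ('v, 'k::field) mpoly). Const c * p)"
  by unfold_locales (auto simp: algebra_simps Const_add Const_mult)

abbreviation lin_subspace :: "('v, 'k::field) mpoly set \<Rightarrow> bool" where
  "lin_subspace \<equiv> module.subspace (\<lambda>c p. Const c * p)"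

abbreviation lin_span :: "('v, 'k::field) mpoly set \<Rightarrow> ('v, 'k::field) mpoly set" where
  "lin_span \<equiv> module.span (\<lambda>c p. Const c * p)"

lemma ideal_subspace: "is_ideal I \<Longrightarrow> lin_subspace I"
  by (simp add: module.subspace_def[OF mpoly_module] idealD)

text \<open>A basis of \<open>Z\<close> stays independent when \<open>p\<close> is added, so the
  values 0 on the basis and 1 at \<open>p\<close> extend linearly.\<close>

lemma separating_functional:
  fixes Z :: "('v, 'k::field) mpoly set"
  assumes Z: "lin_subspace Z" and p: "p \<notin> Z"
  obtains \<alpha> where "lin \<alpha>" "\<And>z. z \<in> Z \<Longrightarrow> \<alpha> z = 0" "\<alpha> p = 1"
proof -
  interpret mp: vector_space "\<lambda>c (p :: ('v, 'k::field) mpoly). Const c * p" by (rule mpoly_vs)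
  interpret vp: vector_space_pair "\<lambda>c (p :: ('v, 'k::field) mpoly). Const c * p" "(*)" by (rule mpoly_vs_pair)
  obtain B where B: "B \<subseteq> Z" "mp.independent B" "Z \<subseteq> mp.span B"
    using mp.maximal_independent_subset[of Z] by metis
  have "mp.span B \<subseteq> Z" using B(1) Z by (rule mp.span_minimal)
  then have np: "p \<notin> mp.span B" using p by auto
  then have ind: "mp.independent (insert p B)"
    using B(2) by (simp add: mp.independent_insert)
  obtain g where g: "Vector_Spaces.linear (\<lambda>c p. Const c * p) (*) g"
    and ge: "\<forall>x\<in>insert p B. g x = (if x = p then 1 else 0)"
    using vp.linear_independent_extend[OF ind, of "\<lambda>x. if x = p then 1 else 0"] by auto
  interpret g: Vector_Spaces.linear "\<lambda>c p. Const c * p" "(*)" g by (rule g)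
  have "lin g" unfolding lin_def using g.add g.scale by blast
  moreover have "g z = 0" if "z \<in> Z" for z
  proof (rule vp.linear_eq_0_on_span[OF g])
    show "g b = 0" if "b \<in> B" for b using ge p B(1) that by auto
    show "z \<in> mp.span B" using that B(3) by auto
  qed
  ultimately show thesis using that ge by auto
qed

text \<open>A functional over the larger field is only semilinear on polynomials over
  \<open>k\<close>. If the new \<open>p\<close> lies outside the span \<open>Z\<close> of
  \<open>I\<close> and the earlier elements, one more functional vanishing on \<open>Z\<close>
  absorbs the error at \<open>p\<close> without disturbing earlier values; if \<open>p\<close> is in
  \<open>Z\<close>, both sides agree there by semilinearity.\<close>

lemma semilinear_decomposition:
  fixes \<Lambda> :: "('v, 'k::field) mpoly \<Rightarrow> 'l::field"
  assumes \<iota>: "rhom \<iota>" and add: "\<And>p q. \<Lambda> (p + q) = \<Lambda> p + \<Lambda> q" and scale: "\<And>c p. \<Lambda> (Const c * p) = \<iota> c * \<Lambda> p"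
    and I: "is_ideal I" and van: "\<And>p. p \<in> I \<Longrightarrow> \<Lambda> p = 0" and P: "finite P"
  shows "\<exists>(N::nat) c \<mu>. (\<forall>e<N. lin (\<mu> e) \<and> (\<forall>p\<in>I. \<mu> e p = 0)) \<and> (\<forall>p\<in>P. \<Lambda> p = (\<Sum>e<N. c e * \<iota> (\<mu> e p)))"
  using P
proof (induction P)
  case empty
  show ?case by (intro exI[of _ 0]) auto
next
  case (insert p P)
  then obtain N c \<mu> where \<mu>: "\<And>e. e < (N::nat) \<Longrightarrow> lin (\<mu> e)" "\<And>e p. e < N \<Longrightarrow> p \<in> I \<Longrightarrow> \<mu> e p = 0"
    and eq: "\<And>p. p \<in> P \<Longrightarrow> \<Lambda> p = (\<Sum>e<N. c e * \<iota> (\<mu> e p))" by blast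
  define Z where "Z = lin_span (I \<union> P)"
  have z: "\<Lambda> z = (\<Sum>e<N. c e * \<iota> (\<mu> e z))" if "z \<in> Z" for z
    using that unfolding Z_def
  proof (induction rule: module.span_induct_alt[OF mpoly_module, consumes 1, case_names base step])
    case base
    have "\<Lambda> 0 = 0" using scale[of 0 0] by (simp add: rhom_0[OF \<iota>])
    then show ?case using \<mu> by (simp add: lin_0 rhom_0[OF \<iota>])
  next
    case (step a x y)
    have "\<Lambda> x = (\<Sum>e<N. c e * \<iota> (\<mu> e x))"
      using step(1) eq van \<mu>(2) by (auto simp: rhom_0[OF \<iota>])
    moreover have "(\<Sum>e<N. c e * \<iota> (\<mu> e (Const a * x + y))) = \<iota> a * (\<Sum>e<N. c e * \<iota> (\<mu> e x)) + (\<Sum>e<N. c e * \<iota> (\<mu> e y))"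
      unfolding sum_distrib_left sum.distrib[symmetric]
      by (intro sum.cong refl) (simp add: lin_add[OF \<mu>(1)] lin_scale[OF \<mu>(1)] rhomD[OF \<iota>] distrib_left mult.left_commute)
    ultimately show ?case by (simp only: add scale step(2))
  qed
  show ?case
  proof (cases "p \<in> Z")
    case True
    then show ?thesis using \<mu> z[OF True] eq by (intro exI[of _ N] exI[of _ c] exI[of _ \<mu>]) auto
  next
    case False
    then obtain \<nu> where \<nu>: "lin \<nu>" "\<And>z. z \<in> Z \<Longrightarrow> \<nu> z = 0" "\<nu> p = 1"
      using separating_functional[of Z p] module.subspace_span[OF mpoly_module] unfolding Z_def by metis
    have IP: "I \<union> P \<subseteq> Z" unfolding Z_def by (rule module.span_superset[OF mpoly_module])
    define c' where "c' = c(N := \<Lambda> p - (\<Sum>e<N. c e * \<iota> (\<mu> e p)))"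
    define \<mu>' where "\<mu>' = \<mu>(N := \<nu>)"
    have s: "(\<Sum>e<Suc N. c' e * \<iota> (\<mu>' e q)) = (\<Sum>e<N. c e * \<iota> (\<mu> e q)) + (\<Lambda> p - (\<Sum>e<N. c e * \<iota> (\<mu> e p))) * \<iota> (\<nu> q)" for q
      by (simp add: c'_def \<mu>'_def)
    have "\<forall>q\<in>insert p P. \<Lambda> q = (\<Sum>e<Suc N. c' e * \<iota> (\<mu>' e q))"
      using eq IP \<nu>(2,3) unfolding s by (auto simp: rhomD[OF \<iota>])
    moreover have "\<forall>e<Suc N. lin (\<mu>' e) \<and> (\<forall>p\<in>I. \<mu>' e p = 0)"
      using \<mu> \<nu> IP by (auto simp: \<mu>'_def less_Suc_eq)
    ultimately show ?thesis by blast
  qed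
qed

subsection \<open>Slices\<close>

text \<open>
  \<open>SL \<alpha>\<close> and \<open>SR \<alpha>\<close> apply the functional \<open>\<alpha>\<close> to the first, respectively second factor of
  \<open>k[x, y] = k[x] \<otimes> k[y]\<close>.
\<close>

definition separate_vars :: "('v + 'w, 'k::field) mpoly \<Rightarrow> ('w \<Rightarrow>\<^sub>0 nat) \<Rightarrow>\<^sub>0 ('v, 'k) mpoly" where
  "separate_vars = eval_mpoly (\<lambda>c. Poly_Mapping.single 0 (Const c))
     (case_sum (\<lambda>v. Poly_Mapping.single 0 (Var v)) (\<lambda>w. Poly_Mapping.single (Poly_Mapping.single w 1) 1))"

definition SL :: "(('v, 'k) mpoly \<Rightarrow> 'k) \<Rightarrow> ('v + 'w, 'k::field) mpoly \<Rightarrow> ('w, 'k) mpoly" where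
  "SL \<alpha> P = Poly_Mapping.map \<alpha> (separate_vars P)"

definition SR :: "(('w, 'k) mpoly \<Rightarrow> 'k) \<Rightarrow> ('v + 'w, 'k::field) mpoly \<Rightarrow> ('v, 'k) mpoly" where
  "SR \<alpha> P = SL \<alpha> (subst (case_sum pr2 pr1) P)"

lemma rhom_single_0: "rhom (Poly_Mapping.single (0 :: 'w \<Rightarrow>\<^sub>0 nat) :: 'r::comm_ring_1 \<Rightarrow> _)"
  by (simp add: rhom_def single_add mult_single)

lemma rhom_separate_vars: "rhom separate_vars"
  unfolding separate_vars_def by (intro rhom_eval_mpoly rhom_comp[OF rhom_single_0 rhom_Const])

lemma separate_vars_pr1: "separate_vars (subst pr1 a) = Poly_Mapping.single 0 a"
  by (rule rhom_mpoly_eqI[OF rhom_comp[OF rhom_separate_vars rhom_eval_mpoly[OF rhom_Const]] rhom_single_0])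
     (simp_all add: subst_simps separate_vars_def rhom_comp[OF rhom_single_0 rhom_Const])

lemma separate_vars_pr2: "separate_vars (subst pr2 a) = Poly_Mapping.map Const a"
proof (rule rhom_mpoly_eqI[OF rhom_comp[OF rhom_separate_vars rhom_eval_mpoly[OF rhom_Const]] rhom_map_coeffs[OF rhom_Const]])
  show "separate_vars (subst pr2 (Const c)) = Poly_Mapping.map Const (Const c)" for c
    by (simp add: subst_simps separate_vars_def rhom_comp[OF rhom_single_0 rhom_Const])
       (simp add: Const_def[of c] map_single)
  show "separate_vars (subst pr2 (Var c)) = Poly_Mapping.map Const (Var c)" for c
    by (simp add: subst_simps separate_vars_def rhom_comp[OF rhom_single_0 rhom_Const])
       (simp add: Var_def map_single)
qed

text \<open>Each monomial is the product of its part in the left variables and its part in the right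
  ones, so pure tensors span the ring.\<close>

lemma tensor_induct [case_names add tensor]:
  assumes A: "\<And>p q. P p \<Longrightarrow> P q \<Longrightarrow> P (p + q)" and T: "\<And>a b. P (subst pr1 a * subst pr2 b)"
  shows "P (p :: ('v + 'w, 'k::field) mpoly)"
proof -
  have 1: "\<exists>a b. Poly_Mapping.single m c = (subst pr1 a * subst pr2 b :: ('v + 'w, 'k::field) mpoly)" for m c
  proof (induction m rule: mpoly_add_induct)
    case zero
    show ?case by (intro exI[of _ "Const c"] exI[of _ 1]) (simp add: subst_simps, simp add: Const_def)
  next
    case (add u n m)
    then obtain a b where ab: "Poly_Mapping.single m c = (subst pr1 a * subst pr2 b :: ('v + 'w, 'k::field) mpoly)" by blast
    have e: "Poly_Mapping.single (Poly_Mapping.single u n + m) c = Var u ^ n * Poly_Mapping.single m c"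
      by (simp add: Var_power mult_single)
    show ?case
    proof (cases u)
      case (Inl v)
      then show ?thesis unfolding e ab
        by (intro exI[of _ "Var v ^ n * a"] exI[of _ b]) (simp add: subst_simps mult_ac)
    next
      case (Inr v)
      then show ?thesis unfolding e ab
        by (intro exI[of _ a] exI[of _ "Var v ^ n * b"]) (simp add: subst_simps mult_ac)
    qed
  qed
  show ?thesis
  proof (induction p rule: mpoly_add_induct)
    case zero
    show ?case using T[of 0 0] by (simp add: subst_simps)
  next
    case (add m c p)
    then show ?case using 1[of m c] A T by metis
  qed
qed

context
  fixes \<alpha> :: "('v, 'k::field) mpoly \<Rightarrow> 'k"
  assumes lin: "lin \<alpha>"
begin

lemma SL_add: "SL \<alpha> (p + q) = SL \<alpha> p + SL \<alpha> q"
  by (intro poly_mapping_eqI)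
     (simp add: SL_def lookup_map_coeffs lin_0[OF lin] lookup_add rhom_add[OF rhom_separate_vars] lin_add[OF lin])

lemma SL_tensor: "SL \<alpha> (subst pr1 a * subst pr2 b) = Const (\<alpha> a) * b"
  by (intro poly_mapping_eqI)
     (simp add: SL_def rhom_mult[OF rhom_separate_vars] separate_vars_pr1 separate_vars_pr2 Const_def[of "\<alpha> a"]
        lookup_map_coeffs lin_0[OF lin] lin_scale2[OF lin] flip: mult_map_scale_conv_mult)

lemma SL_0: "SL \<alpha> 0 = 0"
  using SL_tensor[of 0 0] by (simp add: subst_simps)

lemma SL_diff: "SL \<alpha> (p - q) = SL \<alpha> p - SL \<alpha> q"
  using SL_add[of "p - q" q] by (simp add: algebra_simps)

lemma SL_sum: "SL \<alpha> (sum f A) = (\<Sum>x\<in>A. SL \<alpha> (f x))"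
  by (induction A rule: infinite_finite_induct) (auto simp: SL_add SL_0)

lemma SL_mult_pr2: "SL \<alpha> (p * subst pr2 b) = SL \<alpha> p * b"
proof (induction p rule: tensor_induct)
  case (tensor c d)
  have "subst pr1 c * subst pr2 d * subst pr2 b = subst pr1 c * subst pr2 (d * b)"
    by (simp add: subst_simps mult_ac)
  then show ?case by (simp only: SL_tensor mult.assoc)
qed (simp add: distrib_right SL_add)

lemma SL_scale: "SL \<alpha> (Const c * p) = Const c * SL \<alpha> p"
  using SL_mult_pr2[of p "Const c"] by (simp add: subst_simps mult.commute)

lemma SL_prod_scheme:
  assumes I: "is_ideal I" and van: "\<And>p. p \<in> I \<Longrightarrow> \<alpha> p = 0" and J: "is_ideal J" and P: "P \<in> prod_scheme I J"
  shows "SL \<alpha> P \<in> J"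
proof -
  \<comment> \<open>\<open>SL\<close> is not multiplicative; demanding the property for all
    multiples yields an ideal, which can be tested on generators.\<close>
  let ?K = "{P. \<forall>Q. SL \<alpha> (Q * P) \<in> J}"
  have K: "is_ideal ?K"
  proof (rule is_idealI)
    fix r a assume a: "a \<in> ?K"
    have "SL \<alpha> (Q * (r * a)) \<in> J" for Q using a by (simp add: mult.assoc[symmetric])
    then show "r * a \<in> ?K" by simp
  qed (auto simp: SL_0 SL_add distrib_left idealD[OF J])
  have 1: "SL \<alpha> (Q * subst pr1 p) \<in> J" if "p \<in> I" for p Q
  proof (induction Q rule: tensor_induct)
    case (add Q R)
    then show ?case by (simp add: distrib_right SL_add idealD[OF J])
  next
    case (tensor a b)
    have "subst pr1 a * subst pr2 b * subst pr1 p = subst pr1 (a * p) * subst pr2 b"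
      by (simp add: subst_simps mult_ac)
    then show ?case using van[OF ideal_mult[OF I that, of a]]
      by (simp add: SL_tensor idealD[OF J] del: eval_mpoly_mult)
  qed
  have 2: "SL \<alpha> (Q * subst pr2 p) \<in> J" if "p \<in> J" for p Q
    using that by (simp add: SL_mult_pr2 idealD[OF J])
  have "prod_scheme I J \<subseteq> ?K"
    unfolding prod_scheme_def by (intro ideal_gen_least K) (use 1 2 in auto)
  then have "SL \<alpha> (1 * P) \<in> J" using P by blast
  then show ?thesis by simp
qed

end

lemma swap_pr: "subst (case_sum pr2 pr1) (subst pr1 a) = subst pr2 a" "subst (case_sum pr2 pr1) (subst pr2 a) = subst pr1 a"
  by (simp_all add: subst_subst subst_simps)

context
  fixes \<alpha> :: "('v, 'k::field) mpoly \<Rightarrow> 'k"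
  assumes lin: "lin \<alpha>"
begin

lemma SR_add: "SR \<alpha> (p + q) = SR \<alpha> p + SR \<alpha> q"
  by (simp add: SR_def SL_add[OF lin] subst_simps)

lemma SR_diff: "SR \<alpha> (p - q) = SR \<alpha> p - SR \<alpha> q"
  by (simp add: SR_def SL_diff[OF lin] subst_simps)

lemma SR_sum: "SR \<alpha> (sum f A) = (\<Sum>x\<in>A. SR \<alpha> (f x))"
  by (simp add: SR_def SL_sum[OF lin] subst_simps)

lemma SR_tensor: "SR \<alpha> (subst pr1 a * subst pr2 b) = Const (\<alpha> b) * a"
  using SL_tensor[OF lin, of b a] by (simp add: SR_def subst_simps swap_pr mult.commute)

lemma SR_prod_scheme:
  assumes I: "is_ideal I" and van: "\<And>p. p \<in> I \<Longrightarrow> \<alpha> p = 0" and J: "is_ideal J" and P: "P \<in> prod_scheme J I"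
  shows "SR \<alpha> P \<in> J"
proof -
  have "subst (case_sum pr2 pr1) P \<in> prod_scheme I J"
    by (rule rhom_prod_scheme_subset[OF rhom_eval_mpoly[OF rhom_Const] _ _ _ P])
       (simp_all add: swap_pr prod_scheme_pr1 prod_scheme_pr2)
  then show ?thesis unfolding SR_def using SL_prod_scheme[OF lin I van J] by blast
qed

end

text \<open>The linear dual of the coordinate ring of \<open>J\<close>, which acts on
  representations as a group algebra would.\<close>

definition functionals :: "('v, 'k::field) mpoly set \<Rightarrow> (('v, 'k) mpoly \<Rightarrow> 'k) set" where
  "functionals J = {\<alpha>. lin \<alpha> \<and> (\<forall>p\<in>J. \<alpha> p = 0)}"

lemma SL_functionals:
  "\<alpha> \<in> functionals I \<Longrightarrow> is_ideal I \<Longrightarrow> is_ideal J \<Longrightarrow> P \<in> prod_scheme I J \<Longrightarrow> SL \<alpha> P \<in> J"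
  using SL_prod_scheme[of \<alpha> I J P] by (auto simp: functionals_def)

lemma SR_functionals:
  "\<alpha> \<in> functionals I \<Longrightarrow> is_ideal I \<Longrightarrow> is_ideal J \<Longrightarrow> P \<in> prod_scheme J I \<Longrightarrow> SR \<alpha> P \<in> J"
  using SR_prod_scheme[of \<alpha> I J P] by (auto simp: functionals_def)

subsection \<open>Points of affine groups\<close>

lemma pmult_apply: "pmult G a b v = subst (case_sum a b) (gmult G v)"
  by (simp add: pmult_def comp_morphism_def)

lemma pmult_eq: "pmult G a b = (\<lambda>v. subst (case_sum a b) (gmult G v))"
  by (rule ext) (rule pmult_apply)

lemma pinv_apply: "pinv G a v = subst a (ginv G v)"
  by (simp add: pinv_def comp_morphism_def)

lemma pinv_eq: "pinv G a = (\<lambda>v. subst a (ginv G v))"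
  by (rule ext) (rule pinv_apply)

lemma subst_case_sum: "(\<lambda>w. subst h (case_sum a b w)) = case_sum (\<lambda>v. subst h (a v)) (\<lambda>v. subst h (b v))"
  by (rule ext) (auto split: sum.split)

lemma subst_pmult_apply: "subst h (pmult G a b v) = pmult G (\<lambda>v. subst h (a v)) (\<lambda>v. subst h (b v)) v"
  by (simp add: pmult_apply subst_subst subst_case_sum)

lemma subst_pinv_apply: "subst h (pinv G a v) = pinv G (\<lambda>v. subst h (a v)) v"
  by (simp add: pinv_apply subst_subst)

lemma subst_punit_apply: "subst h (punit G v) = punit G v"
  by (simp add: punit_def subst_simps)

lemma subst_pmult: "subst (pmult G a b) p = subst (case_sum a b) (subst (gmult G) p)"
  by (simp only: subst_subst pmult_eq)

lemma subst_pinv: "subst (pinv G a) p = subst a (subst (ginv G) p)"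
  by (simp only: subst_subst pinv_eq)

lemma subst_punit: "subst (punit G) p = Const (eval_mpoly id (gunit G) p)"
  by (simp add: punit_def subst_Const_point)

lemma pmult_pr: "pmult G pr1 pr2 = gmult G"
proof -
  have "case_sum pr1 pr2 = Var" by (rule ext) (auto split: sum.split)
  show ?thesis unfolding pmult_eq \<open>case_sum pr1 pr2 = Var\<close> subst_Var ..
qed

lemma pinv_Var: "pinv G Var = ginv G"
  by (rule ext) (simp add: pinv_apply)

lemma subst_case_sum_prod_scheme:
  assumes K: "is_ideal K" and a: "morphism K I a" and b: "morphism K J b" and p: "p \<in> prod_scheme I J"
  shows "subst (case_sum a b) p \<in> K"
  by (rule rhom_prod_scheme_subset[OF rhom_eval_mpoly[OF rhom_Const] K _ _ p])
     (use a b in \<open>simp_all add: subst_subst subst_simps morphism_def\<close>)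

lemma morphism_case_sum:
  "is_ideal K \<Longrightarrow> morphism K I a \<Longrightarrow> morphism K J b \<Longrightarrow> morphism K (prod_scheme I J) (case_sum a b)"
  using subst_case_sum_prod_scheme by (auto simp: morphism_def[of K "prod_scheme I J"])

lemma morphism_pr1: "morphism (prod_scheme I J) I pr1"
  and morphism_pr2: "morphism (prod_scheme I J) J pr2"
  by (auto simp: morphism_def prod_scheme_pr1 prod_scheme_pr2)

lemma morphism_Var: "morphism I I Var"
  by (simp add: morphism_def)

lemma morphism_mono: "K \<subseteq> K' \<Longrightarrow> I' \<subseteq> I \<Longrightarrow> morphism K I a \<Longrightarrow> morphism K' I' a"
  by (auto simp: morphism_def)

lemma subst_eqm_morphism: "morphism K J h \<Longrightarrow> eqm J p q \<Longrightarrow> eqm K (subst h p) (subst h q)"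
  by (auto simp: morphism_def eqm_def rhom_diff[OF rhom_eval_mpoly[OF rhom_Const], symmetric])

locale aff_group =
  fixes G :: "('v, 'k::field) group_data"
  assumes affine_group: "affine_group G"
begin

abbreviation I where "I \<equiv> defideal G"
abbreviation comult where "comult \<equiv> subst (gmult G)"
abbreviation counit where "counit \<equiv> eval_mpoly id (gunit G)"

lemma I_ideal: "is_ideal I"
  and gmult_morphism: "morphism (prod_scheme I I) I (gmult G)"
  and counit_I: "p \<in> I \<Longrightarrow> counit p = 0"
  and ginv_morphism: "morphism I I (ginv G)"
  using affine_group by (auto simp: affine_group_def Let_def)

context
  fixes K :: "('t, 'k) mpoly set"
  assumes K: "is_ideal K"
begin

lemma pmult_point:
  assumes "morphism K I a" "morphism K I b"
  shows "morphism K I (pmult G a b)"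
  using gmult_morphism subst_case_sum_prod_scheme[OF K assms]
  by (simp add: morphism_def subst_pmult)

lemma pinv_point: "morphism K I a \<Longrightarrow> morphism K I (pinv G a)"
  using ginv_morphism by (simp add: morphism_def subst_pinv)

text \<open>The axiom concerns the three projections of \<open>G \<times> (G \<times> G)\<close>;
  substituting \<open>a\<close>, \<open>b\<close>, \<open>c\<close> for them transports it to
  arbitrary points.\<close>

lemma pmult_assoc:
  assumes a: "morphism K I a" and b: "morphism K I b" and c: "morphism K I c"
  shows "eqm K (pmult G (pmult G a b) c v) (pmult G a (pmult G b c) v)"
proof -
  have "eqm (prod_scheme I (prod_scheme I I))
     (pmult G (pmult G pr1 (\<lambda>v. pr2 (Inl v))) (\<lambda>v. pr2 (Inr v)) v) (pmult G pr1 (pmult G (\<lambda>v. pr2 (Inl v)) (\<lambda>v. pr2 (Inr v))) v)"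
    using affine_group by (simp add: affine_group_def Let_def same_morphism_def eqm_def)
  from subst_eqm_morphism[OF morphism_case_sum[OF K a morphism_case_sum[OF K b c]] this]
  show ?thesis by (simp add: subst_pmult_apply subst_simps)
qed

lemma pmult_punit:
  assumes a: "morphism K I a"
  shows "eqm K (pmult G (punit G) a v) (a v)" "eqm K (pmult G a (punit G) v) (a v)"
proof -
  have "eqm I (pmult G (punit G) Var v) (Var v)" "eqm I (pmult G Var (punit G) v) (Var v)"
    using affine_group by (auto simp: affine_group_def Let_def same_morphism_def eqm_def)
  from this[THEN subst_eqm_morphism[OF a]]
  show "eqm K (pmult G (punit G) a v) (a v)" "eqm K (pmult G a (punit G) v) (a v)"
    by (simp_all add: subst_pmult_apply subst_punit_apply subst_simps)
qed

lemma pmult_pinv: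
  assumes a: "morphism K I a"
  shows "eqm K (pmult G (pinv G a) a v) (punit G v)" "eqm K (pmult G a (pinv G a) v) (punit G v)"
proof -
  have "eqm I (pmult G (pinv G Var) Var v) (punit G v)" "eqm I (pmult G Var (pinv G Var) v) (punit G v)"
    using affine_group by (auto simp: affine_group_def Let_def same_morphism_def eqm_def)
  from this[THEN subst_eqm_morphism[OF a]]
  show "eqm K (pmult G (pinv G a) a v) (punit G v)" "eqm K (pmult G a (pinv G a) v) (punit G v)"
    by (simp_all add: subst_pmult_apply subst_punit_apply subst_pinv_apply subst_simps)
qed

end

section \<open>The counit and its slices\<close>

lemma lin_counit: "lin counit"
  by (simp add: lin_def rhomD[OF rhom_eval_mpoly[OF rhom_id(1)]] rhom_id)

lemma counit_functional: "counit \<in> functionals I"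
  by (simp add: functionals_def lin_counit counit_I)

lemma counit_simps: "counit (p + q) = counit p + counit q" "counit (p - q) = counit p - counit q"
  "counit (p * q) = counit p * counit q" "counit 0 = 0" "counit 1 = 1" "counit (Const c) = c"
  "counit (sum f A) = (\<Sum>x\<in>A. counit (f x))"
  by (simp_all add: rhomD[OF rhom_eval_mpoly[OF rhom_id(1)]] rhom_id)

text \<open>Slicing with the counit is evaluation of the left factor at the unit, which makes the
  unit axiom available for slices.\<close>

lemma SL_counit_eq: "SL counit P = subst (case_sum (punit G) Var) P"
proof (induction P rule: tensor_induct)
  case (add p q)
  then show ?case by (simp only: SL_add[OF lin_counit] subst_simps)
next
  case (tensor a b)
  show ?case unfolding SL_tensor[OF lin_counit] subst_simps subst_subst by (simp add: subst_simps subst_punit)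
qed

lemma SR_counit_eq: "SR counit P = subst (case_sum Var (punit G)) P"
proof (induction P rule: tensor_induct)
  case (add p q)
  then show ?case by (simp only: SR_add[OF lin_counit] subst_simps)
next
  case (tensor a b)
  show ?case unfolding SR_tensor[OF lin_counit] subst_simps subst_subst by (simp add: subst_simps subst_punit mult.commute)
qed

lemma SL_counit: "eqm I (SL counit (comult p)) p"
  using eqm_subst[OF I_ideal, where f = "pmult G (punit G) Var" and g = Var] pmult_punit(1)[OF I_ideal morphism_Var]
  by (simp add: SL_counit_eq subst_pmult)

lemma SR_counit: "eqm I (SR counit (comult p)) p"
  using eqm_subst[OF I_ideal, where f = "pmult G Var (punit G)" and g = Var] pmult_punit(2)[OF I_ideal morphism_Var]
  by (simp add: SR_counit_eq subst_pmult)

end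

subsection \<open>Matrix representations\<close>

text \<open>\<open>R\<close> is the matrix of a representation acting on row vectors indexed by \<open>B\<close>.\<close>

definition rep :: "('v, 'k::field) group_data \<Rightarrow> nat set \<Rightarrow> (nat \<Rightarrow> nat \<Rightarrow> ('v, 'k) mpoly) \<Rightarrow> bool" where
  "rep G B R \<longleftrightarrow> finite B \<and> (\<forall>i\<in>B. \<forall>j\<in>B.
     eqm (prod_scheme (defideal G) (defideal G))
       (subst (gmult G) (R i j)) (\<Sum>l\<in>B. subst pr1 (R i l) * subst pr2 (R l j)) \<and>
     eval_mpoly id (gunit G) (R i j) = of_bool (i = j))"

text \<open>Vectors vanish off \<open>B\<close>, so that equality of vectors is plain equality of
  functions; \<open>act\<close> keeps to this convention.\<close>

definition vecs :: "nat set \<Rightarrow> (nat \<Rightarrow> 'k::zero) set" where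
  "vecs B = {y. \<forall>i. i \<notin> B \<longrightarrow> y i = 0}"

definition vec_subspace :: "nat set \<Rightarrow> (nat \<Rightarrow> 'k::field) set \<Rightarrow> bool" where
  "vec_subspace B Y \<longleftrightarrow> Y \<subseteq> vecs B \<and> (\<lambda>i. 0) \<in> Y \<and> (\<forall>y\<in>Y. \<forall>z\<in>Y. (\<lambda>i. y i + z i) \<in> Y) \<and>
     (\<forall>c. \<forall>y\<in>Y. (\<lambda>i. c * y i) \<in> Y)"

definition act :: "nat set \<Rightarrow> (nat \<Rightarrow> 'r::comm_ring_1) \<Rightarrow> (nat \<Rightarrow> nat \<Rightarrow> 'r) \<Rightarrow> nat \<Rightarrow> 'r" where
  "act B y A = (\<lambda>j. if j \<in> B then \<Sum>i\<in>B. y i * A i j else 0)"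

text \<open>The matrices \<alpha>(\<open>R\<close>) stand for all group elements, so this is
  invariance under the group scheme and not merely under its rational points.\<close>

definition stable :: "('v, 'k::field) group_data \<Rightarrow> nat set \<Rightarrow> (nat \<Rightarrow> nat \<Rightarrow> ('v, 'k) mpoly) \<Rightarrow> (nat \<Rightarrow> 'k) set \<Rightarrow> bool" where
  "stable G B R Y \<longleftrightarrow> (\<forall>y\<in>Y. \<forall>\<alpha>\<in>functionals (defideal G). act B y (\<lambda>i j. \<alpha> (R i j)) \<in> Y)"

text \<open>The zero representation on the empty index set counts as irreducible: it contributes no
  generator to \<open>rad_ideal\<close>, and \<open>triangular_form\<close> can treat it without a
  separate case.\<close>

definition irreducible_rep :: "('v, 'k::field) group_data \<Rightarrow> nat set \<Rightarrow> (nat \<Rightarrow> nat \<Rightarrow> ('v, 'k) mpoly) \<Rightarrow> bool" where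
  "irreducible_rep G B R \<longleftrightarrow> rep G B R \<and>
     (\<forall>Y. vec_subspace B Y \<longrightarrow> stable G B R Y \<longrightarrow> Y = {\<lambda>i. 0} \<or> Y = vecs B)"

lemma sum_of_bool:
  fixes f :: "'a \<Rightarrow> 'r::semiring_1"
  assumes "finite B" "j \<in> B"
  shows "(\<Sum>l\<in>B. f l * of_bool (l = j)) = f j" "(\<Sum>l\<in>B. of_bool (j = l) * f l) = f j"
  using assms by (simp_all add: of_bool_def if_distrib if_distribR sum.delta cong: if_cong)

context aff_group
begin

lemma rep_finite: "rep G B R \<Longrightarrow> finite B"
  by (simp add: rep_def)

lemma rep_comult: "rep G B R \<Longrightarrow> i \<in> B \<Longrightarrow> j \<in> B \<Longrightarrow>
    eqm (prod_scheme I I) (comult (R i j)) (\<Sum>l\<in>B. subst pr1 (R i l) * subst pr2 (R l j))"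
  by (simp add: rep_def)

lemma rep_counit: "rep G B R \<Longrightarrow> i \<in> B \<Longrightarrow> j \<in> B \<Longrightarrow> counit (R i j) = of_bool (i = j)"
  by (simp add: rep_def)

lemma rep_punit: "rep G B R \<Longrightarrow> i \<in> B \<Longrightarrow> j \<in> B \<Longrightarrow> subst (punit G) (R i j) = of_bool (i = j)"
  by (simp add: subst_punit rep_counit of_bool_def)

context
  fixes K :: "('t, 'k) mpoly set" and B R
  assumes K: "is_ideal K" and R: "rep G B R"
begin

lemma rep_pmult:
  assumes a: "morphism K I a" and b: "morphism K I b" and ij: "i \<in> B" "j \<in> B"
  shows "eqm K (subst (pmult G a b) (R i j)) (\<Sum>l\<in>B. subst a (R i l) * subst b (R l j))"
  using subst_eqm_morphism[OF morphism_case_sum[OF K a b] rep_comult[OF R ij]]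
  by (simp add: subst_pmult subst_simps subst_subst)

lemma rep_pinv:
  assumes a: "morphism K I a" and ij: "i \<in> B" "j \<in> B"
  shows "eqm K (\<Sum>l\<in>B. subst (pinv G a) (R i l) * subst a (R l j)) (of_bool (i = j))"
    "eqm K (\<Sum>l\<in>B. subst a (R i l) * subst (pinv G a) (R l j)) (of_bool (i = j))"
proof -
  note i = pinv_point[OF K a]
  show "eqm K (\<Sum>l\<in>B. subst (pinv G a) (R i l) * subst a (R l j)) (of_bool (i = j))"
    using eqm_trans[OF K eqm_sym[OF K rep_pmult[OF i a ij]] eqm_subst[OF K pmult_pinv(1)[OF K a], where p = "R i j"]]
    by (simp add: rep_punit[OF R ij])
  show "eqm K (\<Sum>l\<in>B. subst a (R i l) * subst (pinv G a) (R l j)) (of_bool (i = j))"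
    using eqm_trans[OF K eqm_sym[OF K rep_pmult[OF a i ij]] eqm_subst[OF K pmult_pinv(2)[OF K a], where p = "R i j"]]
    by (simp add: rep_punit[OF R ij])
qed

end

end

subsection \<open>The subgroup acting trivially on all irreducible representations\<close>

text \<open>A basis can always be numbered by natural numbers, so these matrices cover all
  finite-dimensional irreducible representations up to isomorphism.\<close>

definition rad_ideal :: "('v, 'k::field) group_data \<Rightarrow> ('v, 'k) mpoly set" where
  "rad_ideal G = ideal_gen (defideal G \<union>
     {R i j - of_bool (i = j) | B R i j. irreducible_rep G B R \<and> i \<in> B \<and> j \<in> B})"

context aff_group
begin

abbreviation Q where "Q \<equiv> rad_ideal G"

lemma Q_ideal: "is_ideal Q"
  by (simp add: rad_ideal_def ideal_gen_ideal)

lemma I_subset_Q: "I \<subseteq> Q"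
  by (auto simp: rad_ideal_def intro: ideal_gen_base)

lemma irreducible_mem_Q: "irreducible_rep G B R \<Longrightarrow> i \<in> B \<Longrightarrow> j \<in> B \<Longrightarrow> eqm Q (R i j) (of_bool (i = j))"
  by (auto simp: rad_ideal_def eqm_def intro!: ideal_gen_base)

lemma subst_of_bool: "subst a (of_bool P) = of_bool P"
  by (cases P) (simp_all add: subst_simps)

text \<open>It suffices to test a tuple on the generators of \<open>Q\<close>. The subgroup axioms
  for \<open>Q\<close> thereby become matrix computations: products, inverses and conjugates of the
  identity matrix are the identity.\<close>

lemma Q_point_iff:
  assumes K: "is_ideal K"
  shows "morphism K Q a \<longleftrightarrow> morphism K I a \<and>
    (\<forall>B R. irreducible_rep G B R \<longrightarrow> (\<forall>i\<in>B. \<forall>j\<in>B. eqm K (subst a (R i j)) (of_bool (i = j))))"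
    (is "_ \<longleftrightarrow> ?r")
proof
  assume a: "morphism K Q a"
  then show ?r
    using morphism_mono[OF subset_refl I_subset_Q a] subst_eqm_morphism[OF a irreducible_mem_Q]
    by (simp add: subst_of_bool)
next
  assume r: ?r
  then have 1: "subst a p \<in> K" if "p \<in> I \<union> {R i j - of_bool (i = j) | B R i j. irreducible_rep G B R \<and> i \<in> B \<and> j \<in> B}" for p
    using that by (elim UnE CollectE exE conjE) (use r in \<open>auto simp: morphism_def eqm_def subst_simps subst_of_bool simp del: of_bool_eq_iff split_of_bool\<close>)
  show "morphism K Q a"
    using rhom_ideal_gen_subset[OF rhom_eval_mpoly[OF rhom_Const] K 1]
    unfolding morphism_def rad_ideal_def by blast
qed

lemma Q_point:
  assumes K: "is_ideal K" and a: "morphism K Q a"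
  shows "morphism K I a" "irreducible_rep G B R \<Longrightarrow> i \<in> B \<Longrightarrow> j \<in> B \<Longrightarrow> eqm K (subst a (R i j)) (of_bool (i = j))"
  using Q_point_iff[OF K] a by auto

lemma eqm_matrix_mult:
  assumes K: "is_ideal K" and B: "finite B" "j \<in> B" and y: "\<And>l. l \<in> B \<Longrightarrow> eqm K (y l) (of_bool (l = j))"
  shows "eqm K (\<Sum>l\<in>B. x l * y l) (x j)"
proof -
  have "eqm K (\<Sum>l\<in>B. x l * y l) (\<Sum>l\<in>B. x l * of_bool (l = j))"
    by (intro eqm_sum[OF K] eqm_mult[OF K] eqm_refl[OF K] y)
  then show ?thesis by (simp add: sum_of_bool B)
qed

lemma normal_subgroup_Q: "normal_subgroup G Q"
proof -
  have PQ: "is_ideal (prod_scheme Q Q)" by simp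
  have irr: "rep G B R" if "irreducible_rep G B R" for B R using that by (simp add: irreducible_rep_def)
  have 1: "morphism (prod_scheme Q Q) Q (gmult G)"
    unfolding Q_point_iff[OF PQ]
  proof (intro conjI allI impI ballI)
    note p = Q_point[OF PQ morphism_pr1] Q_point[OF PQ morphism_pr2]
    show "morphism (prod_scheme Q Q) I (gmult G)"
      by (rule morphism_mono[OF prod_scheme_mono[OF I_subset_Q I_subset_Q] subset_refl gmult_morphism])
    fix B R i j assume R: "irreducible_rep G B R" and ij: "i \<in> B" "j \<in> B"
    note B = rep_finite[OF irr[OF R]]
    have "eqm (prod_scheme Q Q) (subst (pmult G pr1 pr2) (R i j)) (\<Sum>l\<in>B. subst pr1 (R i l) * subst pr2 (R l j))"
      by (rule rep_pmult[OF PQ irr[OF R] p(1) p(3) ij])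
    also have "eqm (prod_scheme Q Q) \<dots> (subst pr1 (R i j))"
      by (rule eqm_matrix_mult[OF PQ B ij(2) p(4)[OF R _ ij(2)]])
    also (eqm_trans[OF PQ]) have "eqm (prod_scheme Q Q) \<dots> (of_bool (i = j))" by (rule p(2)[OF R ij])
    finally (eqm_trans[OF PQ]) show "eqm (prod_scheme Q Q) (subst (gmult G) (R i j)) (of_bool (i = j))"
      by (simp add: pmult_pr)
  qed
  have 2: "counit p = 0" if "p \<in> Q" for p
  proof -
    have z: "is_ideal {0 :: 'k}" by (rule is_idealI) auto
    have v: "counit p = 0" if "p \<in> I \<union> {R i j - of_bool (i = j) | B R i j. irreducible_rep G B R \<and> i \<in> B \<and> j \<in> B}" for p
      using that by (auto simp: counit_simps counit_I rep_counit[OF irr] of_bool_def split: if_splits)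
    have "counit p \<in> {0}"
      by (rule rhom_ideal_gen_subset[OF rhom_eval_mpoly[OF rhom_id(1)] z _ that[unfolded rad_ideal_def]])
         (simp only: singleton_iff, erule v)
    then show ?thesis by simp
  qed
  have 3: "morphism Q Q (ginv G)"
    unfolding Q_point_iff[OF Q_ideal]
  proof (intro conjI allI impI ballI)
    note p = Q_point[OF Q_ideal morphism_Var]
    show "morphism Q I (ginv G)"
      by (rule morphism_mono[OF I_subset_Q subset_refl ginv_morphism])
    fix B R i j assume R: "irreducible_rep G B R" and ij: "i \<in> B" "j \<in> B"
    note B = rep_finite[OF irr[OF R]]
    \<comment> \<open>Multiplying by \<open>R\<close>, which is the identity modulo
      \<open>Q\<close>, changes nothing and makes the inverse law applicable.\<close>
    have "eqm Q (subst (pinv G Var) (R i j)) (\<Sum>l\<in>B. subst (pinv G Var) (R i l) * subst Var (R l j))"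
      by (rule eqm_sym[OF Q_ideal eqm_matrix_mult[OF Q_ideal B ij(2) p(2)[OF R _ ij(2)]]])
    also have "eqm Q \<dots> (of_bool (i = j))"
      by (rule rep_pinv[OF Q_ideal irr[OF R] p(1) ij])
    finally (eqm_trans[OF Q_ideal]) show "eqm Q (subst (ginv G) (R i j)) (of_bool (i = j))"
      by (simp add: pinv_Var)
  qed
  let ?K = "prod_scheme I Q"
  have K: "is_ideal ?K" by simp
  have 4: "morphism ?K Q (pmult G (pmult G pr1 pr2) (pinv G pr1))"
    unfolding Q_point_iff[OF K]
  proof (intro conjI allI impI ballI)
    note x = morphism_pr1[of I Q]
    note n = Q_point[OF K morphism_pr2]
    note xn = pmult_point[OF K x n(1)]
    note xi = pinv_point[OF K x]
    show "morphism ?K I (pmult G (pmult G pr1 pr2) (pinv G pr1))"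
      by (intro pmult_point pinv_point x n K)
    fix B R i j assume R: "irreducible_rep G B R" and ij: "i \<in> B" "j \<in> B"
    note B = rep_finite[OF irr[OF R]]
    have "eqm ?K (subst (pmult G (pmult G pr1 pr2) (pinv G pr1)) (R i j))
       (\<Sum>l\<in>B. subst (pmult G pr1 pr2) (R i l) * subst (pinv G pr1) (R l j))"
      by (rule rep_pmult[OF K irr[OF R] xn xi ij])
    also have "eqm ?K \<dots> (\<Sum>l\<in>B. subst pr1 (R i l) * subst (pinv G pr1) (R l j))"
    proof (intro eqm_sum[OF K] eqm_mult[OF K] eqm_refl[OF K])
      fix l assume l: "l \<in> B"
      have "eqm ?K (subst (pmult G pr1 pr2) (R i l)) (\<Sum>m\<in>B. subst pr1 (R i m) * subst pr2 (R m l))"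
        by (rule rep_pmult[OF K irr[OF R] x n(1) ij(1) l])
      also have "eqm ?K \<dots> (subst pr1 (R i l))"
        by (rule eqm_matrix_mult[OF K B l n(2)[OF R _ l]])
      finally (eqm_trans[OF K]) show "eqm ?K (subst (pmult G pr1 pr2) (R i l)) (subst pr1 (R i l))" .
    qed
    also (eqm_trans[OF K]) have "eqm ?K \<dots> (of_bool (i = j))"
      by (rule rep_pinv[OF K irr[OF R] x ij])
    finally (eqm_trans[OF K]) show "eqm ?K (subst (pmult G (pmult G pr1 pr2) (pinv G pr1)) (R i j)) (of_bool (i = j))" .
  qed
  show ?thesis
    unfolding normal_subgroup_def closed_subgroup_def
    using Q_ideal I_subset_Q 1 2 3 4 by auto
qed

end

subsection \<open>Separable elements\<close>

lemma rhom_of_nat: "rhom h \<Longrightarrow> h (of_nat n) = of_nat n"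
  by (induction n) (auto simp: rhomD)

lemma rhom_field_inj:
  fixes \<iota> :: "'k::field \<Rightarrow> 'l::field"
  assumes "rhom \<iota>" "\<iota> c = 0"
  shows "c = 0"
proof (rule ccontr)
  assume "c \<noteq> 0"
  then have "\<iota> c * \<iota> (inverse c) = 1" by (simp add: rhom_1[OF assms(1)] flip: rhom_mult[OF assms(1)])
  then show False using assms(2) by simp
qed

lemma rhom_poly_map_poly:
  fixes \<iota> :: "'k::field \<Rightarrow> 'l::field"
  assumes "rhom \<iota>"
  shows "rhom (\<lambda>p. poly (map_poly \<iota> p) a)"
proof -
  note [simp] = rhomD[OF assms] coeff_map_poly
  have "map_poly \<iota> (p * q) = map_poly \<iota> p * map_poly \<iota> q" for p q
    by (rule poly_eqI) (simp add: coeff_mult)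
  moreover have "map_poly \<iota> (p + q) = map_poly \<iota> p + map_poly \<iota> q" for p q
    by (rule poly_eqI) simp
  moreover have "map_poly \<iota> 1 = 1"
    by (rule poly_eqI) (simp add: coeff_1)
  ultimately show ?thesis by (simp add: rhom_def)
qed

lemma map_poly_pderiv:
  fixes \<iota> :: "'k::field \<Rightarrow> 'l::field"
  assumes "rhom \<iota>"
  shows "map_poly \<iota> (pderiv f) = pderiv (map_poly \<iota> f)"
  by (rule poly_eqI) (simp add: coeff_pderiv coeff_map_poly rhom_of_nat[OF assms] rhomD[OF assms] del: of_nat_Suc)

text \<open>A common zero of \<open>f\<close> and \<open>f'\<close> would make the minimal polynomial of \<open>a\<close> a common divisor.\<close>

lemma separable_simple_root:
  fixes \<iota> :: "'k::field \<Rightarrow> 'l::field"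
  assumes \<iota>: "rhom \<iota>" and f: "f \<noteq> 0" "coprime f (pderiv f)" and root: "poly (map_poly \<iota> f) a = 0"
  shows "poly (pderiv (map_poly \<iota> f)) a \<noteq> 0"
proof
  assume d: "poly (pderiv (map_poly \<iota> f)) a = 0"
  let ?h = "\<lambda>p. poly (map_poly \<iota> p) a"
  note h = rhomD[OF rhom_poly_map_poly[OF \<iota>, of a]]
  obtain g where g: "g \<noteq> 0" "?h g = 0" and min: "\<And>g'. g' \<noteq> 0 \<Longrightarrow> ?h g' = 0 \<Longrightarrow> degree g \<le> degree g'"
    using ex_has_least_nat[of "\<lambda>g. g \<noteq> 0 \<and> ?h g = 0" f degree] f root by blast
  have dv: "g dvd p" if "?h p = 0" for p
  proof (rule ccontr)
    assume "\<not> g dvd p"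
    then have "p mod g \<noteq> 0" by (simp add: mod_eq_0_iff_dvd)
    then have "degree (p mod g) < degree g" using degree_mod_less[OF g(1), of p] \<open>p mod g \<noteq> 0\<close> by blast
    moreover have "?h (p mod g) = 0"
      using h(5)[of p "g * (p div g)"] that g(2) by (simp add: h(3) minus_mult_div_eq_mod)
    ultimately show False using min[OF \<open>p mod g \<noteq> 0\<close>] by linarith
  qed
  have "is_unit g"
  proof (rule coprime_common_divisor[OF f(2)])
    show "g dvd f" "g dvd pderiv f" using root d by (auto intro!: dv simp only: map_poly_pderiv[OF \<iota>])
  qed
  then obtain c where c: "g = [:c:]" by (auto simp: is_unit_poly_iff)
  then have "c \<noteq> 0" using g(1) by auto
  have "map_poly \<iota> g = [:\<iota> c:]" by (simp add: c map_poly_pCons rhom_0[OF \<iota>])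
  then have "\<iota> c = 0" using g(2) by simp
  then show False using rhom_field_inj[OF \<iota>] \<open>c \<noteq> 0\<close> by blast
qed

subsection \<open>Projections of a representation after separable base change\<close>

lemma act_add: "act B (\<lambda>i. x i + y i) A = (\<lambda>j. act B x A j + act B y A j)"
  by (rule ext) (simp add: act_def sum.distrib distrib_right)

lemma act_scale: "act B (\<lambda>i. c * x i) A = (\<lambda>j. c * act B x A j)"
  by (rule ext) (simp add: act_def sum_distrib_left mult.assoc)

lemma act_vecs: "act B x A \<in> vecs B"
  by (simp add: act_def vecs_def)

lemma act_zero: "act B (\<lambda>i. 0) A = (\<lambda>j. 0)"
  by (rule ext) (simp add: act_def)

lemma vecs_closed:
  "(\<lambda>i. 0) \<in> vecs B" "x \<in> vecs B \<Longrightarrow> y \<in> vecs B \<Longrightarrow> (\<lambda>i. x i + y i) \<in> vecs B"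
  "x \<in> vecs B \<Longrightarrow> (\<lambda>i. (c::'k::field) * x i) \<in> vecs B"
  "x \<in> vecs B \<Longrightarrow> y \<in> vecs B \<Longrightarrow> (\<lambda>i. x i - (y i::'k)) \<in> vecs B"
  by (auto simp: vecs_def)

lemma vec_subspaceD:
  assumes "vec_subspace B W"
  shows "W \<subseteq> vecs B" "(\<lambda>i. 0) \<in> W" "x \<in> W \<Longrightarrow> y \<in> W \<Longrightarrow> (\<lambda>i. x i + y i) \<in> W"
    "x \<in> W \<Longrightarrow> (\<lambda>i. c * x i) \<in> W" "x \<in> W \<Longrightarrow> y \<in> W \<Longrightarrow> (\<lambda>i. x i - y i) \<in> W"
proof -
  show a: "W \<subseteq> vecs B" "(\<lambda>i. 0) \<in> W" "x \<in> W \<Longrightarrow> y \<in> W \<Longrightarrow> (\<lambda>i. x i + y i) \<in> W"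
    "x \<in> W \<Longrightarrow> (\<lambda>i. c * x i) \<in> W" for c x y
    using assms by (auto simp: vec_subspace_def)
  show "x \<in> W \<Longrightarrow> y \<in> W \<Longrightarrow> (\<lambda>i. x i - y i) \<in> W"
    using a(3)[OF _ a(4)[of y "-1"], of x] by simp
qed

text \<open>Linearity over \<open>k\<close> is built in, linearity over the larger field only for
  the scalars in \<open>C\<close>; \<open>\<A>\<close> holds the operators over \<open>k\<close> to
  be respected.\<close>

definition base_change_projection ::
  "('k::field \<Rightarrow> 'l::field) \<Rightarrow> nat set \<Rightarrow> (nat \<Rightarrow> nat \<Rightarrow> 'k) set \<Rightarrow> (nat \<Rightarrow> 'l) set \<Rightarrow> 'l set
    \<Rightarrow> ((nat \<Rightarrow> 'l) \<Rightarrow> nat \<Rightarrow> 'l) \<Rightarrow> bool" where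
  "base_change_projection \<iota> B \<A> W C \<pi> \<longleftrightarrow>
     (\<forall>x\<in>vecs B. \<pi> x \<in> W) \<and> (\<forall>x\<in>W. \<pi> x = x) \<and>
     (\<forall>x\<in>vecs B. \<forall>y\<in>vecs B. \<pi> (\<lambda>i. x i + y i) = (\<lambda>i. \<pi> x i + \<pi> y i)) \<and>
     (\<forall>t. \<forall>x\<in>vecs B. \<pi> (\<lambda>i. \<iota> t * x i) = (\<lambda>i. \<iota> t * \<pi> x i)) \<and>
     (\<forall>a\<in>\<A>. \<forall>x\<in>vecs B. \<pi> (act B x (\<lambda>i j. \<iota> (a i j))) = act B (\<pi> x) (\<lambda>i j. \<iota> (a i j))) \<and>
     (\<forall>c\<in>C. \<forall>x\<in>vecs B. \<pi> (\<lambda>i. c * x i) = (\<lambda>i. c * \<pi> x i))"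

context
  fixes \<iota> :: "'k::field \<Rightarrow> 'l::field" and B :: "nat set" and \<A> :: "(nat \<Rightarrow> nat \<Rightarrow> 'k) set" and W :: "(nat \<Rightarrow> 'l) set"
  assumes \<iota>: "rhom \<iota>" and B: "finite B"
    and W: "vec_subspace B W"
    and W_stable: "\<And>w a. w \<in> W \<Longrightarrow> a \<in> \<A> \<Longrightarrow> act B w (\<lambda>i j. \<iota> (a i j)) \<in> W"
    and irreducible: "\<And>Y. vec_subspace B Y \<Longrightarrow> (\<And>y a. y \<in> Y \<Longrightarrow> a \<in> \<A> \<Longrightarrow> act B y a \<in> Y) \<Longrightarrow>
      Y = {\<lambda>i. 0} \<or> Y = vecs B"
begin

text \<open>
  The complement of \<open>W\<close> has the form \<open>k\<^sup>B \<otimes> M\<close> for a \<open>k\<close>-subspace \<open>M\<close> of the extension field,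
  maximal with the property that \<open>k\<^sup>B \<otimes> M\<close> meets \<open>W\<close> trivially.
\<close>

lemma projection_exists: "\<exists>\<pi>. base_change_projection \<iota> B \<A> W {} \<pi>"
proof -
  define ksub where "ksub D \<longleftrightarrow> (0::'l) \<in> D \<and> (\<forall>x\<in>D. \<forall>y\<in>D. x + y \<in> D) \<and> (\<forall>t. \<forall>x\<in>D. \<iota> t * x \<in> D)" for D
  define \<D> where "\<D> = {D. ksub D \<and> (\<forall>x\<in>W. (\<forall>i. x i \<in> D) \<longrightarrow> x = (\<lambda>i. 0))}"
  have "\<exists>M\<in>\<D>. \<forall>X\<in>\<D>. M \<subseteq> X \<longrightarrow> X = M"
  proof (rule subset_Zorn_nonempty)
    have "{0} \<in> \<D>" by (auto simp: \<D>_def ksub_def)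
    then show "\<D> \<noteq> {}" by blast
    fix \<C> assume ne: "\<C> \<noteq> {}" and ch: "subset.chain \<D> \<C>"
    have sub: "\<C> \<subseteq> \<D>" and lin: "\<And>X Y. X \<in> \<C> \<Longrightarrow> Y \<in> \<C> \<Longrightarrow> X \<subseteq> Y \<or> Y \<subseteq> X"
      using ch by (auto simp: subset_chain_def)
    have "ksub (\<Union>\<C>)"
      unfolding ksub_def
    proof (intro conjI ballI allI)
      show "0 \<in> \<Union>\<C>" using ne sub by (auto simp: \<D>_def ksub_def)
      fix x assume "x \<in> \<Union>\<C>"
      then obtain X where X: "X \<in> \<C>" "x \<in> X" by blast
      show "\<iota> t * x \<in> \<Union>\<C>" for t using X sub by (auto simp: \<D>_def ksub_def)
      fix y assume "y \<in> \<Union>\<C>"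
      then obtain Y where Y: "Y \<in> \<C>" "y \<in> Y" by blast
      obtain Z where Z: "Z \<in> \<C>" "x \<in> Z" "y \<in> Z" using lin[OF X(1) Y(1)] X Y by blast
      then have "x + y \<in> Z" using sub by (auto simp: \<D>_def ksub_def)
      then show "x + y \<in> \<Union>\<C>" using Z(1) by blast
    qed
    \<comment> \<open>A vector has finitely many nonzero coordinates, so a single member of the
      chain contains them all.\<close>
    moreover have "x = (\<lambda>i. 0)" if x: "x \<in> W" "\<forall>i. x i \<in> \<Union>\<C>" for x
    proof -
      have "finite (x ` B)" "x ` B \<subseteq> \<Union>\<C>" using B x(2) by auto
      then obtain X where X: "X \<in> \<C>" "x ` B \<subseteq> X"
        using finite_subset_Union_chain[of "x ` B" \<C> \<D>] ne ch by blast
      have "x i \<in> X" for i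
      proof (cases "i \<in> B")
        case False
        then have "x i = 0" using x(1) vec_subspaceD(1)[OF W] by (auto simp: vecs_def)
        then show ?thesis using X(1) sub by (auto simp: \<D>_def ksub_def)
      qed (use X in auto)
      then show ?thesis using X(1) sub x(1) by (auto simp: \<D>_def)
    qed
    ultimately show "\<Union>\<C> \<in> \<D>" by (auto simp: \<D>_def)
  qed
  then obtain M where M: "M \<in> \<D>" and max: "\<And>X. X \<in> \<D> \<Longrightarrow> M \<subseteq> X \<Longrightarrow> X = M" by blast
  have M0: "0 \<in> M" and Madd: "\<And>x y. x \<in> M \<Longrightarrow> y \<in> M \<Longrightarrow> x + y \<in> M" and Mscale: "\<And>t x. x \<in> M \<Longrightarrow> \<iota> t * x \<in> M"
    and MW: "\<And>x. x \<in> W \<Longrightarrow> (\<And>i. x i \<in> M) \<Longrightarrow> x = (\<lambda>i. 0)"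
    using M by (auto simp: \<D>_def ksub_def)
  have Mneg: "- x \<in> M" if "x \<in> M" for x using Mscale[OF that, of "-1"] by (simp add: rhomD[OF \<iota>])
  have Mdiff: "x - y \<in> M" if "x \<in> M" "y \<in> M" for x y using Madd[OF that(1) Mneg[OF that(2)]] by simp
  have Msum: "sum f F \<in> M" if "\<And>i. i \<in> F \<Longrightarrow> f i \<in> M" for f :: "nat \<Rightarrow> 'l" and F
    using that by (induction F rule: infinite_finite_induct) (auto simp: M0 Madd)
  \<comment> \<open>\<open>T\<close> is the sum of \<open>W\<close> and the vectors with coordinates
    in \<open>M\<close>; the aim is to show that it is the whole space.\<close>
  define T where "T = {x \<in> vecs B. \<exists>w\<in>W. \<forall>i. x i - w i \<in> M}"
  have T0: "(\<lambda>i. 0) \<in> T" unfolding T_def using vec_subspaceD(2)[OF W] M0 by (auto simp: vecs_closed intro!: bexI[of _ "\<lambda>i. 0"])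
  have Tadd: "(\<lambda>i. x i + y i) \<in> T" if xy: "x \<in> T" "y \<in> T" for x y
  proof -
    obtain w v where w: "w \<in> W" "\<And>i. x i - w i \<in> M" and v: "v \<in> W" "\<And>i. y i - v i \<in> M"
      using xy by (auto simp: T_def)
    have "x i + y i - (w i + v i) \<in> M" for i using Madd[OF w(2) v(2), of i i] by (simp add: algebra_simps)
    moreover have "(\<lambda>i. x i + y i) \<in> vecs B" using xy by (simp add: T_def vecs_closed)
    ultimately show ?thesis using vec_subspaceD(3)[OF W w(1) v(1)]
      by (auto simp: T_def intro!: bexI[of _ "\<lambda>i. w i + v i"])
  qed
  \<comment> \<open>The pure tensors span the whole space. For fixed \<open>c\<close> the admissible
    \<open>v\<close> form an invariant subspace over \<open>k\<close>, so by irreducibility one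
    nonzero \<open>v\<close> is enough when \<open>c\<close> is outside \<open>M\<close>.\<close>
  have simple: "(\<lambda>i. c * \<iota> (v i)) \<in> T" if v: "v \<in> vecs B" for c v
  proof -
    let ?Y = "{v \<in> vecs B. (\<lambda>i. c * \<iota> (v i)) \<in> T}"
    have sub: "vec_subspace B ?Y"
      unfolding vec_subspace_def
    proof (intro conjI ballI allI)
      show "(\<lambda>i. 0) \<in> ?Y" using T0 by (simp add: vecs_closed rhom_0[OF \<iota>])
      fix y assume y: "y \<in> ?Y"
      show "(\<lambda>i. y i + z i) \<in> ?Y" if "z \<in> ?Y" for z
        using y that Tadd by (simp add: vecs_closed rhom_add[OF \<iota>] distrib_left)
      obtain w where w: "w \<in> W" "\<And>i. c * \<iota> (y i) - w i \<in> M" using y by (auto simp: T_def)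
      show "(\<lambda>i. t * y i) \<in> ?Y" for t
      proof -
        have "c * \<iota> (t * y i) - \<iota> t * w i \<in> M" for i
          using Mscale[OF w(2), of t i] by (simp add: rhom_mult[OF \<iota>] algebra_simps)
        moreover have "(\<lambda>i. c * \<iota> (t * y i)) \<in> vecs B" using y by (auto simp: vecs_def rhomD[OF \<iota>])
        ultimately show ?thesis using y vec_subspaceD(4)[OF W w(1)]
          by (auto simp: T_def vecs_closed intro!: bexI[of _ "\<lambda>i. \<iota> t * w i"])
      qed
    qed auto
    have st: "act B y a \<in> ?Y" if y: "y \<in> ?Y" and a: "a \<in> \<A>" for y a
    proof -
      obtain w where w: "w \<in> W" "\<And>i. c * \<iota> (y i) - w i \<in> M" using y by (auto simp: T_def)
      have e: "c * \<iota> (act B y a j) - act B w (\<lambda>i j. \<iota> (a i j)) j \<in> M" for j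
      proof (cases "j \<in> B")
        case True
        then have "c * \<iota> (act B y a j) - act B w (\<lambda>i j. \<iota> (a i j)) j = (\<Sum>i\<in>B. \<iota> (a i j) * (c * \<iota> (y i) - w i))"
          by (simp add: act_def rhomD[OF \<iota>] sum_distrib_left sum_subtractf algebra_simps)
        then show ?thesis by (simp only:) (intro Msum Mscale w)
      qed (simp add: act_def rhom_0[OF \<iota>] M0)
      moreover have "(\<lambda>i. c * \<iota> (act B y a i)) \<in> vecs B" by (auto simp: vecs_def act_def rhomD[OF \<iota>])
      ultimately show ?thesis using W_stable[OF w(1) a] by (auto simp: T_def act_vecs)
    qed
    have "?Y = vecs B"
    proof (cases "c \<in> M")
      case True
      have "(\<lambda>i. c * \<iota> (v i)) \<in> T" if "v \<in> vecs B" for v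
        using that vec_subspaceD(2)[OF W] Mscale[OF True]
        by (auto simp: T_def vecs_def rhom_0[OF \<iota>] mult.commute[of c] intro!: bexI[of _ "\<lambda>i. 0"])
      then show ?thesis by auto
    next
      case False
      \<comment> \<open>By maximality of \<open>M\<close>, enlarging it by \<open>c\<close> produces
        a nonzero vector of \<open>W\<close> with coordinates in \<open>D\<close>. Its coefficients
        at \<open>c\<close> give the nonzero \<open>s\<close>: were they all zero, that vector would
        already have coordinates in \<open>M\<close>.\<close>
      define D where "D = {d + \<iota> t * c | d t. d \<in> M}"
      have Dmem: "d + \<iota> t * c \<in> D" if "d \<in> M" for d t using that unfolding D_def by blast
      have MD: "M \<subseteq> D"
      proof
        fix d assume "d \<in> M" then show "d \<in> D" using Dmem[of d 0] by (simp add: rhom_0[OF \<iota>])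
      qed
      have cD: "c \<in> D" using Dmem[OF M0, of 1] by (simp add: rhom_1[OF \<iota>])
      have "ksub D"
        unfolding ksub_def
      proof (intro conjI ballI allI)
        show "0 \<in> D" using MD M0 by blast
        fix x assume "x \<in> D"
        then obtain d t where x: "x = d + \<iota> t * c" "d \<in> M" unfolding D_def by blast
        show "\<iota> s * x \<in> D" for s
          using Dmem[OF Mscale[OF x(2)], of s "s * t"] x by (simp add: rhom_mult[OF \<iota>] algebra_simps)
        fix y assume "y \<in> D"
        then obtain e s where y: "y = e + \<iota> s * c" "e \<in> M" unfolding D_def by blast
        show "x + y \<in> D"
          using Dmem[OF Madd[OF x(2) y(2)], of "t + s"] x y by (simp add: rhom_add[OF \<iota>] algebra_simps)
      qed
      moreover have "D \<notin> \<D>" using max[of D] MD cD False by blast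
      ultimately obtain x where x: "x \<in> W" "\<And>i. x i \<in> D" "x \<noteq> (\<lambda>i. 0)" by (auto simp: \<D>_def)
      have "\<exists>d t. d \<in> M \<and> x i = d + \<iota> t * c" for i using x(2)[of i] by (auto simp: D_def)
      then obtain d t where dt: "\<And>i. d i \<in> M" "\<And>i. x i = d i + \<iota> (t i) * c" by metis
      define s where "s = (\<lambda>i. if i \<in> B then t i else 0)"
      have x0: "x i = 0" if "i \<notin> B" for i using x(1) vec_subspaceD(1)[OF W] that by (auto simp: vecs_def)
      have "c * \<iota> (s i) - x i \<in> M" for i
        using Mneg[OF dt(1)[of i]] x0[of i] M0 by (auto simp: s_def dt(2) rhom_0[OF \<iota>] mult.commute)
      then have "\<exists>w\<in>W. \<forall>i. c * \<iota> (s i) - w i \<in> M" using x(1) by blast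
      moreover have "s \<in> vecs B" "(\<lambda>i. c * \<iota> (s i)) \<in> vecs B" by (auto simp: vecs_def s_def rhom_0[OF \<iota>])
      ultimately have "s \<in> ?Y" by (simp add: T_def)
      moreover have "s \<noteq> (\<lambda>i. 0)"
      proof
        assume s0: "s = (\<lambda>i. 0)"
        have "x i \<in> M" for i
        proof (cases "i \<in> B")
          case True
          then have "t i = 0" using fun_cong[OF s0, of i] by (simp add: s_def)
          then show ?thesis using dt(1)[of i] unfolding dt(2) by (simp add: rhom_0[OF \<iota>])
        qed (simp add: x0 M0)
        then show False using MW[OF x(1)] x(3) by blast
      qed
      ultimately show ?thesis using irreducible[OF sub st] by blast
    qed
    then show ?thesis using v by blast
  qed
  have Tall: "x \<in> T" if x: "x \<in> vecs B" for x
  proof -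
    have "(\<lambda>i. if i \<in> F then x i else 0) \<in> T" if "finite F" "F \<subseteq> B" for F
      using that
    proof (induction F)
      case empty
      show ?case using T0 by simp
    next
      case (insert j F)
      have "(\<lambda>i. x j * \<iota> (if i = j then 1 else 0)) \<in> T"
        using insert by (intro simple) (auto simp: vecs_def)
      from Tadd[OF this insert.IH] insert
      have "(\<lambda>i. x j * \<iota> (if i = j then 1 else 0) + (if i \<in> F then x i else 0)) \<in> T" by auto
      moreover have "(\<lambda>i. x j * \<iota> (if i = j then 1 else 0) + (if i \<in> F then x i else 0)) = (\<lambda>i. if i \<in> insert j F then x i else 0)"
        using insert(2) by (auto simp: rhomD[OF \<iota>])
      ultimately show ?case by simp
    qed
    from this[OF B] have "(\<lambda>i. if i \<in> B then x i else 0) \<in> T" by simp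
    moreover have "(\<lambda>i. if i \<in> B then x i else 0) = x" using x by (auto simp: vecs_def)
    ultimately show ?thesis by simp
  qed
  \<comment> \<open>The choice is unique, as \<open>W\<close> and the vectors over \<open>M\<close>
    meet only in zero; all equations for the projection follow from this uniqueness.\<close>
  define \<pi> where "\<pi> x = (SOME w. w \<in> W \<and> (\<forall>i. x i - w i \<in> M))" for x
  have \<pi>: "\<pi> x \<in> W" "\<And>i. x i - \<pi> x i \<in> M" if "x \<in> vecs B" for x
  proof -
    have "\<exists>w. w \<in> W \<and> (\<forall>i. x i - w i \<in> M)" using Tall[OF that] by (auto simp: T_def)
    from someI_ex[OF this] show "\<pi> x \<in> W" "\<And>i. x i - \<pi> x i \<in> M" by (auto simp: \<pi>_def)
  qed
  have \<pi>_eq: "\<pi> x = w" if x: "x \<in> vecs B" and w: "w \<in> W" "\<And>i. x i - w i \<in> M" for x w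
  proof -
    have "w i - \<pi> x i \<in> M" for i
      using Mdiff[OF \<pi>(2)[OF x] w(2), of i i] by simp
    then have "(\<lambda>i. w i - \<pi> x i) = (\<lambda>i. 0)"
      using MW[OF vec_subspaceD(5)[OF W w(1) \<pi>(1)[OF x]]] by blast
    then show ?thesis by (simp add: fun_eq_iff)
  qed
  have "base_change_projection \<iota> B \<A> W {} \<pi>"
    unfolding base_change_projection_def
  proof (intro conjI ballI allI)
    fix x :: "nat \<Rightarrow> 'l" assume x: "x \<in> vecs B"
    show "\<pi> x \<in> W" using \<pi>[OF x] by simp
    show "\<pi> (\<lambda>i. x i + y i) = (\<lambda>i. \<pi> x i + \<pi> y i)" if y: "y \<in> vecs B" for y
    proof (rule \<pi>_eq)
      show "x i + y i - (\<pi> x i + \<pi> y i) \<in> M" for i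
        using Madd[OF \<pi>(2)[OF x] \<pi>(2)[OF y], of i i] by (simp add: algebra_simps)
    qed (use x y \<pi> in \<open>auto intro!: vecs_closed vec_subspaceD[OF W]\<close>)
    show "\<pi> (\<lambda>i. \<iota> t * x i) = (\<lambda>i. \<iota> t * \<pi> x i)" for t
    proof (rule \<pi>_eq)
      show "\<iota> t * x i - \<iota> t * \<pi> x i \<in> M" for i
        using Mscale[OF \<pi>(2)[OF x], of t i] by (simp add: algebra_simps)
    qed (use x \<pi> in \<open>auto intro!: vecs_closed vec_subspaceD[OF W]\<close>)
    show "\<pi> (act B x (\<lambda>i j. \<iota> (a i j))) = act B (\<pi> x) (\<lambda>i j. \<iota> (a i j))" if a: "a \<in> \<A>" for a
    proof (rule \<pi>_eq)
      show "act B x (\<lambda>i j. \<iota> (a i j)) j - act B (\<pi> x) (\<lambda>i j. \<iota> (a i j)) j \<in> M" for j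
      proof (cases "j \<in> B")
        case True
        then have "act B x (\<lambda>i j. \<iota> (a i j)) j - act B (\<pi> x) (\<lambda>i j. \<iota> (a i j)) j = (\<Sum>i\<in>B. \<iota> (a i j) * (x i - \<pi> x i))"
          by (simp add: act_def sum_subtractf algebra_simps)
        then show ?thesis by (simp only:) (intro Msum Mscale \<pi>[OF x])
      qed (simp add: act_def M0)
    qed (use x \<pi> a in \<open>auto intro!: act_vecs W_stable\<close>)
  next
    fix w assume w: "w \<in> W"
    then show "\<pi> w = w" using vec_subspaceD(1)[OF W] by (intro \<pi>_eq) (auto simp: M0)
  qed auto
  then show ?thesis by blast
qed

text \<open>
  If \<open>f(X) = (X - c) \<Sum>\<^sub>s b\<^sub>s X\<^sup>s\<close> with \<open>f\<close> over \<open>k\<close>, then \<open>\<Sum>\<^sub>s b\<^sub>s \<otimes> c\<^sup>s\<close>, divided by \<open>f'(c)\<close>, is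
  the separability idempotent of \<open>k(c)/k\<close>. Averaging a \<open>k\<close>-linear projection over it makes the
  projection commute with \<open>c\<close>.
\<close>

lemma projection_average:
  assumes p: "base_change_projection \<iota> B \<A> W C \<pi>"
    and f: "poly (map_poly \<iota> f) c = 0" "poly (pderiv (map_poly \<iota> f)) c \<noteq> 0"
  shows "\<exists>\<pi>'. base_change_projection \<iota> B \<A> W (insert c C) \<pi>'"
proof -
  note pd = p[unfolded base_change_projection_def]
  have \<pi>W: "\<And>x. x \<in> vecs B \<Longrightarrow> \<pi> x \<in> W" and \<pi>fix: "\<And>x. x \<in> W \<Longrightarrow> \<pi> x = x"
    and \<pi>add: "\<And>x y. x \<in> vecs B \<Longrightarrow> y \<in> vecs B \<Longrightarrow> \<pi> (\<lambda>i. x i + y i) = (\<lambda>i. \<pi> x i + \<pi> y i)"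
    and \<pi>scale: "\<And>t x. x \<in> vecs B \<Longrightarrow> \<pi> (\<lambda>i. \<iota> t * x i) = (\<lambda>i. \<iota> t * \<pi> x i)"
    and \<pi>A: "\<And>a x. a \<in> \<A> \<Longrightarrow> x \<in> vecs B \<Longrightarrow> \<pi> (act B x (\<lambda>i j. \<iota> (a i j))) = act B (\<pi> x) (\<lambda>i j. \<iota> (a i j))"
    and \<pi>C: "\<And>e x. e \<in> C \<Longrightarrow> x \<in> vecs B \<Longrightarrow> \<pi> (\<lambda>i. e * x i) = (\<lambda>i. e * \<pi> x i)"
    using pd by blast+
  define F where "F = map_poly \<iota> f"
  \<comment> \<open>The coefficients of \<open>q\<close> are the scalars \<open>b\<^sub>s\<close> of
    the idempotent, and \<open>d = q(c)\<close> is the derivative of \<open>F\<close> at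
    \<open>c\<close>.\<close>
  define q where "q = synthetic_div F c"
  define d where "d = poly q c"
  define N where "N = degree F"
  have F: "F = [:-c, 1:] * q"
    using synthetic_div_correct'[of c F] f(1) by (simp add: q_def F_def)
  have "pderiv F = [:-c, 1:] * pderiv q + q"
    unfolding F pderiv_mult by (simp add: pderiv_pCons)
  then have d0: "d \<noteq> 0" using f(2) by (simp add: F_def[symmetric] d_def)
  have dq: "degree q \<le> N" by (simp add: q_def N_def degree_synthetic_div)
  have deg: "coeff F s = 0" if "s > N" for s using that by (simp add: N_def coeff_eq_0)
  have qN: "coeff q s = 0" if "s > N" for s using that dq by (simp add: coeff_eq_0)
  have cF: "coeff F s = \<iota> (coeff f s)" for s by (simp add: F_def coeff_map_poly rhom_0[OF \<iota>])
  have F0: "coeff F 0 = - c * coeff q 0" and FS: "\<And>s. coeff F (Suc s) = coeff q s - c * coeff q (Suc s)"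
    by (simp_all add: F)
  \<comment> \<open>In coordinates, this says that \<open>c \<otimes> 1 - 1 \<otimes> c\<close>
    kills the idempotent: by \<open>F = (X - c) q\<close>, raising the index of \<open>u\<close>
    multiplies the sum by \<open>c\<close>, up to the sum assumed to vanish.\<close>
  have shift: "(\<Sum>s\<le>N. coeff q s * u (Suc s)) = c * (\<Sum>s\<le>N. coeff q s * u s)"
    if u: "(\<Sum>s\<le>N. coeff F s * u s) = 0" for u
  proof -
    have "0 = (\<Sum>s\<le>Suc N. coeff F s * u s)" using u deg[of "Suc N"] by simp
    also have "\<dots> = coeff F 0 * u 0 + (\<Sum>s\<le>N. coeff F (Suc s) * u (Suc s))" by (rule sum.atMost_Suc_shift)
    also have "\<dots> = (\<Sum>s\<le>N. coeff q s * u (Suc s)) - c * (coeff q 0 * u 0 + (\<Sum>s\<le>N. coeff q (Suc s) * u (Suc s)))"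
      by (simp add: F0 FS left_diff_distrib sum_subtractf sum_distrib_left distrib_left mult.assoc)
    also have "coeff q 0 * u 0 + (\<Sum>s\<le>N. coeff q (Suc s) * u (Suc s)) = (\<Sum>s\<le>Suc N. coeff q s * u s)"
      by (rule sum.atMost_Suc_shift[symmetric])
    also have "\<dots> = (\<Sum>s\<le>N. coeff q s * u s)" using qN[of "Suc N"] by simp
    finally show ?thesis by simp
  qed
  have vc: "(\<lambda>i. e * x i) \<in> vecs B" if "x \<in> vecs B" for e and x :: "nat \<Rightarrow> 'l" using that by (rule vecs_closed)
  have \<pi>0: "\<pi> (\<lambda>i. 0) = (\<lambda>i. 0)" using \<pi>fix[OF vec_subspaceD(2)[OF W]] .
  have \<pi>sum: "\<pi> (\<lambda>i. \<Sum>s\<in>S. \<iota> (t s) * y s i) = (\<lambda>i. \<Sum>s\<in>S. \<iota> (t s) * \<pi> (y s) i)"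
    if S: "finite S" and y: "\<And>s. y s \<in> vecs B" for S :: "nat set" and t y
    using S
  proof (induction S)
    case empty
    show ?case by (simp add: \<pi>0)
  next
    case (insert r S)
    have "(\<lambda>i. \<Sum>s\<in>S. \<iota> (t s) * y s i) \<in> vecs B" using y by (auto simp: vecs_def)
    then show ?case using insert by (simp add: \<pi>add vc y \<pi>scale)
  qed
  \<comment> \<open>The sum is \<pi> applied to \<open>F(c) x = 0\<close>. Linearity over
    \<open>k\<close> is enough for this, since \<open>F\<close> has its coefficients in
    \<open>k\<close>.\<close>
  have u0: "(\<Sum>s\<le>N. coeff F s * \<pi> (\<lambda>i. c ^ s * x i) i) = 0" if x: "x \<in> vecs B" for x i
  proof -
    have "(\<lambda>i. \<Sum>s\<le>N. coeff F s * \<pi> (\<lambda>i. c ^ s * x i) i) = \<pi> (\<lambda>i. \<Sum>s\<le>N. coeff F s * (c ^ s * x i))"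
      unfolding cF by (subst \<pi>sum) (auto intro: vc x)
    also have "(\<lambda>i. \<Sum>s\<le>N. coeff F s * (c ^ s * x i)) = (\<lambda>i. poly F c * x i)"
      by (simp add: poly_altdef N_def sum_distrib_right mult.assoc)
    also have "\<dots> = (\<lambda>i. 0)" using f(1) by (simp add: F_def)
    finally show ?thesis by (simp add: \<pi>0 fun_eq_iff)
  qed
  \<comment> \<open>On \<open>W\<close>, where \<pi> is the identity, the sum is multiplication by
    \<open>q(c) = d\<close>; the factor \<open>inverse d\<close> therefore keeps \<open>W\<close>
    fixed pointwise.\<close>
  define \<rho> where "\<rho> x = (\<lambda>i. inverse d * (\<Sum>s\<le>N. coeff q s * \<pi> (\<lambda>i. c ^ s * x i) i))" for x
  have Wsum: "(\<lambda>i. \<Sum>s\<in>S. t s * y s i) \<in> W" if "finite S" "\<And>s. y s \<in> W" for S :: "nat set" and t y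
    using that(1) by (induction S) (auto intro!: vec_subspaceD[OF W] that(2) simp: vec_subspaceD(2)[OF W])
  have "base_change_projection \<iota> B \<A> W (insert c C) \<rho>"
    unfolding base_change_projection_def
  proof (intro conjI ballI allI)
    fix x :: "nat \<Rightarrow> 'l" assume x: "x \<in> vecs B"
    show "\<rho> x \<in> W" unfolding \<rho>_def by (intro vec_subspaceD(4)[OF W] Wsum \<pi>W vc x) simp
    show "\<rho> (\<lambda>i. x i + y i) = (\<lambda>i. \<rho> x i + \<rho> y i)" if y: "y \<in> vecs B" for y
      unfolding \<rho>_def by (simp add: distrib_left \<pi>add vc x y sum.distrib)
    show "\<rho> (\<lambda>i. \<iota> t * x i) = (\<lambda>i. \<iota> t * \<rho> x i)" for t
    proof -
      have "\<pi> (\<lambda>i. c ^ s * (\<iota> t * x i)) = (\<lambda>i. \<iota> t * \<pi> (\<lambda>i. c ^ s * x i) i)" for s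
        using \<pi>scale[OF vc[OF x, of "c ^ s"], of t] by (simp add: mult.left_commute)
      then show ?thesis unfolding \<rho>_def by (simp add: sum_distrib_left mult_ac)
    qed
    show "\<rho> (act B x (\<lambda>i j. \<iota> (a i j))) = act B (\<rho> x) (\<lambda>i j. \<iota> (a i j))" if a: "a \<in> \<A>" for a
    proof (rule ext)
      fix j
      have 1: "\<pi> (\<lambda>i. c ^ s * act B x (\<lambda>i j. \<iota> (a i j)) i) = act B (\<pi> (\<lambda>i. c ^ s * x i)) (\<lambda>i j. \<iota> (a i j))" for s
        using \<pi>A[OF a vc[OF x, of "c ^ s"]] by (simp add: act_scale)
      have "\<rho> (act B x (\<lambda>i j. \<iota> (a i j))) j = inverse d * (\<Sum>s\<le>N. coeff q s * act B (\<pi> (\<lambda>i. c ^ s * x i)) (\<lambda>i j. \<iota> (a i j)) j)"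
        unfolding \<rho>_def 1 ..
      also have "\<dots> = act B (\<rho> x) (\<lambda>i j. \<iota> (a i j)) j"
      proof (cases "j \<in> B")
        case True
        have "(\<Sum>s\<le>N. coeff q s * (\<Sum>i\<in>B. \<pi> (\<lambda>i. c ^ s * x i) i * \<iota> (a i j))) =
          (\<Sum>i\<in>B. (\<Sum>s\<le>N. coeff q s * \<pi> (\<lambda>i. c ^ s * x i) i) * \<iota> (a i j))"
          by (simp add: sum_distrib_left sum_distrib_right mult.assoc sum.swap[of _ "{..N}" B])
        then have "inverse d * (\<Sum>s\<le>N. coeff q s * (\<Sum>i\<in>B. \<pi> (\<lambda>i. c ^ s * x i) i * \<iota> (a i j))) =
          (\<Sum>i\<in>B. inverse d * (\<Sum>s\<le>N. coeff q s * \<pi> (\<lambda>i. c ^ s * x i) i) * \<iota> (a i j))"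
          by (simp only: sum_distrib_left[of "inverse d" _ B] mult.assoc)
        then show ?thesis using True unfolding act_def \<rho>_def by simp
      qed (simp add: act_def)
      finally show "\<rho> (act B x (\<lambda>i j. \<iota> (a i j))) j = act B (\<rho> x) (\<lambda>i j. \<iota> (a i j)) j" .
    qed
    show "\<rho> (\<lambda>i. e * x i) = (\<lambda>i. e * \<rho> x i)" if e: "e \<in> insert c C" for e
    proof (cases "e = c")
      case True
      have "(\<Sum>s\<le>N. coeff q s * \<pi> (\<lambda>i. c ^ s * (c * x i)) i) = c * (\<Sum>s\<le>N. coeff q s * \<pi> (\<lambda>i. c ^ s * x i) i)" for i
        using shift[OF u0[OF x, of i]] by (simp add: mult_ac)
      then show ?thesis unfolding \<rho>_def True by (simp add: mult_ac)
    next
      case False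
      have "\<pi> (\<lambda>i. c ^ s * (e * x i)) = (\<lambda>i. e * \<pi> (\<lambda>i. c ^ s * x i) i)" for s
        using \<pi>C[OF _ vc[OF x, of "c ^ s"], of e] e False by (simp add: mult.left_commute)
      then show ?thesis unfolding \<rho>_def by (simp add: sum_distrib_left mult_ac)
    qed
  next
    fix w assume w: "w \<in> W"
    have "(\<Sum>s\<le>N. coeff q s * \<pi> (\<lambda>i. c ^ s * w i) i) = d * w i" for i
    proof -
      have "(\<Sum>s\<le>N. coeff q s * \<pi> (\<lambda>i. c ^ s * w i) i) = (\<Sum>s\<le>N. coeff q s * c ^ s) * w i"
        by (simp add: \<pi>fix vec_subspaceD(4)[OF W w] sum_distrib_right mult.assoc)
      also have "(\<Sum>s\<le>N. coeff q s * c ^ s) = d"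
        unfolding d_def poly_altdef using dq qN
        by (intro sum.mono_neutral_right) (auto simp: coeff_eq_0)
      finally show ?thesis .
    qed
    then show "\<rho> w = w" unfolding \<rho>_def using d0 by (auto simp: mult.assoc[symmetric])
  qed
  then show ?thesis by blast
qed

lemma commuting_projection_exists:
  assumes sep: "\<And>c. \<exists>f. poly (map_poly \<iota> f) c = 0 \<and> poly (pderiv (map_poly \<iota> f)) c \<noteq> 0" and C: "finite C"
  shows "\<exists>\<pi>. base_change_projection \<iota> B \<A> W C \<pi>"
  using C
proof (induction C)
  case empty
  show ?case by (rule projection_exists)
next
  case (insert c C)
  then show ?case using projection_average sep by meson
qed

end

subsection \<open>Base change\<close>

lemma field_embedding_iff_rhom: "field_embedding \<iota> \<longleftrightarrow> rhom \<iota>"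
  by (simp add: field_embedding_def rhom_def)

context
  fixes \<iota> :: "'k::field \<Rightarrow> 'l::field"
  assumes \<iota>: "rhom \<iota>"
begin

abbreviation bc :: "('v, 'k) mpoly set \<Rightarrow> ('v, 'l) mpoly set" where
  "bc \<equiv> base_change_scheme \<iota>"

lemma map_coeffs_simps:
  "map_coeffs \<iota> (1 :: ('v, 'k) mpoly) = 1" "map_coeffs \<iota> (0 :: ('v, 'k) mpoly) = 0"
  "map_coeffs \<iota> (p + q :: ('v, 'k) mpoly) = map_coeffs \<iota> p + map_coeffs \<iota> q"
  "map_coeffs \<iota> (p - q :: ('v, 'k) mpoly) = map_coeffs \<iota> p - map_coeffs \<iota> q"
  "map_coeffs \<iota> (p * q :: ('v, 'k) mpoly) = map_coeffs \<iota> p * map_coeffs \<iota> q"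
  "map_coeffs \<iota> (\<Sum>x\<in>A. f x :: ('v, 'k) mpoly) = (\<Sum>x\<in>A. map_coeffs \<iota> (f x))"
  "map_coeffs \<iota> (Const c :: ('v, 'k) mpoly) = Const (\<iota> c)"
  "map_coeffs \<iota> (Var v :: ('v, 'k) mpoly) = Var v"
  "map_coeffs \<iota> (of_bool P :: ('v, 'k) mpoly) = of_bool P"
  by (simp_all add: rhomD[OF rhom_map_coeffs[OF \<iota>]] rhom_0[OF \<iota>] map_coeffs_Var[OF \<iota>] of_bool_def)

lemma bc_ideal: "is_ideal (bc I)"
  by (simp add: base_change_scheme_def ideal_gen_ideal)

lemma bc_mem: "p \<in> I \<Longrightarrow> map_coeffs \<iota> p \<in> bc I"
  by (auto simp: base_change_scheme_def intro: ideal_gen_base)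

lemma bc_least: "is_ideal K \<Longrightarrow> (\<And>p. p \<in> I \<Longrightarrow> map_coeffs \<iota> p \<in> K) \<Longrightarrow> bc I \<subseteq> K"
  unfolding base_change_scheme_def by (rule ideal_gen_least) auto

lemma bc_mono: "I \<subseteq> J \<Longrightarrow> bc I \<subseteq> bc J"
  by (rule bc_least[OF bc_ideal]) (auto intro: bc_mem)

lemma bc_eqm: "eqm I p q \<Longrightarrow> eqm (bc I) (map_coeffs \<iota> p) (map_coeffs \<iota> q)"
  using bc_mem[of "p - q" I] by (simp add: eqm_def map_coeffs_simps)

text \<open>Generators go to generators. This inclusion carries congruences on products over to the
  base change.\<close>

lemma bc_prod_scheme: "bc (prod_scheme I J) \<subseteq> prod_scheme (bc I) (bc J)"
proof (rule bc_least)
  fix p assume p: "p \<in> prod_scheme I J"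
  show "map_coeffs \<iota> p \<in> prod_scheme (bc I) (bc J)"
    by (rule rhom_prod_scheme_subset[OF rhom_map_coeffs[OF \<iota>] _ _ _ p])
       (simp_all add: map_coeffs_subst[OF \<iota>] map_coeffs_Var[OF \<iota>] prod_scheme_pr1 prod_scheme_pr2 bc_mem)
qed simp

lemma bc_morphism: "morphism I J f \<Longrightarrow> morphism (bc I) (bc J) (\<lambda>w. map_coeffs \<iota> (f w))"
proof -
  assume f: "morphism I J f"
  have "subst (\<lambda>w. map_coeffs \<iota> (f w)) q \<in> bc I" if q: "q \<in> bc J" for q
  proof (rule rhom_ideal_gen_subset[OF rhom_eval_mpoly[OF rhom_Const] bc_ideal _ q[unfolded base_change_scheme_def]])
    fix x assume "x \<in> map_coeffs \<iota> ` J"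
    then obtain p where "x = map_coeffs \<iota> p" "p \<in> J" by blast
    then show "subst (\<lambda>w. map_coeffs \<iota> (f w)) x \<in> bc I"
      using f bc_mem[of "subst f p" I] by (simp only: map_coeffs_subst[OF \<iota>] morphism_def)
  qed
  then show ?thesis by (simp only: morphism_def) blast
qed

lemma bc_eqm_prod: "eqm (prod_scheme I J) p q \<Longrightarrow> eqm (prod_scheme (bc I) (bc J)) (map_coeffs \<iota> p) (map_coeffs \<iota> q)"
  by (rule eqm_mono[OF bc_prod_scheme bc_eqm])

lemma bc_pmult: "map_coeffs \<iota> (pmult G a b v) = pmult (base_change_group \<iota> G) (\<lambda>v. map_coeffs \<iota> (a v)) (\<lambda>v. map_coeffs \<iota> (b v)) v"
proof -
  have "(\<lambda>w. map_coeffs \<iota> (case_sum a b w)) = case_sum (\<lambda>v. map_coeffs \<iota> (a v)) (\<lambda>v. map_coeffs \<iota> (b v))"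
    by (rule ext) (auto split: sum.split)
  then show ?thesis by (simp add: pmult_apply map_coeffs_subst[OF \<iota>] base_change_group_def)
qed

lemma bc_pinv: "map_coeffs \<iota> (pinv G a v) = pinv (base_change_group \<iota> G) (\<lambda>v. map_coeffs \<iota> (a v)) v"
  by (simp add: pinv_apply map_coeffs_subst[OF \<iota>] base_change_group_def)

lemma bc_punit: "map_coeffs \<iota> (punit G v) = punit (base_change_group \<iota> G) v"
  by (simp add: punit_def map_coeffs_simps base_change_group_def)

lemma bc_counit: "eval_mpoly id (gunit (base_change_group \<iota> G)) (map_coeffs \<iota> p) = \<iota> (eval_mpoly id (gunit G) p)"
  by (simp add: base_change_group_def map_coeffs_eval[OF \<iota>])

lemma bc_counit_zero:
  assumes "\<And>p. p \<in> I \<Longrightarrow> eval_mpoly id (gunit G) p = 0" and "p \<in> bc I"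
  shows "eval_mpoly id (gunit (base_change_group \<iota> G)) p = 0"
proof -
  have z: "is_ideal {0 :: 'l}" by (rule is_idealI) auto
  have "eval_mpoly id (gunit (base_change_group \<iota> G)) p \<in> {0}"
    by (rule rhom_ideal_gen_subset[OF rhom_eval_mpoly[OF rhom_id(1)] z _ assms(2)[unfolded base_change_scheme_def]])
       (auto simp: bc_counit assms(1) rhom_0[OF \<iota>])
  then show ?thesis by simp
qed

lemma bc_defideal: "defideal (base_change_group \<iota> G) = bc (defideal G)"
  by (simp add: base_change_group_def)

lemma bc_gmult: "gmult (base_change_group \<iota> G) = (\<lambda>v. map_coeffs \<iota> (gmult G v))"
  by (simp add: base_change_group_def)

lemma bc_ginv: "ginv (base_change_group \<iota> G) = (\<lambda>v. map_coeffs \<iota> (ginv G v))"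
  by (simp add: base_change_group_def)

lemma bc_gmult_morphism:
  "morphism (prod_scheme J J) J (gmult G) \<Longrightarrow>
    morphism (prod_scheme (bc J) (bc J)) (bc J) (gmult (base_change_group \<iota> G))"
  unfolding bc_gmult by (rule morphism_mono[OF bc_prod_scheme subset_refl bc_morphism])

lemma affine_group_base_change:
  assumes "affine_group G"
  shows "affine_group (base_change_group \<iota> G)"
proof -
  let ?G = "base_change_group \<iota> G" and ?I = "defideal G"
  have P3: "bc (prod_scheme ?I (prod_scheme ?I ?I)) \<subseteq> prod_scheme (bc ?I) (prod_scheme (bc ?I) (bc ?I))"
    using bc_prod_scheme[of ?I "prod_scheme ?I ?I"] prod_scheme_mono[OF subset_refl bc_prod_scheme] by blast
  have as: "same_morphism (prod_scheme ?I (prod_scheme ?I ?I))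
       (pmult G (pmult G pr1 (\<lambda>v. pr2 (Inl v))) (\<lambda>v. pr2 (Inr v))) (pmult G pr1 (pmult G (\<lambda>v. pr2 (Inl v)) (\<lambda>v. pr2 (Inr v))))"
    and un: "same_morphism ?I (pmult G (punit G) Var) Var" "same_morphism ?I (pmult G Var (punit G)) Var"
    and iv: "same_morphism ?I (pmult G (pinv G Var) Var) (punit G)" "same_morphism ?I (pmult G Var (pinv G Var)) (punit G)"
    using assms by (auto simp: affine_group_def Let_def)
  have sm: "same_morphism (bc K) (\<lambda>v. map_coeffs \<iota> (a v)) (\<lambda>v. map_coeffs \<iota> (b v))" if "same_morphism K a b"
    for K :: "('t, 'k) mpoly set" and a b
    using that by (simp add: same_morphism_def bc_eqm[unfolded eqm_def])
  have 1: "same_morphism (prod_scheme (bc ?I) (prod_scheme (bc ?I) (bc ?I)))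
       (pmult ?G (pmult ?G pr1 (\<lambda>v. pr2 (Inl v))) (\<lambda>v. pr2 (Inr v))) (pmult ?G pr1 (pmult ?G (\<lambda>v. pr2 (Inl v)) (\<lambda>v. pr2 (Inr v))))"
    using sm[OF as] P3 by (auto simp: same_morphism_def bc_pmult map_coeffs_simps)
  have 2: "same_morphism (bc ?I) (pmult ?G (punit ?G) Var) Var" "same_morphism (bc ?I) (pmult ?G Var (punit ?G)) Var"
    using un[THEN sm] by (simp_all add: same_morphism_def bc_pmult bc_punit map_coeffs_simps)
  have 3: "same_morphism (bc ?I) (pmult ?G (pinv ?G Var) Var) (punit ?G)" "same_morphism (bc ?I) (pmult ?G Var (pinv ?G Var)) (punit ?G)"
    using iv[THEN sm] by (simp_all add: same_morphism_def bc_pmult bc_punit bc_pinv map_coeffs_simps)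
  have 4: "morphism (prod_scheme (bc ?I) (bc ?I)) (bc ?I) (gmult ?G)"
    using assms by (intro bc_gmult_morphism) (simp add: affine_group_def Let_def)
  have 5: "morphism (bc ?I) (bc ?I) (ginv ?G)"
    using assms unfolding bc_ginv by (intro bc_morphism) (simp add: affine_group_def Let_def)
  have 6: "\<forall>p\<in>bc ?I. eval_mpoly id (gunit ?G) p = 0"
    using assms bc_counit_zero[of ?I G] by (simp add: affine_group_def Let_def)
  show ?thesis
    unfolding affine_group_def Let_def bc_defideal
    using 1 2 3 4 5 6 bc_ideal by blast
qed

lemma normal_subgroup_base_change:
  assumes "normal_subgroup G N"
  shows "normal_subgroup (base_change_group \<iota> G) (bc N)"
proof -
  let ?G = "base_change_group \<iota> G"
  have "morphism (prod_scheme (defideal G) N) N (pmult G (pmult G pr1 pr2) (pinv G pr1))"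
    using assms by (simp add: normal_subgroup_def)
  from morphism_mono[OF bc_prod_scheme subset_refl bc_morphism[OF this]]
  have 1: "morphism (prod_scheme (bc (defideal G)) (bc N)) (bc N) (pmult ?G (pmult ?G pr1 pr2) (pinv ?G pr1))"
    by (simp add: bc_pmult bc_pinv map_coeffs_simps)
  have c: "closed_subgroup G N" using assms by (simp add: normal_subgroup_def)
  then have "\<forall>p\<in>bc N. eval_mpoly id (gunit ?G) p = 0"
    using bc_counit_zero[of N G] by (simp add: closed_subgroup_def)
  moreover have "morphism (prod_scheme (bc N) (bc N)) (bc N) (gmult ?G)"
    using c by (intro bc_gmult_morphism) (simp add: closed_subgroup_def)
  moreover have "morphism (bc N) (bc N) (ginv ?G)"
    using c unfolding bc_ginv by (intro bc_morphism) (simp add: closed_subgroup_def)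
  ultimately show ?thesis
    using 1 c by (simp add: normal_subgroup_def closed_subgroup_def bc_defideal bc_ideal bc_mono)
qed

lemma rep_base_change:
  assumes "rep G B R"
  shows "rep (base_change_group \<iota> G) B (\<lambda>i j. map_coeffs \<iota> (R i j))"
  unfolding rep_def
proof (intro conjI ballI)
  show "finite B" using assms by (simp add: rep_def)
  fix i j assume ij: "i \<in> B" "j \<in> B"
  then have e: "eqm (prod_scheme (defideal G) (defideal G))
       (subst (gmult G) (R i j)) (\<Sum>l\<in>B. subst pr1 (R i l) * subst pr2 (R l j))"
    and u: "eval_mpoly id (gunit G) (R i j) = of_bool (i = j)" using assms by (auto simp: rep_def)
  show "eqm (prod_scheme (defideal (base_change_group \<iota> G)) (defideal (base_change_group \<iota> G)))
        (subst (gmult (base_change_group \<iota> G)) (map_coeffs \<iota> (R i j)))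
        (\<Sum>l\<in>B. subst pr1 (map_coeffs \<iota> (R i l)) * subst pr2 (map_coeffs \<iota> (R l j)))"
    using bc_eqm_prod[OF e] by (simp add: map_coeffs_simps map_coeffs_subst[OF \<iota>] bc_defideal bc_gmult)
  show "eval_mpoly id (gunit (base_change_group \<iota> G)) (map_coeffs \<iota> (R i j)) = of_bool (i = j)"
    using u by (simp add: bc_counit rhomD[OF \<iota>] of_bool_def)
qed

text \<open>The extension of \<alpha> to a functional over the larger field, through the basis of
  monomials.\<close>

definition functional_bc :: "(('v, 'k) mpoly \<Rightarrow> 'k) \<Rightarrow> ('v, 'l) mpoly \<Rightarrow> 'l" where
  "functional_bc \<alpha> p = (\<Sum>m\<in>Poly_Mapping.keys p. Poly_Mapping.lookup p m * \<iota> (\<alpha> (Poly_Mapping.single m 1)))"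

lemma functional_bc_superset:
  "finite K \<Longrightarrow> Poly_Mapping.keys p \<subseteq> K \<Longrightarrow>
   functional_bc \<alpha> p = (\<Sum>m\<in>K. Poly_Mapping.lookup p m * \<iota> (\<alpha> (Poly_Mapping.single m 1)))"
  unfolding functional_bc_def by (intro sum.mono_neutral_left) (auto simp: in_keys_iff)

lemma functional_bc_add: "functional_bc \<alpha> (p + q) = functional_bc \<alpha> p + functional_bc \<alpha> q"
proof -
  let ?K = "Poly_Mapping.keys p \<union> Poly_Mapping.keys q"
  show ?thesis
    using keys_add[of p q]
    by (simp add: functional_bc_superset[of ?K] lookup_add sum.distrib algebra_simps)
qed

lemma functional_bc_single: "functional_bc \<alpha> (Poly_Mapping.single m c) = c * \<iota> (\<alpha> (Poly_Mapping.single m 1))"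
  by (subst functional_bc_superset[of "{m}"]) auto

lemma lin_functional_bc: "lin (functional_bc (\<alpha> :: ('v, 'k) mpoly \<Rightarrow> 'k))"
  unfolding lin_def
proof (intro conjI allI functional_bc_add)
  fix c and p :: "('v, 'l) mpoly"
  show "functional_bc \<alpha> (Const c * p) = c * functional_bc \<alpha> p"
  proof (induction p rule: mpoly_add_induct)
    case zero
    show ?case by (simp add: functional_bc_def)
  next
    case (add m d p)
    then show ?case
      by (simp add: distrib_left functional_bc_add Const_def mult_single functional_bc_single mult.assoc)
  qed
qed

lemma functional_bc_map_coeffs:
  assumes "lin \<alpha>"
  shows "functional_bc \<alpha> (map_coeffs \<iota> p) = \<iota> (\<alpha> p)"
proof (induction p rule: mpoly_add_induct)
  case zero
  show ?case by (simp add: map_coeffs_simps functional_bc_def lin_0[OF assms] rhom_0[OF \<iota>])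
next
  case (add m c p)
  have e: "Poly_Mapping.single m c = Const c * Poly_Mapping.single m 1" by (simp add: Const_def mult_single)
  have "functional_bc \<alpha> (map_coeffs \<iota> (Poly_Mapping.single m c)) = \<iota> (\<alpha> (Poly_Mapping.single m c))"
    using lin_scale[OF assms, of c "Poly_Mapping.single m 1"]
    by (simp add: map_single rhom_0[OF \<iota>] functional_bc_single rhom_mult[OF \<iota>] flip: e)
  then show ?case using add by (simp add: map_coeffs_simps functional_bc_add lin_add[OF assms] rhom_add[OF \<iota>])
qed

lemma functional_bc_functionals:
  assumes \<alpha>: "\<alpha> \<in> functionals I" and I: "is_ideal I"
  shows "functional_bc \<alpha> \<in> functionals (bc I)"
proof -
  have l: "lin \<alpha>" and v: "\<And>p. p \<in> I \<Longrightarrow> \<alpha> p = 0" using \<alpha> by (auto simp: functionals_def)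
  \<comment> \<open>A functional does not respect products; vanishing on all multiples makes
    \<open>?K\<close> an ideal, so that only the image of \<open>I\<close> has to be
    checked.\<close>
  let ?K = "{p. \<forall>q. functional_bc \<alpha> (q * p) = 0}"
  have "bc I \<subseteq> ?K"
  proof (rule bc_least)
    have "functional_bc \<alpha> 0 = 0" by (simp add: functional_bc_def)
    then show "is_ideal ?K"
      by (intro is_idealI) (auto simp: distrib_left functional_bc_add mult.assoc[symmetric])
    fix p assume p: "p \<in> I"
    have "functional_bc \<alpha> (q * map_coeffs \<iota> p) = 0" for q
    proof (induction q rule: mpoly_add_induct)
      case zero
      show ?case by (simp add: functional_bc_def)
    next
      case (add m c q)
      have "Poly_Mapping.single m c * map_coeffs \<iota> p = Const c * map_coeffs \<iota> (Poly_Mapping.single m 1 * p)"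
        by (simp add: map_coeffs_simps map_single rhomD[OF \<iota>] Const_def mult_single flip: mult.assoc)
      then show ?case using add v[OF ideal_mult[OF I p]]
        by (simp add: distrib_right functional_bc_add lin_scale[OF lin_functional_bc] functional_bc_map_coeffs[OF l] rhom_0[OF \<iota>])
    qed
    then show "map_coeffs \<iota> p \<in> ?K" by simp
  qed
  then have "functional_bc \<alpha> (1 * p) = 0" if "p \<in> bc I" for p using that by blast
  then show ?thesis by (simp add: functionals_def lin_functional_bc)
qed

end

lemma SL_pr1: "lin \<alpha> \<Longrightarrow> SL \<alpha> (subst pr1 p) = Const (\<alpha> p)"
  using SL_tensor[of \<alpha> p 1] by (simp add: subst_simps)

subsection \<open>Unipotent groups act nilpotently\<close>

text \<open>A homomorphism from \<open>J\<close> to the unitriangular group, given by its matrix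
  entries. The last condition makes it a closed immersion: the entries generate the coordinate ring
  of \<open>J\<close>.\<close>

definition unitriangular_rep ::
  "('v, 'k::field) group_data \<Rightarrow> ('v, 'k) mpoly set \<Rightarrow> nat \<Rightarrow> (nat \<times> nat \<Rightarrow> ('v, 'k) mpoly) \<Rightarrow> bool" where
  "unitriangular_rep G J n f \<longleftrightarrow>
     (\<forall>i j. i \<ge> n \<or> j \<ge> n \<or> j < i \<longrightarrow> f (i, j) \<in> J) \<and> (\<forall>i<n. eqm J (f (i, i)) 1) \<and>
     (\<forall>i j. eqm (prod_scheme J J) (subst (gmult G) (f (i, j))) (\<Sum>l<n. subst pr1 (f (i, l)) * subst pr2 (f (l, j)))) \<and>
     (\<forall>v. \<exists>q. eqm J (Var v) (subst f q))"

text \<open>The relations of the unitriangular group are pulled back along the isomorphism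
  \<open>f\<close>; its inverse \<open>g\<close> supplies the polynomials that recover the variables
  from the entries.\<close>

lemma unipotent_unitriangular_rep:
  fixes G :: "('a, 'b::field) group_data"
  assumes u: "unipotent (subgroup_group G J)" and J: "is_ideal J"
  shows "\<exists>n f. unitriangular_rep G J n f"
proof -
  obtain n L f g where L: "closed_subgroup (unitriangular n) L"
    and f: "group_morphism (subgroup_group G J) (subgroup_group (unitriangular n) L) f"
    and gf: "same_morphism J (comp_morphism g f) Var"
    using u by (auto simp: unipotent_def isomorphic_groups_def subgroup_group_def)
  have UL: "defideal (unitriangular n) \<subseteq> L" using L by (simp add: closed_subgroup_def)
  have fL: "subst f p \<in> J" if "p \<in> defideal (unitriangular n)" for p
    using f that UL by (auto simp: group_morphism_def subgroup_group_def morphism_def)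
  have 1: "f (i, j) \<in> J" if "i \<ge> n \<or> j \<ge> n \<or> j < i" for i j
  proof -
    have "Var (i, j) \<in> {Var (i, j) | i j. i \<ge> n \<or> j \<ge> n} \<union> {Var (i, j) | i j. j < i \<and> i < n}"
    proof -
      have "(i \<ge> n \<or> j \<ge> n) \<or> (j < i \<and> i < n)" using that by linarith
      then show ?thesis by blast
    qed
    then have "Var (i, j) \<in> defideal (unitriangular n)"
      unfolding unitriangular_def by (simp only: group_data.simps) (rule ideal_gen_base, blast)
    from fL[OF this] show ?thesis by (simp add: subst_simps)
  qed
  have 2: "eqm J (f (i, i)) 1" if "i < n" for i
  proof -
    have "Var (i, i) - 1 \<in> defideal (unitriangular n)"
      using that by (auto simp: unitriangular_def intro!: ideal_gen_base)
    from fL[OF this] show ?thesis by (simp add: subst_simps eqm_def)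
  qed
  have 3: "eqm (prod_scheme J J) (subst (gmult G) (f (i, j))) (\<Sum>l<n. subst pr1 (f (i, l)) * subst pr2 (f (l, j)))" for i j
  proof -
    let ?U = "subgroup_group (unitriangular n) L :: (nat \<times> nat, 'b) group_data"
    have g: "gmult ?U = mat_mult n pr1 pr2" by (simp add: subgroup_group_def unitriangular_def)
    have "pmult ?U (comp_morphism f pr1) (comp_morphism f pr2) (i, j) = (\<Sum>l<n. subst pr1 (f (i, l)) * subst pr2 (f (l, j)))"
      unfolding pmult_apply g mat_mult_def comp_morphism_def by (simp add: subst_simps)
    moreover have "eqm (prod_scheme J J) (subst (gmult G) (f (i, j))) (pmult ?U (comp_morphism f pr1) (comp_morphism f pr2) (i, j))"
      using f by (simp only: group_morphism_def same_morphism_def eqm_def) (simp add: subgroup_group_def comp_morphism_def)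
    ultimately show ?thesis by simp
  qed
  have 4: "eqm J (Var v) (subst f (g v))" for v
    by (rule eqm_sym[OF J]) (use gf in \<open>simp add: same_morphism_def eqm_def comp_morphism_def\<close>)
  show ?thesis unfolding unitriangular_rep_def using 1 2 3 4 by blast
qed

text \<open>
  The coordinate \<open>f (i, j)\<close> has weight \<open>j - i\<close>. The comultiplication is compatible with weights, and
  functions of weight \<open>0\<close> are constant.
\<close>

inductive weight_le :: "('v, 'k::field) mpoly set \<Rightarrow> (nat \<times> nat \<Rightarrow> ('v, 'k) mpoly) \<Rightarrow> nat \<Rightarrow> ('v, 'k) mpoly \<Rightarrow> bool"
  for J f where
  mem: "p \<in> J \<Longrightarrow> weight_le J f w p"
| const: "weight_le J f w (Const c)"
| gen: "j - i \<le> w \<Longrightarrow> weight_le J f w (f (i, j))"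
| add: "weight_le J f w p \<Longrightarrow> weight_le J f w q \<Longrightarrow> weight_le J f w (p + q)"
| mult: "weight_le J f u p \<Longrightarrow> weight_le J f v q \<Longrightarrow> u + v \<le> w \<Longrightarrow> weight_le J f w (p * q)"

text \<open>The induced filtration on the coordinate ring of \<open>J \<times> J\<close>.\<close>

inductive tensor_weight_le :: "('v, 'k::field) mpoly set \<Rightarrow> (nat \<times> nat \<Rightarrow> ('v, 'k) mpoly) \<Rightarrow> nat \<Rightarrow> ('v + 'v, 'k) mpoly \<Rightarrow> bool"
  for J f where
  tmem: "P \<in> prod_scheme J J \<Longrightarrow> tensor_weight_le J f w P"
| tensor: "weight_le J f u a \<Longrightarrow> weight_le J f v b \<Longrightarrow> u + v \<le> w \<Longrightarrow> tensor_weight_le J f w (subst pr1 a * subst pr2 b)"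
| tadd: "tensor_weight_le J f w P \<Longrightarrow> tensor_weight_le J f w Q \<Longrightarrow> tensor_weight_le J f w (P + Q)"

lemma weight_le_mono: "weight_le J f u p \<Longrightarrow> u \<le> w \<Longrightarrow> weight_le J f w p"
  using weight_le.mult[of J f u p 0 1 w] weight_le.const[of J f 0 1] by simp

lemma tensor_weight_le_mult:
  assumes "tensor_weight_le J f u P" "tensor_weight_le J f v Q" "u + v \<le> w"
  shows "tensor_weight_le J f w (P * Q)"
  using assms(1,3)
proof induction
  case (tmem P u)
  show ?case by (intro tensor_weight_le.tmem ideal_mult2[OF prod_scheme_ideal] tmem(1))
next
  case (tadd u P P')
  then show ?case by (simp add: distrib_right tensor_weight_le.tadd)
next
  case (tensor u1 a v1 b u)
  note a = tensor
  from assms(2) a(4) show ?case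
  proof (induction)
    case (tmem P u)
    show ?case by (intro tensor_weight_le.tmem ideal_mult[OF prod_scheme_ideal] tmem(1))
  next
    case (tadd u P P')
    then show ?case by (simp add: distrib_left tensor_weight_le.tadd)
  next
    case (tensor u2 c v2 d v)
    have "tensor_weight_le J f w (subst pr1 (a * c) * subst pr2 (b * d))"
      by (rule tensor_weight_le.tensor[of J f "u1 + u2" _ "v1 + v2"])
         (use a tensor in \<open>auto intro: weight_le.mult\<close>)
    then show ?case by (simp add: subst_simps mult_ac)
  qed
qed

text \<open>The augmentation ideal of the algebra dual to the coordinate ring, the counterpart of
  the operators \<open>g - 1\<close>; fixed vectors are those it kills.\<close>

definition aug_functionals :: "('v, 'k::field) mpoly set \<Rightarrow> (('v, 'k) mpoly \<Rightarrow> 'k) set" where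
  "aug_functionals J = {\<alpha> \<in> functionals J. \<alpha> 1 = 0}"

context
  fixes G :: "('v, 'k::field) group_data" and J n f
  assumes f: "unitriangular_rep G J n f" and J: "is_ideal J"
    and J_comult: "morphism (prod_scheme J J) J (gmult G)"
begin

lemma unitriangular_rep_mem: "i \<ge> n \<or> j \<ge> n \<or> j < i \<Longrightarrow> f (i, j) \<in> J"
  using f unfolding unitriangular_rep_def by blast

lemma weight_le_0: "weight_le J f w p \<Longrightarrow> w = 0 \<Longrightarrow> \<exists>c. eqm J p (Const c)"
proof (induction rule: weight_le.induct)
  case (mem p w)
  then show ?case by (intro exI[of _ 0]) (simp add: eqm_def)
next
  case (const w c)
  then show ?case using eqm_refl[OF J] by blast
next
  \<comment> \<open>Truncated subtraction gives weight 0 below the diagonal too, where the entries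
    vanish modulo \<open>J\<close>; only diagonal entries remain, and they are 1.\<close>
  case (gen j i w)
  show ?case
  proof (cases "i \<ge> n \<or> j \<ge> n \<or> j < i")
    case True
    then show ?thesis using unitriangular_rep_mem by (intro exI[of _ 0]) (simp add: eqm_def)
  next
    case False
    then have "i = j" "i < n" using gen by auto
    then show ?thesis using f by (intro exI[of _ 1]) (simp add: unitriangular_rep_def)
  qed
next
  case (add w p q)
  then show ?case using eqm_add[OF J] Const_add by metis
next
  case (mult u p v q w)
  then show ?case using eqm_mult[OF J] Const_mult by (metis add_is_0 le_zero_eq)
qed

text \<open>The entry \<open>(i, j)\<close> comultiplies to a sum over \<open>l\<close>. For
  \<open>l\<close> between \<open>i\<close> and \<open>j\<close> the weights \<open>l - i\<close>
  and \<open>j - l\<close> add up to \<open>j - i\<close>; the other terms vanish modulo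
  \<open>J\<close>.\<close>

lemma weight_le_comult: "weight_le J f w p \<Longrightarrow> tensor_weight_le J f w (subst (gmult G) p)"
proof (induction rule: weight_le.induct)
  case (mem p w)
  then show ?case using J_comult by (intro tensor_weight_le.tmem) (simp add: morphism_def)
next
  case (const w c)
  have "tensor_weight_le J f w (subst pr1 (Const c) * subst pr2 (Const 1))"
    by (rule tensor_weight_le.tensor[OF weight_le.const[of J f 0] weight_le.const[of J f 0]]) simp
  then show ?case by (simp add: subst_simps)
next
  case (gen j i w)
  have s: "tensor_weight_le J f w (\<Sum>l\<in>A. subst pr1 (f (i, l)) * subst pr2 (f (l, j)))" if "finite A" for A
    using that
  proof (induction A)
    case empty
    show ?case by (simp add: tensor_weight_le.tmem idealD[OF prod_scheme_ideal])
  next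
    case (insert l A)
    have "tensor_weight_le J f w (subst pr1 (f (i, l)) * subst pr2 (f (l, j)))"
    proof (cases "i \<le> l \<and> l \<le> j")
      case True
      then show ?thesis using gen
        by (intro tensor_weight_le.tensor[of J f "l - i" _ "j - l"]) (auto intro: weight_le.gen)
    next
      case False
      then have "f (i, l) \<in> J \<or> f (l, j) \<in> J" using f by (auto simp: unitriangular_rep_def)
      then show ?thesis
        by (auto intro!: tensor_weight_le.tmem intro: ideal_mult2[OF prod_scheme_ideal] ideal_mult[OF prod_scheme_ideal]
            prod_scheme_pr1 prod_scheme_pr2)
    qed
    then show ?case using insert by (simp add: tensor_weight_le.tadd)
  qed
  let ?S = "\<Sum>l<n. subst pr1 (f (i, l)) * subst pr2 (f (l, j))"
  have "subst (gmult G) (f (i, j)) - ?S \<in> prod_scheme J J"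
    using f by (simp add: unitriangular_rep_def eqm_def)
  from tensor_weight_le.tadd[OF tensor_weight_le.tmem[OF this] s[of "{..<n}"]] show ?case by simp
next
  case (add w p q)
  then show ?case by (simp add: subst_simps tensor_weight_le.tadd)
next
  case (mult u p v q w)
  then show ?case by (simp add: subst_simps tensor_weight_le_mult)
qed

text \<open>Modulo \<open>J\<close> the variables are polynomials in the entries, so the filtration
  exhausts the ring.\<close>

lemma weight_le_exists: "\<exists>w. weight_le J f w p"
proof (induction p rule: mpoly_induct)
  case (Const c)
  show ?case by (blast intro: weight_le.const)
next
  case (Var v)
  have s: "\<exists>w. weight_le J f w (subst f q)" for q
  proof (induction q rule: mpoly_induct)
    case (Const c)
    then show ?case by (auto simp: subst_simps intro: weight_le.const)
  next
    case (Var ij)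
    then show ?case by (cases ij) (auto simp: subst_simps intro: weight_le.gen)
  next
    case (add p q)
    then obtain u v where "weight_le J f u (subst f p)" "weight_le J f v (subst f q)" by blast
    then have "weight_le J f (max u v) (subst f p)" "weight_le J f (max u v) (subst f q)"
      by (auto intro: weight_le_mono)
    then show ?case by (auto simp: subst_simps intro: weight_le.add)
  next
    case (mult p q)
    then show ?case by (auto simp: subst_simps intro: weight_le.mult)
  qed
  obtain q where "Var v - subst f q \<in> J" using f unfolding unitriangular_rep_def eqm_def by blast
  moreover obtain w where "weight_le J f w (subst f q)" using s by blast
  ultimately have "weight_le J f w ((Var v - subst f q) + subst f q)" by (rule weight_le.add[OF weight_le.mem])
  then show ?case by auto
next
  case (add p q)
  then obtain u v where "weight_le J f u p" "weight_le J f v q" by blast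
  then have "weight_le J f (max u v) p" "weight_le J f (max u v) q"
    by (auto intro: weight_le_mono)
  then show ?case by (auto intro: weight_le.add)
next
  case (mult p q)
  then show ?case by (auto intro: weight_le.mult)
qed

text \<open>A left factor of weight bound 0 is constant modulo \<open>J\<close> and is killed
  because \<alpha>(1) = 0. A left factor of positive bound leaves at most \<open>w - 1\<close> for
  the right factor.\<close>

lemma weight_le_slice:
  assumes \<alpha>: "\<alpha> \<in> aug_functionals J"
  shows "tensor_weight_le J f w P \<Longrightarrow> (if w = 0 then SL \<alpha> P \<in> J else weight_le J f (w - 1) (SL \<alpha> P))"
proof (induction rule: tensor_weight_le.induct)
  have lin: "lin \<alpha>" and van: "\<And>p. p \<in> J \<Longrightarrow> \<alpha> p = 0" and one: "\<alpha> 1 = 0"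
    using \<alpha> by (auto simp: aug_functionals_def functionals_def)
  {
    case (tmem P w)
    then show ?case using SL_prod_scheme[OF lin J van J] by (auto intro: weight_le.mem)
  next
    case (tadd w P Q)
    then show ?case by (auto simp: SL_add[OF lin] intro: idealD[OF J] weight_le.add split: if_splits)
  next
    case (tensor u a v b w)
    show ?case
    proof (cases "u = 0")
      case True
      then obtain c where "eqm J a (Const c)" using weight_le_0 tensor(1) by blast
      then have "\<alpha> (a - Const c) = 0" using van by (simp add: eqm_def)
      then have "\<alpha> a = 0" by (simp add: lin_diff[OF lin] lin_Const[OF lin] one)
      then show ?thesis using idealD(1)[OF J] by (auto simp: SL_tensor[OF lin] intro: weight_le.mem)
    next
      case False
      have "weight_le J f (w - 1) (Const (\<alpha> a) * b)"
        by (rule weight_le.mult[of J f 0 _ v]) (use False tensor in \<open>auto intro: weight_le.const\<close>)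
      then show ?thesis using False tensor by (simp add: SL_tensor[OF lin])
    qed
  }
qed

end

text \<open>Row vectors are acted on from the right, so the head of the list acts first.\<close>

definition act_list :: "nat set \<Rightarrow> (nat \<Rightarrow> nat \<Rightarrow> ('v, 'k::field) mpoly) \<Rightarrow> (('v, 'k) mpoly \<Rightarrow> 'k) list \<Rightarrow> (nat \<Rightarrow> 'k) \<Rightarrow> nat \<Rightarrow> 'k" where
  "act_list B R \<alpha>s y = foldl (\<lambda>y \<alpha>. act B y (\<lambda>i j. \<alpha> (R i j))) y \<alpha>s"

lemma act_list_simps:
  "act_list B R [] y = y" "act_list B R (\<alpha> # \<alpha>s) y = act_list B R \<alpha>s (act B y (\<lambda>i j. \<alpha> (R i j)))"
  "act_list B R (\<alpha>s @ [\<alpha>]) y = act B (act_list B R \<alpha>s y) (\<lambda>i j. \<alpha> (R i j))"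
  by (simp_all add: act_list_def)

section \<open>Orbit functions and fixed vectors of a closed subgroup\<close>

lemma closed_subgroupD:
  assumes "closed_subgroup G J"
  shows "is_ideal J" "defideal G \<subseteq> J" "morphism (prod_scheme J J) J (gmult G)"
    "p \<in> J \<Longrightarrow> eval_mpoly id (gunit G) p = 0"
  using assms by (auto simp: closed_subgroup_def morphism_def)

context aff_group
begin

context
  fixes J B R
  assumes J: "closed_subgroup G J" and R: "rep G B R"
begin

lemmas J_ideal = closed_subgroupD(1)[OF J]

text \<open>\<open>p\<close> is not congruent to a constant modulo \<open>J\<close>: the constant
  would have to be the value 0 of \<open>p\<close> at the unit. Hence \<open>p\<close> can be
  separated from the sum of \<open>J\<close> and the constants.\<close>

lemma aug_functional_separates:
  assumes p: "p \<notin> J" "counit p = 0"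
  obtains \<alpha> where "\<alpha> \<in> aug_functionals J" "\<alpha> p = 1"
proof -
  let ?Z = "{z. \<exists>c. z - Const c \<in> J}"
  have Z: "lin_subspace ?Z"
    unfolding module.subspace_def[OF mpoly_module]
  proof (intro conjI ballI allI)
    show "0 \<in> ?Z" using idealD(1)[OF J_ideal] by (auto intro!: exI[of _ 0])
    fix x assume "x \<in> ?Z"
    then obtain c where c: "x - Const c \<in> J" by blast
    show "x + y \<in> ?Z" if "y \<in> ?Z" for y
    proof -
      obtain d where d: "y - Const d \<in> J" using \<open>y \<in> ?Z\<close> by blast
      have "x + y - Const (c + d) \<in> J" using ideal_add[OF J_ideal c d] by (simp add: Const_add algebra_simps)
      then show ?thesis by blast
    qed
    show "Const e * x \<in> ?Z" for e
    proof -
      have "Const e * x - Const (e * c) \<in> J" using ideal_mult[OF J_ideal c, of "Const e"] by (simp add: Const_mult algebra_simps)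
      then show ?thesis by blast
    qed
  qed
  have "p \<notin> ?Z"
  proof
    assume "p \<in> ?Z"
    then obtain c where c: "p - Const c \<in> J" by blast
    then have "counit (p - Const c) = 0" by (rule closed_subgroupD(4)[OF J])
    then have "c = 0" using p(2) by (simp add: counit_simps)
    then show False using c p(1) by simp
  qed
  from separating_functional[OF Z this] obtain \<alpha> where \<alpha>: "lin \<alpha>" "\<And>z. z \<in> ?Z \<Longrightarrow> \<alpha> z = 0" "\<alpha> p = 1" by blast
  have "J \<subseteq> ?Z" by (auto intro!: exI[of _ 0])
  moreover have "1 \<in> ?Z" using idealD(1)[OF J_ideal] by (auto intro!: exI[of _ 1])
  ultimately have "\<alpha> \<in> aug_functionals J" using \<alpha> by (auto simp: aug_functionals_def functionals_def)
  then show thesis using that \<alpha>(3) by blast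
qed

text \<open>The coordinates of the orbit map \<open>g \<mapsto> y g\<close>, as functions on the
  group.\<close>

definition row :: "(nat \<Rightarrow> 'k) \<Rightarrow> nat \<Rightarrow> ('v, 'k) mpoly" where
  "row y j = (\<Sum>i\<in>B. Const (y i) * R i j)"

lemma counit_row: "j \<in> B \<Longrightarrow> counit (row y j) = y j"
  using rep_finite[OF R] by (simp add: row_def counit_simps rep_counit[OF R] sum_of_bool)

lemma lin_row: "lin \<alpha> \<Longrightarrow> j \<in> B \<Longrightarrow> \<alpha> (row y j) = act B y (\<lambda>i j. \<alpha> (R i j)) j"
  by (simp add: row_def act_def linD)

text \<open>Acting by \<alpha> and then by the generic point is a product of matrices; on orbit
  functions it is a slice of the comultiplication.\<close>

lemma slice_row:
  assumes \<alpha>: "\<alpha> \<in> functionals J" and j: "j \<in> B"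
  shows "eqm J (SL \<alpha> (comult (row y j))) (row (act B y (\<lambda>i j. \<alpha> (R i j))) j)"
proof -
  have lin: "lin \<alpha>" and van: "\<And>p. p \<in> J \<Longrightarrow> \<alpha> p = 0" using \<alpha> by (auto simp: functionals_def)
  let ?K = "prod_scheme J J"
  have K: "is_ideal ?K" by simp
  have "eqm ?K (comult (row y j)) (\<Sum>i\<in>B. Const (y i) * (\<Sum>l\<in>B. subst pr1 (R i l) * subst pr2 (R l j)))"
    unfolding row_def subst_simps
    by (intro eqm_sum[OF K] eqm_mult[OF K] eqm_refl[OF K]
        eqm_mono[OF prod_scheme_mono[OF closed_subgroupD(2)[OF J] closed_subgroupD(2)[OF J]]] rep_comult[OF R] j)
  then have "SL \<alpha> (comult (row y j)  - (\<Sum>i\<in>B. Const (y i) * (\<Sum>l\<in>B. subst pr1 (R i l) * subst pr2 (R l j)))) \<in> J"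
    unfolding eqm_def by (rule SL_functionals[OF \<alpha> J_ideal J_ideal])
  moreover have "SL \<alpha> (\<Sum>i\<in>B. Const (y i) * (\<Sum>l\<in>B. subst pr1 (R i l) * subst pr2 (R l j))) =
     (\<Sum>i\<in>B. \<Sum>l\<in>B. Const (y i * \<alpha> (R i l)) * R l j)"
    by (simp add: SL_sum[OF lin] SL_scale[OF lin] SL_tensor[OF lin] Const_mult sum_distrib_left mult.assoc)
  moreover have "(\<Sum>i\<in>B. \<Sum>l\<in>B. Const (y i * \<alpha> (R i l)) * R l j) = row (act B y (\<lambda>i j. \<alpha> (R i j))) j"
    by (subst sum.swap) (simp add: row_def act_def Const_sum sum_distrib_right)
  ultimately show ?thesis by (simp add: eqm_def SL_diff[OF lin])
qed

text \<open>Each operator replaces the orbit functions by slices, which lowers their weight. At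
  weight 0 the slices lie in \<open>J\<close>, and their values at the unit, the coordinates of the
  new vector, are zero.\<close>

lemma act_list_zero:
  assumes f: "unitriangular_rep G J n f"
  shows "(\<And>j. j \<in> B \<Longrightarrow> weight_le J f w (row y j)) \<Longrightarrow> set \<alpha>s \<subseteq> aug_functionals J \<Longrightarrow> w < length \<alpha>s \<Longrightarrow>
    act_list B R \<alpha>s y = (\<lambda>i. 0)"
proof (induction \<alpha>s arbitrary: w y)
  case Nil
  then show ?case by simp
next
  case (Cons \<alpha> \<alpha>s)
  let ?z = "act B y (\<lambda>i j. \<alpha> (R i j))"
  have \<alpha>: "\<alpha> \<in> aug_functionals J" "\<alpha> \<in> functionals J" using Cons.prems by (auto simp: aug_functionals_def)
  note wl = weight_le_slice[OF f J_ideal closed_subgroupD(3)[OF J] \<alpha>(1) weight_le_comult[OF f J_ideal closed_subgroupD(3)[OF J] Cons.prems(1)]]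
  show ?case
  proof (cases "w = 0")
    case True
    have "?z j = 0" for j
    proof (cases "j \<in> B")
      case j: True
      then have "row ?z j \<in> J" using wl[OF j] True eqm_mem[OF J_ideal slice_row[OF \<alpha>(2) j]] by simp
      then show ?thesis using closed_subgroupD(4)[OF J] counit_row[OF j] by metis
    qed (simp add: act_def)
    then have "?z = (\<lambda>i. 0)" by blast
    moreover have "act_list B R \<alpha>s (\<lambda>i. 0) = (\<lambda>i. 0)" by (induction \<alpha>s) (simp_all add: act_list_simps act_zero)
    ultimately show ?thesis by (simp add: act_list_simps)
  next
    case False
    have "weight_le J f (w - 1) (row ?z j)" if j: "j \<in> B" for j
    proof -
      have "row ?z j - SL \<alpha> (comult (row y j)) \<in> J"
        using eqm_sym[OF J_ideal slice_row[OF \<alpha>(2) j]] by (simp add: eqm_def)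
      from weight_le.add[OF weight_le.mem[OF this]] wl[OF j] False show ?thesis by force
    qed
    from Cons.IH[OF this] show ?thesis using Cons.prems False by (simp add: act_list_simps)
  qed
qed

definition fixed_vectors :: "(nat \<Rightarrow> 'k) set" where
  "fixed_vectors = {w \<in> vecs B. \<forall>\<alpha>\<in>aug_functionals J. act B w (\<lambda>i j. \<alpha> (R i j)) = (\<lambda>i. 0)}"

text \<open>A congruence to a constant is preserved by functionals with \<alpha>(1) = 0. Conversely
  \<open>aug_functional_separates\<close> turns a nonconstant orbit function into a functional that
  does not kill \<open>w\<close>.\<close>

lemma fixed_vectors_iff: "w \<in> fixed_vectors \<longleftrightarrow> w \<in> vecs B \<and> (\<forall>j\<in>B. eqm J (row w j) (Const (w j)))"
proof safe
  assume w: "w \<in> fixed_vectors"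
  then show "w \<in> vecs B" by (simp add: fixed_vectors_def)
  fix j assume j: "j \<in> B"
  show "eqm J (row w j) (Const (w j))"
  proof (rule ccontr)
    assume "\<not> ?thesis"
    then obtain \<alpha> where \<alpha>: "\<alpha> \<in> aug_functionals J" "\<alpha> (row w j - Const (w j)) = 1"
      using aug_functional_separates[of "row w j - Const (w j)"] by (auto simp: eqm_def counit_simps counit_row[OF j])
    then have "lin \<alpha>" "\<alpha> 1 = 0" by (auto simp: aug_functionals_def functionals_def)
    then have "act B w (\<lambda>i j. \<alpha> (R i j)) j = 1" using \<alpha>(2) j by (simp add: lin_diff lin_Const lin_row)
    moreover have "act B w (\<lambda>i j. \<alpha> (R i j)) j = 0" using w \<alpha>(1) by (simp add: fixed_vectors_def)
    ultimately show False by simp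
  qed
next
  assume w: "w \<in> vecs B" "\<forall>j\<in>B. eqm J (row w j) (Const (w j))"
  have "act B w (\<lambda>i j. \<alpha> (R i j)) j = 0" if \<alpha>: "\<alpha> \<in> aug_functionals J" for \<alpha> j
  proof (cases "j \<in> B")
    case True
    have l: "lin \<alpha>" "\<alpha> 1 = 0" "\<alpha> (row w j - Const (w j)) = 0"
      using \<alpha> w(2) True by (auto simp: aug_functionals_def functionals_def eqm_def)
    then show ?thesis using True by (simp add: lin_diff lin_Const lin_row)
  qed (simp add: act_def)
  then show "w \<in> fixed_vectors" using w(1) by (auto simp: fixed_vectors_def)
qed

lemma fixed_vectors_subspace: "vec_subspace B fixed_vectors"
  unfolding vec_subspace_def fixed_vectors_def by (auto simp: vecs_closed act_zero act_add act_scale)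

text \<open>For \<open>w\<close> fixed by the normal subgroup one has \<open>w x n = w (x n x\<^sup>-\<^sup>1) x = w x\<close>.\<close>

lemma fixed_vectors_stable:
  assumes normal: "normal_subgroup G J" and w: "w \<in> fixed_vectors" and \<alpha>: "\<alpha> \<in> functionals I"
  shows "act B w (\<lambda>i j. \<alpha> (R i j)) \<in> fixed_vectors"
proof -
  have lin: "lin \<alpha>" and van: "\<And>p. p \<in> I \<Longrightarrow> \<alpha> p = 0" using \<alpha> by (auto simp: functionals_def)
  have wfix: "eqm J (row w j) (Const (w j))" if "j \<in> B" for j using w that by (simp add: fixed_vectors_iff)
  let ?K = "prod_scheme I J"
  have K: "is_ideal ?K" by simp
  let ?c = "pmult G (pmult G pr1 pr2) (pinv G pr1)"
  have cJ: "morphism ?K J ?c" using normal by (simp add: normal_subgroup_def)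
  note IJ = closed_subgroupD(2)[OF J]
  note x = morphism_pr1[of I J]
  have n: "morphism ?K I pr2" by (rule morphism_mono[OF subset_refl IJ morphism_pr2])
  have c: "morphism ?K I ?c" by (rule morphism_mono[OF subset_refl IJ cJ])
  note xi = pinv_point[OF K x] and xn = pmult_point[OF K x n]
  have pm: "eqm ?K (pmult G a b v) (pmult G a' b' v)"
    if "\<And>v. eqm ?K (a v) (a' v)" "\<And>v. eqm ?K (b v) (b' v)" for a b a' b' v
    unfolding pmult_apply by (rule eqm_subst[OF K]) (use that in \<open>auto split: sum.split\<close>)
  have conj: "eqm ?K (pmult G ?c pr1 v) (pmult G pr1 pr2 v)" for v
  proof -
    have "eqm ?K (pmult G ?c pr1 v) (pmult G (pmult G pr1 pr2) (pmult G (pinv G pr1) pr1) v)"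
      by (rule pmult_assoc[OF K xn xi x])
    also have "eqm ?K \<dots> (pmult G (pmult G pr1 pr2) (punit G) v)"
      by (intro pm eqm_refl[OF K] pmult_pinv[OF K x])
    also (eqm_trans[OF K]) have "eqm ?K \<dots> (pmult G pr1 pr2 v)"
      by (rule pmult_punit[OF K xn])
    finally (eqm_trans[OF K]) show ?thesis .
  qed
  have key: "eqm J (row (act B w (\<lambda>i j. \<alpha> (R i j))) j) (Const (act B w (\<lambda>i j. \<alpha> (R i j)) j))" if j: "j \<in> B" for j
  proof -
    \<comment> \<open>\<open>?l\<close> is \<open>w x n\<close>. It equals
      \<open>w (x n x\<^sup>-\<^sup>1) x\<close>, hence \<open>w x\<close>, which is
      \<open>?r\<close>. Applying \<alpha> in \<open>x\<close> leaves the orbit functions of the new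
      vector on one side and constants on the other.\<close>
    let ?l = "\<Sum>i\<in>B. Const (w i) * (\<Sum>l\<in>B. subst pr1 (R i l) * subst pr2 (R l j))"
    let ?r = "\<Sum>l\<in>B. Const (w l) * subst pr1 (R l j) :: ('v + 'v, 'k) mpoly"
    have "eqm ?K ?l (\<Sum>i\<in>B. Const (w i) * subst (pmult G pr1 pr2) (R i j))"
      by (intro eqm_sum[OF K] eqm_mult[OF K] eqm_refl[OF K] eqm_sym[OF K rep_pmult[OF K R x n]] j)
    also have "eqm ?K \<dots> (\<Sum>i\<in>B. Const (w i) * subst (pmult G ?c pr1) (R i j))"
      by (intro eqm_sum[OF K] eqm_mult[OF K] eqm_refl[OF K] eqm_subst[OF K] eqm_sym[OF K conj])
    also (eqm_trans[OF K]) have "eqm ?K \<dots> (\<Sum>i\<in>B. Const (w i) * (\<Sum>l\<in>B. subst ?c (R i l) * subst pr1 (R l j)))"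
      by (intro eqm_sum[OF K] eqm_mult[OF K] eqm_refl[OF K] rep_pmult[OF K R c x] j)
    also (eqm_trans[OF K]) have "(\<Sum>i\<in>B. Const (w i) * (\<Sum>l\<in>B. subst ?c (R i l) * subst pr1 (R l j))) =
       (\<Sum>l\<in>B. subst ?c (row w l) * subst pr1 (R l j))"
      by (simp add: row_def subst_simps sum_distrib_left sum_distrib_right mult.assoc, subst sum.swap, rule refl)
    also have "eqm ?K (\<Sum>l\<in>B. subst ?c (row w l) * subst pr1 (R l j)) (\<Sum>l\<in>B. subst ?c (Const (w l)) * subst pr1 (R l j))"
      by (intro eqm_sum[OF K] eqm_mult[OF K] eqm_refl[OF K] subst_eqm_morphism[OF cJ] wfix)
    also (eqm_trans[OF K]) have "(\<Sum>l\<in>B. subst ?c (Const (w l)) * subst pr1 (R l j)) = ?r"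
      by (simp add: subst_simps)
    finally have "SL \<alpha> (?l - ?r) \<in> J"
      unfolding eqm_def by (intro SL_functionals[OF \<alpha> I_ideal J_ideal])
    moreover have "SL \<alpha> ?l = (\<Sum>i\<in>B. \<Sum>l\<in>B. Const (w i * \<alpha> (R i l)) * R l j)"
      by (simp add: SL_sum[OF lin] SL_scale[OF lin] SL_tensor[OF lin] Const_mult sum_distrib_left mult.assoc)
    moreover have "(\<Sum>i\<in>B. \<Sum>l\<in>B. Const (w i * \<alpha> (R i l)) * R l j) = row (act B w (\<lambda>i j. \<alpha> (R i j))) j"
      by (subst sum.swap) (simp add: row_def act_def Const_sum sum_distrib_right)
    moreover have "SL \<alpha> ?r = Const (act B w (\<lambda>i j. \<alpha> (R i j)) j)"
      using j by (simp add: SL_sum[OF lin] SL_scale[OF lin] SL_pr1[OF lin] act_def Const_sum Const_mult)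
    ultimately show ?thesis by (simp add: eqm_def SL_diff[OF lin])
  qed
  show ?thesis using key by (simp add: fixed_vectors_iff act_vecs)
qed

end

end

section \<open>Unipotent normal subgroups act trivially on irreducible representations\<close>

lemma base_change_projection_antimono:
  "base_change_projection \<iota> B \<A> W C \<pi> \<Longrightarrow> D \<subseteq> C \<Longrightarrow> base_change_projection \<iota> B \<A> W D \<pi>"
  unfolding base_change_projection_def by blast

lemma base_change_projection_sum:
  assumes p: "base_change_projection \<iota> B \<A> W C \<pi>" and W: "vec_subspace B W"
    and c: "\<And>e. e < (N::nat) \<Longrightarrow> c e \<in> C" and z: "\<And>e. z e \<in> vecs B"
  shows "\<pi> (\<lambda>i. \<Sum>e<N. c e * z e i) = (\<lambda>i. \<Sum>e<N. c e * \<pi> (z e) i)"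
  using c
proof (induction N)
  case 0
  show ?case using p vec_subspaceD(2)[OF W] by (auto simp: base_change_projection_def)
next
  case (Suc N)
  have "(\<lambda>i. \<Sum>e<N. c e * z e i) \<in> vecs B" using z by (auto simp: vecs_def)
  moreover have "(\<lambda>i. c N * z N i) \<in> vecs B" using z[of N] by (auto simp: vecs_def)
  ultimately show ?case using Suc z[of N] p unfolding base_change_projection_def by simp
qed

lemma separable_algebraic_extensionD:
  assumes "separable_algebraic_extension \<iota>"
  shows "rhom \<iota>" "\<exists>f. poly (map_poly \<iota> f) c = 0 \<and> poly (pderiv (map_poly \<iota> f)) c \<noteq> 0"
proof -
  show r: "rhom \<iota>" using assms by (simp add: separable_algebraic_extension_def field_embedding_iff_rhom)
  obtain f where f: "irreducible f" "coprime f (pderiv f)" "poly (map_poly \<iota> f) c = 0"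
    using assms unfolding separable_algebraic_extension_def by blast
  have "f \<noteq> 0" using f(1) by auto
  from separable_simple_root[OF r this f(2,3)] f(3)
  show "\<exists>f. poly (map_poly \<iota> f) c = 0 \<and> poly (pderiv (map_poly \<iota> f)) c \<noteq> 0" by blast
qed

context aff_group
begin

definition matrices where
  "matrices R = {\<lambda>i j. \<alpha> (R i j) | \<alpha>. \<alpha> \<in> functionals I}"

text \<open>By \<open>semilinear_decomposition\<close> each operator of the list is a combination of
  operators from \<open>matrices R\<close> with finitely many scalars of the larger field.
  \<open>C\<close> collects these scalars, and a projection commuting with them commutes with the
  product.\<close>

lemma act_list_commutes:
  fixes \<iota> :: "'k \<Rightarrow> 'l::field"
  assumes \<iota>: "rhom \<iota>" and B: "finite B" and W: "vec_subspace B W" and J: "is_ideal J" "bc \<iota> I \<subseteq> J"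
  shows "set \<alpha>s \<subseteq> functionals J \<Longrightarrow> \<exists>C. finite C \<and> (\<forall>\<pi>. base_change_projection \<iota> B (matrices R) W C \<pi> \<longrightarrow>
    (\<forall>x\<in>vecs B. \<pi> (act_list B (\<lambda>i j. map_coeffs \<iota> (R i j)) \<alpha>s x) = act_list B (\<lambda>i j. map_coeffs \<iota> (R i j)) \<alpha>s (\<pi> x)))"
proof (induction \<alpha>s)
  case Nil
  show ?case by (intro exI[of _ "{}"]) (simp add: act_list_simps)
next
  case (Cons \<alpha> \<alpha>s)
  let ?R = "\<lambda>i j. map_coeffs \<iota> (R i j)"
  obtain C where C: "finite C" "\<And>\<pi> x. base_change_projection \<iota> B (matrices R) W C \<pi> \<Longrightarrow>
    x \<in> vecs B \<Longrightarrow> \<pi> (act_list B ?R \<alpha>s x) = act_list B ?R \<alpha>s (\<pi> x)"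
    using Cons by auto
  have lin: "lin \<alpha>" and van: "\<And>p. p \<in> J \<Longrightarrow> \<alpha> p = 0" using Cons.prems by (auto simp: functionals_def)
  have van': "\<alpha> (map_coeffs \<iota> p) = 0" if "p \<in> I" for p using van bc_mem[OF \<iota> that] J(2) by blast
  have "\<exists>(N::nat) c \<mu>. (\<forall>e<N. lin (\<mu> e) \<and> (\<forall>p\<in>I. \<mu> e p = 0)) \<and>
      (\<forall>p\<in>(\<lambda>(i, j). R i j) ` (B \<times> B). \<alpha> (map_coeffs \<iota> p) = (\<Sum>e<N. c e * \<iota> (\<mu> e p)))"
  proof (rule semilinear_decomposition[where \<Lambda> = "\<lambda>p. \<alpha> (map_coeffs \<iota> p)", OF \<iota> _ _ I_ideal van'])
    show "\<alpha> (map_coeffs \<iota> (p + q)) = \<alpha> (map_coeffs \<iota> p) + \<alpha> (map_coeffs \<iota> q)" for p q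
      by (simp only: map_coeffs_simps[OF \<iota>] lin_add[OF lin])
    show "\<alpha> (map_coeffs \<iota> (Const c * p)) = \<iota> c * \<alpha> (map_coeffs \<iota> p)" for c p
      by (simp only: map_coeffs_simps[OF \<iota>] lin_scale[OF lin])
    show "finite ((\<lambda>(i, j). R i j) ` (B \<times> B))" using B by simp
  qed
  then obtain N :: nat and c \<mu> where \<mu>': "\<forall>e<N. lin (\<mu> e) \<and> (\<forall>p\<in>I. \<mu> e p = 0)"
    and eq': "\<forall>p\<in>(\<lambda>(i, j). R i j) ` (B \<times> B). \<alpha> (map_coeffs \<iota> p) = (\<Sum>e<N. c e * \<iota> (\<mu> e p))"
    by (elim exE conjE)
  have \<mu>: "lin (\<mu> e)" "\<And>p. p \<in> I \<Longrightarrow> \<mu> e p = 0" if "e < N" for e using \<mu>' that by auto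
  have eq: "\<alpha> (map_coeffs \<iota> (R i j)) = (\<Sum>e<N. c e * \<iota> (\<mu> e (R i j)))" if "i \<in> B" "j \<in> B" for i j
    by (rule bspec[OF eq']) (use that in force)
  have \<mu>A: "(\<lambda>i j. \<mu> e (R i j)) \<in> matrices R" if "e < N" for e
    unfolding matrices_def functionals_def using \<mu> that by blast
  have act_eq: "act B x (\<lambda>i j. \<alpha> (?R i j)) = (\<lambda>j. \<Sum>e<N. c e * act B x (\<lambda>i j. \<iota> (\<mu> e (R i j))) j)" for x
  proof
    fix j
    show "act B x (\<lambda>i j. \<alpha> (?R i j)) j = (\<Sum>e<N. c e * act B x (\<lambda>i j. \<iota> (\<mu> e (R i j))) j)"
    proof (cases "j \<in> B")
      case True
      have "(\<Sum>i\<in>B. x i * \<alpha> (?R i j)) = (\<Sum>i\<in>B. \<Sum>e<N. c e * (x i * \<iota> (\<mu> e (R i j))))"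
        using True by (intro sum.cong refl) (simp add: eq sum_distrib_left mult.left_commute)
      then show ?thesis using True by (simp add: act_def sum_distrib_left sum.swap[of _ B])
    qed (simp add: act_def)
  qed
  show ?case
  proof (intro exI conjI allI impI ballI)
    show "finite (C \<union> c ` {..<N})" using C(1) by simp
    fix \<pi> and x :: "nat \<Rightarrow> 'l" assume \<pi>: "base_change_projection \<iota> B (matrices R) W (C \<union> c ` {..<N}) \<pi>" and x: "x \<in> vecs B"
    have comm: "\<pi> (act B x (\<lambda>i j. \<iota> (a i j))) = act B (\<pi> x) (\<lambda>i j. \<iota> (a i j))" if "a \<in> matrices R" for a
      using \<pi> x that unfolding base_change_projection_def by blast
    have "\<pi> (act B x (\<lambda>i j. \<alpha> (?R i j))) = (\<lambda>j. \<Sum>e<N. c e * \<pi> (act B x (\<lambda>i j. \<iota> (\<mu> e (R i j)))) j)"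
      unfolding act_eq by (rule base_change_projection_sum[OF \<pi> W]) (auto simp: act_vecs)
    also have "\<dots> = act B (\<pi> x) (\<lambda>i j. \<alpha> (?R i j))"
      unfolding act_eq by (intro ext sum.cong refl) (simp add: comm[OF \<mu>A])
    finally have e: "\<pi> (act B x (\<lambda>i j. \<alpha> (?R i j))) = act B (\<pi> x) (\<lambda>i j. \<alpha> (?R i j))" .
    show "\<pi> (act_list B ?R (\<alpha> # \<alpha>s) x) = act_list B ?R (\<alpha> # \<alpha>s) (\<pi> x)"
      using C(2)[OF base_change_projection_antimono[OF \<pi>] act_vecs] by (simp add: act_list_simps flip: e)
  qed
qed

text \<open>
  A nonzero product \<open>\<rho>\<close> of maximal length of operators \<open>\<alpha> (R)\<close> with \<open>\<alpha>(1) = 0\<close> maps all vectors to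
  fixed vectors and kills the fixed vectors. Hence \<open>\<rho> y = \<pi> (\<rho> y) = \<rho> (\<pi> y) = 0\<close> for a projection
  \<open>\<pi>\<close> to the fixed vectors that commutes with \<open>\<rho>\<close>.
\<close>

theorem irreducible_rep_trivial_on_unipotent:
  fixes \<iota> :: "'k \<Rightarrow> 'l::field"
  assumes irr: "irreducible_rep G B R" and sep: "separable_algebraic_extension \<iota>"
    and normal: "normal_subgroup (base_change_group \<iota> G) J"
    and unip: "unipotent (subgroup_group (base_change_group \<iota> G) J)"
    and ij: "i \<in> B" "j \<in> B"
  shows "eqm J (map_coeffs \<iota> (R i j)) (of_bool (i = j))"
proof (rule ccontr)
  assume contr: "\<not> ?thesis"
  note \<iota> = separable_algebraic_extensionD(1)[OF sep]
  define H where "H = base_change_group \<iota> G"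
  define S where "S = (\<lambda>i j. map_coeffs \<iota> (R i j))"
  interpret H: aff_group H
    unfolding H_def by unfold_locales (rule affine_group_base_change[OF \<iota> affine_group])
  have R: "rep G B R" using irr by (simp add: irreducible_rep_def)
  have S: "rep H B S" unfolding H_def S_def by (rule rep_base_change[OF \<iota> R])
  note B = rep_finite[OF R]
  have J: "closed_subgroup H J" using normal by (simp add: normal_subgroup_def H_def)
  note J_ideal = closed_subgroupD(1)[OF J]
  have IJ: "bc \<iota> I \<subseteq> J" using closed_subgroupD(2)[OF J] by (simp add: H_def bc_defideal[OF \<iota>])
  obtain n f where f: "unitriangular_rep H J n f"
    using unipotent_unitriangular_rep[OF unip J_ideal] by (auto simp: H_def)
  let ?W = "H.fixed_vectors J B S"
  have W: "vec_subspace B ?W" by (rule H.fixed_vectors_subspace[OF J S])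
  have aug: "aug_functionals J \<subseteq> functionals J" by (auto simp: aug_functionals_def)

  \<comment> \<open>A common bound for all entries limits the length of nonzero products for every
    starting vector at once.\<close>
  have "\<exists>w. \<forall>i\<in>B. \<forall>j\<in>B. weight_le J f w (S i j)"
  proof -
    have "\<forall>i j. \<exists>w. weight_le J f w (S i j)"
      using weight_le_exists[OF f J_ideal closed_subgroupD(3)[OF J]] by blast
    then obtain w where w: "\<And>i j. weight_le J f (w i j) (S i j)" by metis
    have "w i j \<le> Max ((\<lambda>(i, j). w i j) ` (B \<times> B))" if "i \<in> B" "j \<in> B" for i j
      using that B by (intro Max_ge) auto
    then show ?thesis using w weight_le_mono by blast
  qed
  then obtain w where w: "\<And>i j. i \<in> B \<Longrightarrow> j \<in> B \<Longrightarrow> weight_le J f w (S i j)" by blast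
  have wrow: "weight_le J f w (H.row B S y j)" if "j \<in> B" for y j
  proof -
    have "weight_le J f w (\<Sum>i\<in>F. Const (y i) * S i j)" if "finite F" "F \<subseteq> B" for F
      using that
    proof (induction F)
      case empty
      show ?case using weight_le.const[of J f w 0] by simp
    next
      case (insert i F)
      have "weight_le J f w (Const (y i) * S i j)"
        by (rule weight_le.mult[OF weight_le.const[of _ _ 0] w]) (use insert \<open>j \<in> B\<close> in auto)
      then show ?case using insert by (simp add: weight_le.add)
    qed
    then show ?thesis using B by (simp add: H.row_def[OF J S])
  qed

  define P where "P m \<longleftrightarrow> (\<exists>\<alpha>s y. set \<alpha>s \<subseteq> aug_functionals J \<and> length \<alpha>s = m \<and> y \<in> vecs B \<and> act_list B S \<alpha>s y \<noteq> (\<lambda>i. 0))" for m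
  have bound: "m \<le> w" if "P m" for m
    using that H.act_list_zero[OF J S f wrow] by (force simp: P_def)
  \<comment> \<open>An entry that differs from the identity modulo \<open>J\<close> is detected by a
    functional, so some product of length one is nonzero.\<close>
  have "P 1"
  proof -
    have c: "H.counit (S i j - of_bool (i = j)) = 0"
      using H.rep_counit[OF S ij] by (simp add: H.counit_simps of_bool_def)
    obtain \<alpha> where \<alpha>: "\<alpha> \<in> aug_functionals J" "\<alpha> (S i j - of_bool (i = j)) = 1"
      using H.aug_functional_separates[OF J S _ c] contr by (auto simp: eqm_def S_def)
    have l: "lin \<alpha>" "\<alpha> 1 = 0" using \<alpha>(1) by (auto simp: aug_functionals_def functionals_def)
    have "\<alpha> (S i j) = 1" using \<alpha>(2) l by (simp add: lin_diff lin_0 of_bool_def split: if_splits)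
    define y where "y = (\<lambda>r. of_bool (i = r) :: 'l)"
    have "act B y (\<lambda>i j. \<alpha> (S i j)) j = 1"
      using ij B \<open>\<alpha> (S i j) = 1\<close> by (simp add: act_def y_def sum_of_bool)
    moreover have "y \<in> vecs B" using ij by (auto simp: y_def vecs_def)
    ultimately show "P 1" unfolding P_def
      by (intro exI[of _ "[\<alpha>]"] exI[of _ y]) (use \<alpha>(1) in \<open>auto simp: act_list_simps fun_eq_iff intro!: exI[of _ j]\<close>)
  qed
  then obtain m where m: "P m" and max: "\<And>m'. P m' \<Longrightarrow> m' \<le> m"
    using ex_has_greatest_nat[of P 1 "\<lambda>x. x" "Suc w"] bound by (metis le_imp_less_Suc)
  have "m \<noteq> 0" using max[OF \<open>P 1\<close>] by simp
  obtain \<alpha>s y where \<alpha>s: "set \<alpha>s \<subseteq> aug_functionals J" "length \<alpha>s = m" and y: "y \<in> vecs B" "act_list B S \<alpha>s y \<noteq> (\<lambda>i. 0)"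
    using m unfolding P_def by blast
  have vecs: "act_list B S \<alpha>s x \<in> vecs B" if "x \<in> vecs B" for x
    using that by (induction \<alpha>s arbitrary: x) (simp_all add: act_list_simps act_vecs)
  have into: "act_list B S \<alpha>s x \<in> ?W" if x: "x \<in> vecs B" for x
  proof -
    have "act B (act_list B S \<alpha>s x) (\<lambda>i j. \<beta> (S i j)) = (\<lambda>i. 0)" if \<beta>: "\<beta> \<in> aug_functionals J" for \<beta>
    proof (rule ccontr)
      assume "\<not> ?thesis"
      then have "P (Suc m)" unfolding P_def
        using \<alpha>s \<beta> x by (intro exI[of _ "\<alpha>s @ [\<beta>]"] exI[of _ x]) (simp add: act_list_simps)
      then show False using max by fastforce
    qed
    then show ?thesis using vecs[OF x] by (simp add: H.fixed_vectors_def[OF J S])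
  qed
  have kills: "act_list B S \<alpha>s x = (\<lambda>i. 0)" if x: "x \<in> ?W" for x
  proof (cases \<alpha>s)
    case Nil
    then show ?thesis using \<open>m \<noteq> 0\<close> \<alpha>s(2) by simp
  next
    case (Cons \<alpha> \<beta>s)
    have "act B x (\<lambda>i j. \<alpha> (S i j)) = (\<lambda>i. 0)" using x \<alpha>s(1) Cons by (simp add: H.fixed_vectors_def[OF J S])
    moreover have "act_list B S \<beta>s (\<lambda>i. 0) = (\<lambda>i. 0)" by (induction \<beta>s) (simp_all add: act_list_simps act_zero)
    ultimately show ?thesis by (simp add: Cons act_list_simps)
  qed
  obtain C where C: "finite C" "\<And>\<pi> x. base_change_projection \<iota> B (matrices R) ?W C \<pi> \<Longrightarrow>
    x \<in> vecs B \<Longrightarrow> \<pi> (act_list B S \<alpha>s x) = act_list B S \<alpha>s (\<pi> x)"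
    using act_list_commutes[OF \<iota> B W J_ideal IJ, of \<alpha>s R] \<alpha>s(1) aug unfolding S_def by blast
  \<comment> \<open>Operators over \<open>k\<close> extend to operators of \<open>H\<close> by
    extension of functionals. Normality of \<open>J\<close> enters here, through
    \<open>fixed_vectors_stable\<close>.\<close>
  have stable: "act B x (\<lambda>i j. \<iota> (a i j)) \<in> ?W" if x: "x \<in> ?W" and a: "a \<in> matrices R" for x a
  proof -
    obtain \<alpha> where \<alpha>: "\<alpha> \<in> functionals I" "a = (\<lambda>i j. \<alpha> (R i j))" using a unfolding matrices_def by blast
    have "functional_bc \<iota> \<alpha> \<in> functionals (defideal H)"
      using functional_bc_functionals[OF \<iota> \<alpha>(1) I_ideal] by (simp add: H_def bc_defideal[OF \<iota>])
    from H.fixed_vectors_stable[OF J S normal[folded H_def] x this]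
    moreover have "lin \<alpha>" using \<alpha>(1) by (simp add: functionals_def)
    ultimately show ?thesis by (simp add: \<alpha>(2) S_def functional_bc_map_coeffs[OF \<iota>])
  qed
  have irred: "Y = {\<lambda>i. 0} \<or> Y = vecs B"
    if "vec_subspace B Y" "\<And>y a. y \<in> Y \<Longrightarrow> a \<in> matrices R \<Longrightarrow> act B y a \<in> Y" for Y
  proof -
    have "stable G B R Y" using that(2) unfolding stable_def matrices_def by blast
    then show ?thesis using irr that(1) by (simp add: irreducible_rep_def)
  qed
  obtain \<pi> where \<pi>: "base_change_projection \<iota> B (matrices R) ?W C \<pi>"
    using commuting_projection_exists[OF \<iota> B W stable irred separable_algebraic_extensionD(2)[OF sep] C(1)] by blast
  have "act_list B S \<alpha>s y = \<pi> (act_list B S \<alpha>s y)"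
    using \<pi> into[OF y(1)] unfolding base_change_projection_def by simp
  also have "\<dots> = act_list B S \<alpha>s (\<pi> y)" by (rule C(2)[OF \<pi> y(1)])
  also have "\<dots> = (\<lambda>i. 0)" using kills \<pi> y(1) unfolding base_change_projection_def by blast
  finally show False using y(2) by simp
qed

end

subsection \<open>Every function is a matrix coefficient\<close>

lemma Const_of_bool [simp]: "Const (of_bool P) = of_bool P"
  by (cases P) simp_all

text \<open>The summands are indexed by natural numbers because these indices will number the basis
  of a representation.\<close>

definition tensor_expr :: "('v, 'k::field) mpoly set \<Rightarrow> ('v + 'v, 'k) mpoly \<Rightarrow> nat set
    \<Rightarrow> (nat \<Rightarrow> ('v, 'k) mpoly) \<Rightarrow> (nat \<Rightarrow> ('v, 'k) mpoly) \<Rightarrow> bool" where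
  "tensor_expr I P B a b \<longleftrightarrow> finite B \<and> eqm (prod_scheme I I) P (\<Sum>i\<in>B. subst pr1 (a i) * subst pr2 (b i))"

definition independent_mod :: "('v, 'k::field) mpoly set \<Rightarrow> nat set \<Rightarrow> (nat \<Rightarrow> ('v, 'k) mpoly) \<Rightarrow> bool" where
  "independent_mod I B a \<longleftrightarrow> (\<forall>c. (\<Sum>i\<in>B. Const (c i) * a i) \<in> I \<longrightarrow> (\<forall>k\<in>B. c k = 0))"

lemma independent_modD:
  "independent_mod I B a \<Longrightarrow> (\<Sum>i\<in>B. Const (c i) * a i) \<in> I \<Longrightarrow> k \<in> B \<Longrightarrow> c k = 0"
  by (simp add: independent_mod_def)

text \<open>The free starting index \<open>N\<close> lets two sums be joined end to end; later it
  keeps the index sets of different representations apart.\<close>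

lemma tensor_sum_exists:
  "\<exists>M\<ge>N::nat. \<exists>a b. (P :: ('v + 'v, 'k::field) mpoly) = (\<Sum>i\<in>{N..<M}. subst pr1 (a i) * subst pr2 (b i))"
proof (induction P arbitrary: N rule: tensor_induct)
  case (add P Q)
  obtain M1 a1 b1 where 1: "N \<le> M1" "P = (\<Sum>i\<in>{N..<M1}. subst pr1 (a1 i) * subst pr2 (b1 i))"
    using add(1)[of N] by (elim exE conjE)
  obtain M2 a2 b2 where 2: "M1 \<le> M2" "Q = (\<Sum>i\<in>{M1..<M2}. subst pr1 (a2 i) * subst pr2 (b2 i))"
    using add(2)[of M1] by (elim exE conjE)
  let ?a = "\<lambda>i. if i < M1 then a1 i else a2 i" and ?b = "\<lambda>i. if i < M1 then b1 i else b2 i"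
  have "(\<Sum>i\<in>{N..<M2}. subst pr1 (?a i) * subst pr2 (?b i)) =
    (\<Sum>i\<in>{N..<M1}. subst pr1 (?a i) * subst pr2 (?b i)) + (\<Sum>i\<in>{M1..<M2}. subst pr1 (?a i) * subst pr2 (?b i))"
    by (rule sum.atLeastLessThan_concat[OF 1(1) 2(1), symmetric])
  moreover have "(\<Sum>i\<in>{N..<M1}. subst pr1 (?a i) * subst pr2 (?b i)) = P"
    unfolding 1(2) by (rule sum.cong) auto
  moreover have "(\<Sum>i\<in>{M1..<M2}. subst pr1 (?a i) * subst pr2 (?b i)) = Q"
    unfolding 2(2) by (rule sum.cong) auto
  ultimately have "P + Q = (\<Sum>i\<in>{N..<M2}. subst pr1 (?a i) * subst pr2 (?b i))" by simp
  then show ?case using 1(1) 2(1) by (intro exI[of _ M2] conjI exI[of _ ?a] exI[of _ ?b]) auto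
next
  case (tensor a b)
  show ?case by (intro exI[of _ "Suc N"] conjI exI[of _ "\<lambda>_. a"] exI[of _ "\<lambda>_. b"]) auto
qed

text \<open>A relation among the \<open>a i\<close> eliminates one of them, its coefficients being
  absorbed into the other \<open>b i\<close>; the expression would become shorter.\<close>

lemma tensor_expr_minimal_independent:
  assumes I: "is_ideal I" and e: "tensor_expr I P B a b"
    and min: "\<And>B' a' b'. B' \<subset> B \<Longrightarrow> \<not> tensor_expr I P B' a' b'"
  shows "independent_mod I B a"
  unfolding independent_mod_def
proof (intro allI impI ballI, rule ccontr)
  fix c k
  assume c: "(\<Sum>i\<in>B. Const (c i) * a i) \<in> I" and k: "k \<in> B" and ck: "c k \<noteq> 0"
  let ?K = "prod_scheme I I" and ?B = "B - {k}"
  have K: "is_ideal ?K" by simp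
  have B: "finite B" using e by (simp add: tensor_expr_def)
  define d where "d = (\<lambda>i. - c i / c k)"
  have "Const (inverse (c k)) * (\<Sum>i\<in>B. Const (c i) * a i) = a k - (\<Sum>i\<in>?B. Const (d i) * a i)"
  proof -
    have "Const (inverse (c k)) * (\<Sum>i\<in>B. Const (c i) * a i) = (\<Sum>i\<in>B. Const (inverse (c k) * c i) * a i)"
      by (simp add: sum_distrib_left Const_mult mult.assoc)
    also have "\<dots> = a k + (\<Sum>i\<in>?B. Const (inverse (c k) * c i) * a i)"
      using B k ck by (simp add: sum.remove[of B k])
    also have "(\<Sum>i\<in>?B. Const (inverse (c k) * c i) * a i) = - (\<Sum>i\<in>?B. Const (d i) * a i)"
      by (simp add: d_def divide_inverse mult.commute flip: sum_negf)
         (simp add: Const_def single_uminus)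
    finally show ?thesis by simp
  qed
  then have "eqm I (a k) (\<Sum>i\<in>?B. Const (d i) * a i)"
    using ideal_mult[OF I c, of "Const (inverse (c k))"] by (simp add: eqm_def)
  from subst_eqm_morphism[OF morphism_pr1 this]
  have ak: "eqm ?K (subst pr1 (a k)) (\<Sum>i\<in>?B. Const (d i) * subst pr1 (a i))" by (simp add: subst_simps)
  let ?b = "\<lambda>i. b i + Const (d i) * b k"
  have "eqm ?K P (subst pr1 (a k) * subst pr2 (b k) + (\<Sum>i\<in>?B. subst pr1 (a i) * subst pr2 (b i)))"
    using e B k by (simp add: tensor_expr_def sum.remove[of B k])
  also have "eqm ?K \<dots> ((\<Sum>i\<in>?B. Const (d i) * subst pr1 (a i)) * subst pr2 (b k) + (\<Sum>i\<in>?B. subst pr1 (a i) * subst pr2 (b i)))"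
    by (intro eqm_add[OF K] eqm_mult[OF K] ak eqm_refl[OF K])
  also (eqm_trans[OF K]) have "\<dots> = (\<Sum>i\<in>?B. subst pr1 (a i) * subst pr2 (?b i))"
    by (simp add: subst_simps distrib_left sum.distrib sum_distrib_right sum_distrib_left mult_ac)
  finally have "tensor_expr I P ?B a ?b" using B by (simp add: tensor_expr_def)
  then show False using min[of ?B a ?b] k by blast
qed

lemma tensor_expr_swap:
  assumes "tensor_expr I P B a b"
  shows "tensor_expr I (subst (case_sum pr2 pr1) P) B b a"
proof -
  have "morphism (prod_scheme I I) (prod_scheme I I) (case_sum pr2 pr1)"
    by (intro morphism_case_sum morphism_pr1 morphism_pr2 prod_scheme_ideal)
  from subst_eqm_morphism[OF this] assms show ?thesis
    by (fastforce simp: tensor_expr_def subst_simps swap_pr mult.commute)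
qed

text \<open>Independence puts \<open>a j\<close> outside the span of \<open>I\<close> and the
  remaining \<open>a i\<close>, from which it can be separated.\<close>

lemma dual_functional:
  assumes I: "is_ideal I" and B: "finite B" and ind: "independent_mod I B a"
    and j: "j \<in> B"
  shows "\<exists>\<alpha>\<in>functionals I. \<forall>i\<in>B. \<alpha> (a i) = of_bool (i = j)"
proof -
  let ?B = "B - {j}"
  let ?Z = "{z. \<exists>c. z - (\<Sum>i\<in>?B. Const (c i) * a i) \<in> I}"
  have Z: "lin_subspace ?Z"
    unfolding module.subspace_def[OF mpoly_module]
  proof (intro conjI ballI allI)
    show "0 \<in> ?Z" using idealD(1)[OF I] by (auto intro!: exI[of _ "\<lambda>_. 0"])
    fix x assume "x \<in> ?Z"
    then obtain c where c: "x - (\<Sum>i\<in>?B. Const (c i) * a i) \<in> I" by blast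
    show "x + y \<in> ?Z" if "y \<in> ?Z" for y
    proof -
      obtain d where d: "y - (\<Sum>i\<in>?B. Const (d i) * a i) \<in> I" using \<open>y \<in> ?Z\<close> by blast
      have "x + y - (\<Sum>i\<in>?B. Const (c i + d i) * a i) \<in> I"
        using ideal_add[OF I c d] by (simp add: Const_add distrib_right sum.distrib algebra_simps)
      then show ?thesis by (intro CollectI exI[of _ "\<lambda>i. c i + d i"])
    qed
    show "Const e * x \<in> ?Z" for e
    proof -
      have "Const e * x - (\<Sum>i\<in>?B. Const (e * c i) * a i) \<in> I"
        using ideal_mult[OF I c, of "Const e"] by (simp add: Const_mult right_diff_distrib sum_distrib_left mult.assoc)
      then show ?thesis by (intro CollectI exI[of _ "\<lambda>i. e * c i"])
    qed
  qed
  have "a j \<notin> ?Z"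
  proof
    assume "a j \<in> ?Z"
    then obtain c where c: "a j - (\<Sum>i\<in>?B. Const (c i) * a i) \<in> I" by blast
    have "(\<Sum>i\<in>B. Const ((\<lambda>i. if i = j then 1 else - c i) i) * a i) = a j + (\<Sum>i\<in>?B. Const (- c i) * a i)"
      using B j by (simp add: sum.remove[of B j])
    also have "\<dots> = a j - (\<Sum>i\<in>?B. Const (c i) * a i)"
      by (simp add: Const_def single_uminus sum_negf)
    finally show False using independent_modD[OF ind, of "\<lambda>i. if i = j then 1 else - c i" j] c j by simp
  qed
  from separating_functional[OF Z this] obtain \<alpha> where \<alpha>: "lin \<alpha>" "\<And>z. z \<in> ?Z \<Longrightarrow> \<alpha> z = 0" "\<alpha> (a j) = 1" by blast
  have "I \<subseteq> ?Z" by (auto intro!: exI[of _ "\<lambda>_. 0"])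
  then have 1: "\<alpha> \<in> functionals I" using \<alpha> by (auto simp: functionals_def)
  have "a i \<in> ?Z" if "i \<in> ?B" for i
  proof -
    have "(\<Sum>l\<in>?B. Const (of_bool (l = i)) * a l) = a i"
      using that B by (subst sum.remove[of ?B i]) (auto intro: sum.neutral)
    then show ?thesis using idealD(1)[OF I] by (auto intro!: exI[of _ "\<lambda>l. of_bool (l = i)"])
  qed
  then show ?thesis using 1 \<alpha>(2,3) by (intro bexI[OF _ 1]) auto
qed

lemma SL_subst_left:
  assumes "lin \<alpha>"
  shows "SL \<alpha> (subst (case_sum pr1 (\<lambda>v. pr2 (Inl v))) Q * subst (\<lambda>v. pr2 (Inr v)) q) = subst pr1 (SL \<alpha> Q) * subst pr2 q"
proof (induction Q rule: tensor_induct)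
  case (add p q)
  then show ?case by (simp add: subst_simps SL_add[OF assms] distrib_right)
next
  case (tensor a b)
  have e: "subst (case_sum pr1 (\<lambda>v. pr2 (Inl v))) (subst pr1 a * subst pr2 b) * subst (\<lambda>v. pr2 (Inr v)) q =
    subst pr1 a * subst pr2 (subst pr1 b * subst pr2 q)"
    by (simp add: subst_simps subst_subst mult.assoc)
  show ?case
    by (subst e, subst (1 2) SL_tensor[OF assms]) (simp add: subst_simps mult.assoc)
qed

context aff_group
begin

text \<open>Coassociativity writes one element of the triple product in two ways. The functional
  dual to \<open>a j\<close>, applied to the first factor, leaves \<open>comult (b j)\<close> on one
  side and an expression with the same right factors on the other.\<close>

lemma comult_left:
  assumes e: "tensor_expr I (comult p) B a b" and \<alpha>: "\<alpha> \<in> functionals I" and j: "j \<in> B"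
    and dual: "\<forall>i\<in>B. \<alpha> (a i) = of_bool (i = j)"
  shows "tensor_expr I (comult (b j)) B (\<lambda>i. SL \<alpha> (comult (a i))) b"
proof -
  have lin: "lin \<alpha>" using \<alpha> by (simp add: functionals_def)
  have B: "finite B" and ee: "eqm (prod_scheme I I) (comult p) (\<Sum>i\<in>B. subst pr1 (a i) * subst pr2 (b i))"
    using e by (auto simp: tensor_expr_def)
  let ?K = "prod_scheme I (prod_scheme I I)"
  have K: "is_ideal ?K" by simp
  let ?y = "\<lambda>v. pr2 (Inl v)" and ?z = "\<lambda>v. pr2 (Inr v)"
  have y2: "morphism (prod_scheme I (prod_scheme I I)) I (\<lambda>v. subst pr2 (pr1 v))"
    and z2: "morphism (prod_scheme I (prod_scheme I I)) I (\<lambda>v. subst pr2 (pr2 v))"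
    using prod_scheme_pr2[OF prod_scheme_pr1] prod_scheme_pr2[OF prod_scheme_pr2]
    by (simp_all only: morphism_def subst_subst[symmetric]) blast+
  have x: "morphism ?K I pr1" and y: "morphism ?K I ?y" and z: "morphism ?K I ?z"
    using y2 z2 by (auto intro: morphism_pr1 simp: subst_simps)
  have yz: "subst (pmult G ?y ?z) q = subst pr2 (comult q)" for q
  proof -
    have e: "case_sum ?y ?z = pr2" by (rule ext) (auto split: sum.split)
    show ?thesis unfolding subst_pmult e ..
  qed
  have "eqm ?K (\<Sum>i\<in>B. subst (pmult G pr1 ?y) (a i) * subst ?z (b i)) (subst (pmult G (pmult G pr1 ?y) ?z) p)"
    using eqm_sym[OF K subst_eqm_morphism[OF morphism_case_sum[OF K pmult_point[OF K x y] z] ee]]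
    by (simp add: subst_simps subst_subst subst_pmult[of G "pmult G pr1 ?y" ?z])
  also have "eqm ?K \<dots> (subst (pmult G pr1 (pmult G ?y ?z)) p)"
    by (intro eqm_subst[OF K] pmult_assoc[OF K x y z])
  also (eqm_trans[OF K]) have "eqm ?K \<dots> (\<Sum>i\<in>B. subst pr1 (a i) * subst (pmult G ?y ?z) (b i))"
    using subst_eqm_morphism[OF morphism_case_sum[OF K x pmult_point[OF K y z]] ee]
    by (simp add: subst_simps subst_subst subst_pmult[of G pr1 "pmult G ?y ?z"])
  finally (eqm_trans[OF K]) have "eqm ?K (\<Sum>i\<in>B. subst (pmult G pr1 ?y) (a i) * subst ?z (b i))
     (\<Sum>i\<in>B. subst pr1 (a i) * subst pr2 (comult (b i)))" unfolding yz .
  from SL_functionals[OF \<alpha> I_ideal prod_scheme_ideal this[unfolded eqm_def]]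
  have 1: "eqm (prod_scheme I I) (\<Sum>i\<in>B. subst pr1 (SL \<alpha> (comult (a i))) * subst pr2 (b i)) (\<Sum>i\<in>B. Const (\<alpha> (a i)) * comult (b i))"
    by (simp add: eqm_def SL_diff[OF lin] SL_sum[OF lin] SL_tensor[OF lin] subst_pmult SL_subst_left[OF lin])
  have "(\<Sum>i\<in>B. Const (\<alpha> (a i)) * comult (b i)) = (\<Sum>i\<in>B. of_bool (j = i) * comult (b i))"
    using dual by (intro sum.cong refl) auto
  also have "\<dots> = comult (b j)" by (rule sum_of_bool(2)[OF B j])
  finally show ?thesis using eqm_sym[OF prod_scheme_ideal 1] B by (simp only: tensor_expr_def)
qed

text \<open>The \<open>b i\<close> span a comodule with matrix \<open>r\<close>. As they are
  independent, comparing coefficients in the counit law and in coassociativity gives the two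
  identities of a representation.\<close>

lemma rep_of_comult:
  assumes e: "\<And>j. j \<in> B \<Longrightarrow> tensor_expr I (comult (b j)) B (r j) b" and B: "finite B"
    and ind: "independent_mod I B b"
  shows "rep G B r"
  unfolding rep_def
proof (intro conjI ballI)
  show "finite B" by (rule B)
  fix j i assume j: "j \<in> B" and i: "i \<in> B"
  have ee: "eqm (prod_scheme I I) (comult (b l)) (\<Sum>i\<in>B. subst pr1 (r l i) * subst pr2 (b i))" if "l \<in> B" for l
    using e that by (simp add: tensor_expr_def)
  have "eqm I (b j) (\<Sum>i\<in>B. Const (counit (r j i)) * b i)"
  proof -
    from SL_functionals[OF counit_functional I_ideal I_ideal ee[OF j, unfolded eqm_def]]
    have "eqm I (SL counit (comult (b j))) (\<Sum>i\<in>B. Const (counit (r j i)) * b i)"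
      by (simp add: eqm_def SL_diff[OF lin_counit] SL_sum[OF lin_counit] SL_tensor[OF lin_counit])
    then show ?thesis using eqm_trans[OF I_ideal eqm_sym[OF I_ideal SL_counit]] by blast
  qed
  then have "(\<Sum>i\<in>B. of_bool (j = i) * b i) - (\<Sum>i\<in>B. Const (counit (r j i)) * b i) \<in> I"
    by (simp add: eqm_def sum_of_bool[OF B j])
  also have "(\<Sum>i\<in>B. of_bool (j = i) * b i) - (\<Sum>i\<in>B. Const (counit (r j i)) * b i) =
     (\<Sum>i\<in>B. Const (of_bool (j = i) - counit (r j i)) * b i)"
    by (simp only: sum_subtractf[symmetric] Const_diff left_diff_distrib Const_of_bool)
  finally have "of_bool (j = i) - counit (r j i) = 0" by (rule independent_modD[OF ind _ i])
  then show "counit (r j i) = of_bool (j = i)" by simp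
  \<comment> \<open>\<beta> reads off the coefficient of \<open>b i\<close> in the last factor of
    the triple product.\<close>
  obtain \<beta> where \<beta>: "\<beta> \<in> functionals I" "\<forall>l\<in>B. \<beta> (b l) = of_bool (l = i)"
    using dual_functional[OF I_ideal B ind i] by blast
  have lin: "lin \<beta>" using \<beta>(1) by (simp add: functionals_def)
  let ?K = "prod_scheme (prod_scheme I I) I"
  have K: "is_ideal ?K" by simp
  let ?x = "\<lambda>v. pr1 (Inl v)" and ?y = "\<lambda>v. pr1 (Inr v)"
  have x2: "morphism ?K I (\<lambda>v. subst pr1 (pr1 v))"
    and y2: "morphism ?K I (\<lambda>v. subst pr1 (pr2 v))"
    using prod_scheme_pr1[OF prod_scheme_pr1] prod_scheme_pr1[OF prod_scheme_pr2]
    by (simp_all only: morphism_def subst_subst[symmetric]) blast+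
  have x: "morphism ?K I ?x" and y: "morphism ?K I ?y" and z: "morphism ?K I pr2"
    using x2 y2 by (auto intro: morphism_pr2 simp: subst_simps)
  have xy: "subst (pmult G ?x ?y) q = subst pr1 (comult q)" for q
  proof -
    have e: "case_sum ?x ?y = pr1" by (rule ext) (auto split: sum.split)
    show ?thesis unfolding subst_pmult e ..
  qed
  have "eqm ?K (\<Sum>l\<in>B. subst (pmult G ?x ?y) (r j l) * subst pr2 (b l)) (subst (pmult G (pmult G ?x ?y) pr2) (b j))"
    using eqm_sym[OF K subst_eqm_morphism[OF morphism_case_sum[OF K pmult_point[OF K x y] z] ee[OF j]]]
    by (simp add: subst_simps subst_subst subst_pmult[of G "pmult G ?x ?y" pr2])
  also have "eqm ?K \<dots> (subst (pmult G ?x (pmult G ?y pr2)) (b j))"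
    by (intro eqm_subst[OF K] pmult_assoc[OF K x y z])
  also (eqm_trans[OF K]) have "eqm ?K \<dots> (\<Sum>l\<in>B. subst ?x (r j l) * subst (pmult G ?y pr2) (b l))"
    using subst_eqm_morphism[OF morphism_case_sum[OF K x pmult_point[OF K y z]] ee[OF j]]
    by (simp add: subst_simps subst_subst subst_pmult[of G ?x "pmult G ?y pr2"])
  also (eqm_trans[OF K]) have "eqm ?K \<dots> (\<Sum>l\<in>B. subst ?x (r j l) * (\<Sum>i\<in>B. subst ?y (r l i) * subst pr2 (b i)))"
  proof (intro eqm_sum[OF K] eqm_mult[OF K] eqm_refl[OF K])
    fix l assume "l \<in> B"
    from subst_eqm_morphism[OF morphism_case_sum[OF K y z] ee[OF this]]
    show "eqm ?K (subst (pmult G ?y pr2) (b l)) (\<Sum>i\<in>B. subst ?y (r l i) * subst pr2 (b i))"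
      by (simp add: subst_simps subst_subst subst_pmult)
  qed
  also (eqm_trans[OF K]) have "(\<Sum>l\<in>B. subst ?x (r j l) * (\<Sum>i\<in>B. subst ?y (r l i) * subst pr2 (b i))) =
     (\<Sum>i\<in>B. subst pr1 (\<Sum>l\<in>B. subst pr1 (r j l) * subst pr2 (r l i)) * subst pr2 (b i))"
    by (simp add: subst_simps subst_subst sum_distrib_left sum_distrib_right mult.assoc, subst sum.swap, rule refl)
  finally have "eqm ?K (\<Sum>l\<in>B. subst pr1 (comult (r j l)) * subst pr2 (b l))
     (\<Sum>i\<in>B. subst pr1 (\<Sum>l\<in>B. subst pr1 (r j l) * subst pr2 (r l i)) * subst pr2 (b i))" unfolding xy .
  from SR_functionals[OF \<beta>(1) I_ideal prod_scheme_ideal this[unfolded eqm_def]]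
  have "eqm (prod_scheme I I) (\<Sum>l\<in>B. Const (\<beta> (b l)) * comult (r j l))
      (\<Sum>i\<in>B. Const (\<beta> (b i)) * (\<Sum>l\<in>B. subst pr1 (r j l) * subst pr2 (r l i)))"
    unfolding eqm_def SR_diff[OF lin] SR_sum[OF lin] SR_tensor[OF lin] .
  moreover have "(\<Sum>l\<in>B. Const (\<beta> (b l)) * q l) = q i" for q :: "nat \<Rightarrow> ('v + 'v, 'k) mpoly"
  proof -
    have "(\<Sum>l\<in>B. Const (\<beta> (b l)) * q l) = (\<Sum>l\<in>B. of_bool (i = l) * q l)"
      using \<beta>(2) by (intro sum.cong refl) auto
    then show ?thesis by (simp add: sum_of_bool[OF B i])
  qed
  ultimately show "eqm (prod_scheme I I) (comult (r j i)) (\<Sum>l\<in>B. subst pr1 (r j l) * subst pr2 (r l i))" by simp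
qed

text \<open>In an expression of \<open>comult p\<close> with the fewest terms both families are
  independent, and the right one spans a comodule that contains \<open>p\<close> modulo
  \<open>I\<close>. Avoiding indices below \<open>N\<close> leaves room for a direct sum.\<close>

lemma coefficient_rep_exists:
  "\<exists>B R u. rep G B R \<and> B \<inter> {..<N} = {} \<and> eqm I p (\<Sum>i\<in>B. \<Sum>j\<in>B. Const (u i j) * R i j)"
proof -
  let ?P = "\<lambda>B. B \<inter> {..<N} = {} \<and> (\<exists>a b. tensor_expr I (comult p) B a b)"
  obtain M a b where "comult p = (\<Sum>i\<in>{N..<M}. subst pr1 (a i) * subst pr2 (b i))"
    using tensor_sum_exists[of N "comult p"] by (elim exE conjE)
  then have "tensor_expr I (comult p) {N..<M} a b" by (simp add: tensor_expr_def eqm_refl[OF prod_scheme_ideal])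
  then have "?P {N..<M}" by auto
  then obtain B where B: "?P B" and least: "\<And>B'. ?P B' \<Longrightarrow> card B \<le> card B'"
    using ex_has_least_nat[of ?P "{N..<M}" card] by blast
  then obtain a b where e: "tensor_expr I (comult p) B a b" by blast
  have fin: "finite B" using e by (simp add: tensor_expr_def)
  have min: "\<not> tensor_expr I (comult p) B' a' b'" if "B' \<subset> B" for B' a' b'
    using least[of B'] that B psubset_card_mono[OF fin that] by (meson disjoint_iff not_le psubsetD)
  have inda: "independent_mod I B a"
    by (rule tensor_expr_minimal_independent[OF I_ideal e min])
  have min': "\<not> tensor_expr I (subst (case_sum pr2 pr1) (comult p)) B' a' b'" if "B' \<subset> B" for B' a' b'
  proof
    assume "tensor_expr I (subst (case_sum pr2 pr1) (comult p)) B' a' b'"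
    from tensor_expr_swap[OF this]
    have "tensor_expr I (subst (case_sum pr2 pr1) (subst (case_sum pr2 pr1) (comult p))) B' b' a'" .
    moreover have "subst (case_sum pr2 pr1) (subst (case_sum pr2 pr1) q) = q" for q :: "('v + 'v, 'k) mpoly"
      by (induction q rule: tensor_induct) (simp_all add: subst_simps swap_pr)
    ultimately show False using min[OF that] by simp
  qed
  have indb: "independent_mod I B b"
    by (rule tensor_expr_minimal_independent[OF I_ideal tensor_expr_swap[OF e] min'])
  have "\<forall>j\<in>B. \<exists>\<alpha>\<in>functionals I. \<forall>i\<in>B. \<alpha> (a i) = of_bool (i = j)"
    using dual_functional[OF I_ideal fin inda] by blast
  then obtain \<alpha> where \<alpha>: "\<And>j. j \<in> B \<Longrightarrow> \<alpha> j \<in> functionals I" "\<And>j. j \<in> B \<Longrightarrow> \<forall>i\<in>B. \<alpha> j (a i) = of_bool (i = j)"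
    by metis
  define r where "r = (\<lambda>j i. SL (\<alpha> j) (comult (a i)))"
  have er: "tensor_expr I (comult (b j)) B (r j) b" if "j \<in> B" for j
    unfolding r_def by (rule comult_left[OF e \<alpha>(1)[OF that] that \<alpha>(2)[OF that]])
  have rep: "rep G B r" by (rule rep_of_comult[OF er fin indb])
  \<comment> \<open>The counit on the left factor writes \<open>p\<close> through the
    \<open>b j\<close>; on the right factor it writes each \<open>b j\<close> through the entries
    \<open>r j i\<close>.\<close>
  have "SL counit (comult p - (\<Sum>i\<in>B. subst pr1 (a i) * subst pr2 (b i))) \<in> I"
    by (rule SL_functionals[OF counit_functional I_ideal I_ideal]) (use e in \<open>simp add: tensor_expr_def eqm_def\<close>)
  then have "eqm I (SL counit (comult p)) (\<Sum>i\<in>B. Const (counit (a i)) * b i)"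
    by (simp add: eqm_def SL_diff[OF lin_counit] SL_sum[OF lin_counit] SL_tensor[OF lin_counit])
  then have 1: "eqm I p (\<Sum>j\<in>B. Const (counit (a j)) * b j)"
    using eqm_trans[OF I_ideal eqm_sym[OF I_ideal SL_counit]] by blast
  have 2: "eqm I (b j) (\<Sum>i\<in>B. Const (counit (b i)) * r j i)" if j: "j \<in> B" for j
  proof -
    have "SR counit (comult (b j) - (\<Sum>i\<in>B. subst pr1 (r j i) * subst pr2 (b i))) \<in> I"
      by (rule SR_functionals[OF counit_functional I_ideal I_ideal]) (use er[OF j] in \<open>simp add: tensor_expr_def eqm_def\<close>)
    then have "eqm I (SR counit (comult (b j))) (\<Sum>i\<in>B. Const (counit (b i)) * r j i)"
      by (simp add: eqm_def SR_diff[OF lin_counit] SR_sum[OF lin_counit] SR_tensor[OF lin_counit])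
    then show ?thesis using eqm_trans[OF I_ideal eqm_sym[OF I_ideal SR_counit]] by blast
  qed
  have "eqm I p (\<Sum>j\<in>B. Const (counit (a j)) * (\<Sum>i\<in>B. Const (counit (b i)) * r j i))"
    by (rule eqm_trans[OF I_ideal 1]) (intro eqm_sum[OF I_ideal] eqm_mult[OF I_ideal] eqm_refl[OF I_ideal] 2)
  then have "eqm I p (\<Sum>j\<in>B. \<Sum>i\<in>B. Const (counit (a j) * counit (b i)) * r j i)"
    by (simp add: sum_distrib_left Const_mult mult.assoc)
  then show ?thesis using rep B by (intro exI[of _ B] exI[of _ r] exI[of _ "\<lambda>j i. counit (a j) * counit (b i)"]) blast
qed

text \<open>Direct sums on disjoint index sets. The induction starts from the trivial
  one-dimensional representation, so \<open>B\<close> is nonempty, as the size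
  \<open>n \<ge> 1\<close> of a unitriangular group requires.\<close>

lemma coefficients_rep_exists:
  assumes "finite P"
  shows "\<exists>B R. rep G B R \<and> B \<noteq> {} \<and> (\<forall>p\<in>P. \<exists>u. eqm I p (\<Sum>i\<in>B. \<Sum>j\<in>B. Const (u i j) * R i j))"
  using assms
proof (induction P)
  case empty
  have "rep G {0} (\<lambda>i j. 1)"
    by (simp add: rep_def subst_simps counit_simps eqm_refl)
  then show ?case by blast
next
  case (insert p P)
  then obtain B1 R1 where 1: "rep G B1 R1" "B1 \<noteq> {}" "\<And>p. p \<in> P \<Longrightarrow> \<exists>u. eqm I p (\<Sum>i\<in>B1. \<Sum>j\<in>B1. Const (u i j) * R1 i j)"
    by blast
  obtain N where N: "B1 \<subseteq> {..<N}" using finite_nat_bounded[OF rep_finite[OF 1(1)]] by blast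
  obtain B2 R2 u2 where 2: "rep G B2 R2" "B2 \<inter> {..<N} = {}" "eqm I p (\<Sum>i\<in>B2. \<Sum>j\<in>B2. Const (u2 i j) * R2 i j)"
    using coefficient_rep_exists by blast
  have disj: "B1 \<inter> B2 = {}" using N 2(2) by blast
  have fin: "finite B1" "finite B2" using 1 2 rep_finite by auto
  define R where "R = (\<lambda>i j. if i \<in> B1 \<and> j \<in> B1 then R1 i j else if i \<in> B2 \<and> j \<in> B2 then R2 i j else 0)"
  have R12: "\<And>i j. i \<in> B1 \<Longrightarrow> j \<in> B1 \<Longrightarrow> R i j = R1 i j" "\<And>i j. i \<in> B2 \<Longrightarrow> j \<in> B2 \<Longrightarrow> R i j = R2 i j"
    "\<And>i j. i \<in> B1 \<Longrightarrow> j \<in> B2 \<Longrightarrow> R i j = 0" "\<And>i j. i \<in> B2 \<Longrightarrow> j \<in> B1 \<Longrightarrow> R i j = 0"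
    using disj by (auto simp: R_def)
  have ne: "i \<noteq> j" if "i \<in> B1" "j \<in> B2" for i j using that disj by auto
  have "rep G (B1 \<union> B2) R"
    unfolding rep_def
  proof (intro conjI ballI)
    show "finite (B1 \<union> B2)" using fin by simp
    fix i j assume ij: "i \<in> B1 \<union> B2" "j \<in> B1 \<union> B2"
    show "counit (R i j) = of_bool (i = j)"
      using ij rep_counit[OF 1(1)] rep_counit[OF 2(1)] by (auto simp: R12 counit_simps dest: ne)
    have s: "(\<Sum>l\<in>B1 \<union> B2. subst pr1 (R i l) * subst pr2 (R l j)) =
      (\<Sum>l\<in>B1. subst pr1 (R i l) * subst pr2 (R l j)) + (\<Sum>l\<in>B2. subst pr1 (R i l) * subst pr2 (R l j))"
      by (rule sum.union_disjoint[OF fin disj])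
    show "eqm (prod_scheme I I) (comult (R i j)) (\<Sum>l\<in>B1 \<union> B2. subst pr1 (R i l) * subst pr2 (R l j))"
      unfolding s using ij rep_comult[OF 1(1)] rep_comult[OF 2(1)]
      by (auto simp: R12 subst_simps eqm_refl)
  qed
  moreover have "\<exists>u. eqm I q (\<Sum>i\<in>B1 \<union> B2. \<Sum>j\<in>B1 \<union> B2. Const (u i j) * R i j)" if q: "q \<in> insert p P" for q
  proof (cases "q = p")
    case True
    have "(\<Sum>i\<in>B1 \<union> B2. \<Sum>j\<in>B1 \<union> B2. Const (if i \<in> B2 \<and> j \<in> B2 then u2 i j else 0) * R i j) =
       (\<Sum>i\<in>B2. \<Sum>j\<in>B1 \<union> B2. Const (if i \<in> B2 \<and> j \<in> B2 then u2 i j else 0) * R i j)"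
      using fin by (intro sum.mono_neutral_right) auto
    also have "\<dots> = (\<Sum>i\<in>B2. \<Sum>j\<in>B2. Const (u2 i j) * R2 i j)"
      using fin by (intro sum.cong[OF refl] sum.mono_neutral_cong_right) (auto simp: R12)
    finally show ?thesis using 2(3) True by (intro exI[of _ "\<lambda>i j. if i \<in> B2 \<and> j \<in> B2 then u2 i j else 0"]) simp
  next
    case False
    then obtain u where u: "eqm I q (\<Sum>i\<in>B1. \<Sum>j\<in>B1. Const (u i j) * R1 i j)" using 1(3) q by blast
    have "(\<Sum>i\<in>B1 \<union> B2. \<Sum>j\<in>B1 \<union> B2. Const (if i \<in> B1 \<and> j \<in> B1 then u i j else 0) * R i j) =
       (\<Sum>i\<in>B1. \<Sum>j\<in>B1 \<union> B2. Const (if i \<in> B1 \<and> j \<in> B1 then u i j else 0) * R i j)"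
      using fin by (intro sum.mono_neutral_right) auto
    also have "\<dots> = (\<Sum>i\<in>B1. \<Sum>j\<in>B1. Const (u i j) * R1 i j)"
      using fin by (intro sum.cong[OF refl] sum.mono_neutral_cong_right) (auto simp: R12)
    finally show ?thesis using u by (intro exI[of _ "\<lambda>i j. if i \<in> B1 \<and> j \<in> B1 then u i j else 0"]) simp
  qed
  ultimately show ?case using 1(2) by blast
qed

text \<open>Finitely many generators of the coordinate ring are coefficients of one common
  representation, whose entries therefore generate everything.\<close>

lemma generating_rep_exists:
  assumes ft: "finite_type I"
  shows "\<exists>B R. rep G B R \<and> B \<noteq> {} \<and> (\<forall>p. \<exists>h. eqm I p (subst (\<lambda>(i, j). if i \<in> B \<and> j \<in> B then R i j else 0) h))"
proof -
  obtain n :: nat and g :: "nat \<Rightarrow> ('v, 'k) mpoly" where g: "\<And>p. \<exists>q. (\<forall>m\<in>Poly_Mapping.keys q. Poly_Mapping.keys m \<subseteq> {..<n}) \<and> p - subst g q \<in> I"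
    using ft unfolding finite_type_def by blast
  obtain B R where R: "rep G B R" "B \<noteq> {}" and u: "\<And>p. p \<in> g ` {..<n} \<Longrightarrow> \<exists>u. eqm I p (\<Sum>i\<in>B. \<Sum>j\<in>B. Const (u i j) * R i j)"
    using coefficients_rep_exists[of "g ` {..<n}"] by blast
  let ?F = "\<lambda>(i, j). if i \<in> B \<and> j \<in> B then R i j else 0"
  \<comment> \<open>Only the values of \<open>g\<close> below \<open>n\<close> are known to be
    coefficients; with 0 elsewhere every value of \<open>g'\<close> is expressible.\<close>
  define g' where "g' = (\<lambda>t. if t < n then g t else 0)"
  have "\<exists>h. eqm I (g' t) (subst ?F h)" for t
  proof (cases "t < n")
    case True
    then obtain u where u: "eqm I (g t) (\<Sum>i\<in>B. \<Sum>j\<in>B. Const (u i j) * R i j)" using u[of "g t"] by auto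
    have "subst ?F (\<Sum>i\<in>B. \<Sum>j\<in>B. Const (u i j) * Var (i, j)) = (\<Sum>i\<in>B. \<Sum>j\<in>B. Const (u i j) * R i j)"
      by (simp add: subst_simps)
    then show ?thesis using u True
      by (intro exI[of _ "\<Sum>i\<in>B. \<Sum>j\<in>B. Const (u i j) * Var (i, j)"]) (simp add: g'_def)
  next
    case False
    then show ?thesis by (intro exI[of _ 0]) (simp add: g'_def subst_simps eqm_refl[OF I_ideal])
  qed
  then have "\<forall>t. \<exists>h. eqm I (g' t) (subst ?F h)" by (intro allI)
  from choice[OF this] obtain h where h: "\<forall>t. eqm I (g' t) (subst ?F (h t))" by (elim exE)
  have "\<exists>h. eqm I p (subst ?F h)" for p
  proof -
    obtain q where q: "\<forall>m\<in>Poly_Mapping.keys q. Poly_Mapping.keys m \<subseteq> {..<n}" "p - subst g q \<in> I" using g by blast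
    have "subst g q = subst g' q"
      unfolding eval_mpoly_def using q(1) by (intro sum.cong refl arg_cong2[of _ _ _ _ "(*)"] prod.cong) (auto simp: g'_def)
    then have "eqm I p (subst g' q)" using q(2) by (simp add: eqm_def)
    also have "eqm I \<dots> (subst (\<lambda>t. subst ?F (h t)) q)" by (intro eqm_subst[OF I_ideal] h[rule_format])
    also (eqm_trans[OF I_ideal]) have "\<dots> = subst ?F (subst h q)" by (simp only: subst_subst)
    finally show ?thesis by blast
  qed
  then show ?thesis using R by blast
qed

end

subsection \<open>Triangular form\<close>

definition mm :: "nat set \<Rightarrow> (nat \<Rightarrow> nat \<Rightarrow> 'r::comm_ring_1) \<Rightarrow> (nat \<Rightarrow> nat \<Rightarrow> 'r) \<Rightarrow> nat \<Rightarrow> nat \<Rightarrow> 'r" where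
  "mm B A C = (\<lambda>i j. \<Sum>l\<in>B. A i l * C l j)"

definition inverse_on :: "nat set \<Rightarrow> (nat \<Rightarrow> nat \<Rightarrow> 'r::comm_ring_1) \<Rightarrow> (nat \<Rightarrow> nat \<Rightarrow> 'r) \<Rightarrow> bool" where
  "inverse_on B E F \<longleftrightarrow> (\<forall>i\<in>B. \<forall>j\<in>B. mm B E F i j = of_bool (i = j) \<and> mm B F E i j = of_bool (i = j))"

abbreviation cm :: "(nat \<Rightarrow> nat \<Rightarrow> 'k::field) \<Rightarrow> nat \<Rightarrow> nat \<Rightarrow> ('v, 'k) mpoly" where
  "cm E \<equiv> \<lambda>i j. Const (E i j)"

text \<open>In the convention of row vectors, the rows of \<open>E\<close> are the new
  basis.\<close>

definition similar :: "nat set \<Rightarrow> (nat \<Rightarrow> nat \<Rightarrow> ('v, 'k::field) mpoly) \<Rightarrow> (nat \<Rightarrow> nat \<Rightarrow> ('v, 'k) mpoly) \<Rightarrow> bool" where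
  "similar B R R' \<longleftrightarrow> (\<exists>E F. inverse_on B E F \<and> (\<forall>i\<in>B. \<forall>j\<in>B. R' i j = mm B (mm B (cm E) R) (cm F) i j))"

lemma mm_assoc: "mm B (mm B A C) D = mm B A (mm B C D)"
  unfolding mm_def by (intro ext) (simp add: sum_distrib_left sum_distrib_right mult.assoc, rule sum.swap)

lemma mm_cong:
  "(\<And>l. l \<in> B \<Longrightarrow> A i l = A' i l) \<Longrightarrow> (\<And>l. l \<in> B \<Longrightarrow> C l j = C' l j) \<Longrightarrow> mm B A C i j = mm B A' C' i j"
  unfolding mm_def by (intro sum.cong refl) simp

lemma mm_one:
  assumes "finite B"
  shows "i \<in> B \<Longrightarrow> (\<And>l. l \<in> B \<Longrightarrow> A i l = of_bool (i = l)) \<Longrightarrow> mm B A C i j = C i j"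
    and "j \<in> B \<Longrightarrow> (\<And>l. l \<in> B \<Longrightarrow> A l j = of_bool (l = j)) \<Longrightarrow> mm B C A i j = C i j"
  using assms by (simp_all add: mm_def sum_of_bool)

lemma mm_Const: "mm B (cm E) (cm F) = cm (mm B E F)"
  unfolding mm_def by (intro ext) (simp add: Const_sum Const_mult)

lemma inverse_on_sym: "inverse_on B E F \<Longrightarrow> inverse_on B F E"
  by (auto simp: inverse_on_def)

lemma inverse_on_mult:
  assumes B: "finite B" and "inverse_on B E F" "inverse_on B E' F'"
  shows "inverse_on B (mm B E' E) (mm B F F')"
  unfolding inverse_on_def
proof (intro ballI conjI)
  fix i j assume ij: "i \<in> B" "j \<in> B"
  have "mm B (mm B E' E) (mm B F F') i j = mm B E' (mm B (mm B E F) F') i j" by (simp only: mm_assoc)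
  also have "\<dots> = mm B E' F' i j"
    by (rule mm_cong[OF refl mm_one(1)[OF B]]) (use assms(2) in \<open>auto simp: inverse_on_def\<close>)
  finally show "mm B (mm B E' E) (mm B F F') i j = of_bool (i = j)" using assms(3) ij by (simp add: inverse_on_def)
  have "mm B (mm B F F') (mm B E' E) i j = mm B F (mm B (mm B F' E') E) i j" by (simp only: mm_assoc)
  also have "\<dots> = mm B F E i j"
    by (rule mm_cong[OF refl mm_one(1)[OF B]]) (use assms(3) in \<open>auto simp: inverse_on_def\<close>)
  finally show "mm B (mm B F F') (mm B E' E) i j = of_bool (i = j)" using assms(2) ij by (simp add: inverse_on_def)
qed

lemma similar_refl:
  assumes "finite B"
  shows "similar B R R"
proof -
  let ?E = "\<lambda>i j. of_bool (i = j)"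
  have "inverse_on B ?E ?E" using assms by (simp add: inverse_on_def mm_one)
  moreover have "R i j = mm B (mm B (cm ?E) R) (cm ?E) i j" if "i \<in> B" "j \<in> B" for i j
    using assms that by (simp add: mm_one)
  ultimately show ?thesis unfolding similar_def by blast
qed

lemma similar_trans:
  assumes B: "finite B" and "similar B R R'" "similar B R' R''"
  shows "similar B R R''"
proof -
  obtain E F where EF: "inverse_on B E F" "\<And>i j. i \<in> B \<Longrightarrow> j \<in> B \<Longrightarrow> R' i j = mm B (mm B (cm E) R) (cm F) i j"
    using assms(2) by (auto simp: similar_def)
  obtain E' F' where EF': "inverse_on B E' F'" "\<And>i j. i \<in> B \<Longrightarrow> j \<in> B \<Longrightarrow> R'' i j = mm B (mm B (cm E') R') (cm F') i j"
    using assms(3) by (auto simp: similar_def)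
  have "R'' i j = mm B (mm B (cm (mm B E' E)) R) (cm (mm B F F')) i j" if ij: "i \<in> B" "j \<in> B" for i j
  proof -
    have "R'' i j = mm B (mm B (cm E') (mm B (mm B (cm E) R) (cm F))) (cm F') i j"
      unfolding EF'(2)[OF ij] by (intro mm_cong refl EF(2) ij)
    then show ?thesis by (simp only: mm_assoc mm_Const[symmetric])
  qed
  then show ?thesis unfolding similar_def using inverse_on_mult[OF B EF(1) EF'(1)] by blast
qed

lemma similar_sym:
  assumes B: "finite B" and "similar B R R'"
  shows "similar B R' R"
proof -
  obtain E F where EF: "inverse_on B E F" "\<And>i j. i \<in> B \<Longrightarrow> j \<in> B \<Longrightarrow> R' i j = mm B (mm B (cm E) R) (cm F) i j"
    using assms(2) by (auto simp: similar_def)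
  have FE: "cm (mm B F E) i j = of_bool (i = j)" if "i \<in> B" "j \<in> B" for i j
    using EF(1) that by (simp add: inverse_on_def of_bool_def)
  have "R i j = mm B (mm B (cm F) R') (cm E) i j" if ij: "i \<in> B" "j \<in> B" for i j
  proof -
    have "mm B (mm B (cm F) R') (cm E) i j = mm B (mm B (cm F) (mm B (mm B (cm E) R) (cm F))) (cm E) i j"
      by (intro mm_cong refl EF(2) ij)
    also have "\<dots> = mm B (cm (mm B F E)) (mm B R (cm (mm B F E))) i j"
      by (simp only: mm_assoc mm_Const[symmetric])
    also have "\<dots> = mm B R (cm (mm B F E)) i j" by (rule mm_one(1)[OF B ij(1)]) (rule FE[OF ij(1)])
    also have "\<dots> = R i j" by (rule mm_one(2)[OF B ij(2)]) (rule FE[OF _ ij(2)])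
    finally show ?thesis ..
  qed
  then show ?thesis unfolding similar_def using inverse_on_sym[OF EF(1)] by blast
qed

lemma eqm_mm:
  "is_ideal K \<Longrightarrow> (\<And>l. l \<in> B \<Longrightarrow> eqm K (A i l) (A' i l)) \<Longrightarrow> (\<And>l. l \<in> B \<Longrightarrow> eqm K (C l j) (C' l j)) \<Longrightarrow>
    eqm K (mm B A C i j) (mm B A' C' i j)"
  unfolding mm_def by (intro eqm_sum eqm_mult) auto

text \<open>Block diagonal \<open>E\<close> and \<open>F\<close> change the basis inside
  \<open>D\<close> and inside \<open>B - D\<close> separately. The off-diagonal block is multiplied
  by constants from both sides and stays in every ideal that contains its entries.\<close>

lemma similar_blocks:
  assumes B: "finite B" and D: "D \<subseteq> B" and s1: "similar D R R1" and s2: "similar (B - D) R R2"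
  obtains R' where "similar B R R'" "\<And>i j. i \<in> D \<Longrightarrow> j \<in> D \<Longrightarrow> R' i j = R1 i j"
    "\<And>i j. i \<in> B - D \<Longrightarrow> j \<in> B - D \<Longrightarrow> R' i j = R2 i j"
    "\<And>K. is_ideal K \<Longrightarrow> (\<And>i j. i \<in> B - D \<Longrightarrow> j \<in> D \<Longrightarrow> R i j \<in> K) \<Longrightarrow> (\<And>i j. i \<in> B - D \<Longrightarrow> j \<in> D \<Longrightarrow> R' i j \<in> K)"
proof -
  obtain E1 F1 where 1: "inverse_on D E1 F1" "\<And>i j. i \<in> D \<Longrightarrow> j \<in> D \<Longrightarrow> R1 i j = mm D (mm D (cm E1) R) (cm F1) i j"
    using s1 by (auto simp: similar_def)
  obtain E2 F2 where 2: "inverse_on (B - D) E2 F2" "\<And>i j. i \<in> B - D \<Longrightarrow> j \<in> B - D \<Longrightarrow> R2 i j = mm (B - D) (mm (B - D) (cm E2) R) (cm F2) i j"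
    using s2 by (auto simp: similar_def)
  let ?diag = "\<lambda>X Y i j. if i \<in> D \<and> j \<in> D then X i j else if i \<in> B - D \<and> j \<in> B - D then Y i j else (0 :: 'b)"
  define E where "E = ?diag E1 E2"
  define F where "F = ?diag F1 F2"
  have fin: "finite D" "finite (B - D)" using B D finite_subset by auto
  have sumD: "(\<Sum>l\<in>B. f l) = (\<Sum>l\<in>D. f l)" if "\<And>l. l \<in> B - D \<Longrightarrow> f l = 0" for f :: "nat \<Rightarrow> 'c::comm_monoid_add"
    using B D that by (intro sum.mono_neutral_right) auto
  have sumB: "(\<Sum>l\<in>B. f l) = (\<Sum>l\<in>B - D. f l)" if "\<And>l. l \<in> D \<Longrightarrow> f l = 0" for f :: "nat \<Rightarrow> 'c::comm_monoid_add"
    using B D that by (intro sum.mono_neutral_right) auto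
  have left: "mm B (cm E) X i j = mm D (cm E1) X i j" if "i \<in> D" for X :: "nat \<Rightarrow> nat \<Rightarrow> ('a, 'b) mpoly" and i j
    unfolding mm_def using that by (subst sumD) (auto simp: E_def)
  have left2: "mm B (cm E) X i j = mm (B - D) (cm E2) X i j" if "i \<in> B - D" for X :: "nat \<Rightarrow> nat \<Rightarrow> ('a, 'b) mpoly" and i j
    unfolding mm_def using that by (subst sumB) (auto simp: E_def)
  have right: "mm B X (cm F) i j = mm D X (cm F1) i j" if "j \<in> D" for X :: "nat \<Rightarrow> nat \<Rightarrow> ('a, 'b) mpoly" and i j
    unfolding mm_def using that by (subst sumD) (auto simp: F_def)
  have right2: "mm B X (cm F) i j = mm (B - D) X (cm F2) i j" if "j \<in> B - D" for X :: "nat \<Rightarrow> nat \<Rightarrow> ('a, 'b) mpoly" and i j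
    unfolding mm_def using that by (subst sumB) (auto simp: F_def)
  have diag: "mm B (?diag X Y) (?diag X' Y') i j = ?diag (mm D X X') (mm (B - D) Y Y') i j"
    if "i \<in> B" "j \<in> B" for X Y X' Y' i j
  proof (cases "i \<in> D")
    case True
    then have "mm B (?diag X Y) (?diag X' Y') i j = (\<Sum>l\<in>D. ?diag X Y i l * ?diag X' Y' l j)"
      unfolding mm_def by (subst sumD) auto
    then show ?thesis using True D by (auto simp: mm_def)
  next
    case False
    then have "mm B (?diag X Y) (?diag X' Y') i j = (\<Sum>l\<in>B - D. ?diag X Y i l * ?diag X' Y' l j)"
      unfolding mm_def by (subst sumB) auto
    then show ?thesis using False that by (auto simp: mm_def)
  qed
  have inv: "inverse_on B E F"
    unfolding inverse_on_def
  proof (intro ballI)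
    fix i j assume ij: "i \<in> B" "j \<in> B"
    show "mm B E F i j = of_bool (i = j) \<and> mm B F E i j = of_bool (i = j)"
      using diag[OF ij, of E1 E2 F1 F2] diag[OF ij, of F1 F2 E1 E2] 1(1) 2(1) ij
      unfolding E_def[symmetric] F_def[symmetric] by (auto simp: inverse_on_def)
  qed
  let ?R = "mm B (mm B (cm E) R) (cm F)"
  show thesis
  proof (rule that)
    show "similar B R ?R" unfolding similar_def using inv by blast
    show "?R i j = R1 i j" if "i \<in> D" "j \<in> D" for i j
      unfolding right[OF that(2)] 1(2)[OF that] by (rule mm_cong, rule left[OF that(1)], rule refl)
    show "?R i j = R2 i j" if "i \<in> B - D" "j \<in> B - D" for i j
      unfolding right2[OF that(2)] 2(2)[OF that] by (rule mm_cong, rule left2[OF that(1)], rule refl)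
    fix K :: "('a, 'b) mpoly set" and i j
    assume K: "is_ideal K" and z: "\<And>i j. i \<in> B - D \<Longrightarrow> j \<in> D \<Longrightarrow> R i j \<in> K" and ij: "i \<in> B - D" "j \<in> D"
    have "?R i j = mm D (mm (B - D) (cm E2) R) (cm F1) i j"
      unfolding right[OF ij(2)] by (rule mm_cong, rule left2[OF ij(1)], rule refl)
    then show "?R i j \<in> K"
      unfolding mm_def by (simp only:) (rule ideal_sum[OF K], rule ideal_mult2[OF K], rule ideal_sum[OF K], rule ideal_mult[OF K], rule z)
  qed
qed

section \<open>Reduction of representations along invariant subspaces\<close>

context aff_group
begin

lemma rep_similar:
  assumes R: "rep G B R" and s: "similar B R R'"
  shows "rep G B R'"
proof -
  note B = rep_finite[OF R]
  obtain E F where EF: "inverse_on B E F" "\<And>i j. i \<in> B \<Longrightarrow> j \<in> B \<Longrightarrow> R' i j = mm B (mm B (cm E) R) (cm F) i j"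
    using s by (auto simp: similar_def)
  let ?K = "prod_scheme I I"
  have K: "is_ideal ?K" by simp
  have FE: "cm (mm B F E) i j = of_bool (i = j)" if "i \<in> B" "j \<in> B" for i j
    using EF(1) that by (simp add: inverse_on_def of_bool_def)
  have h: "subst h (mm B (mm B (cm E) X) (cm F) i j) = mm B (mm B (cm E) (\<lambda>i j. subst h (X i j))) (cm F) i j"
    for h :: "'v \<Rightarrow> ('t, 'k) mpoly" and X i j
    unfolding mm_def by (simp add: subst_simps)
  show ?thesis
    unfolding rep_def
  proof (intro conjI ballI B)
    fix i j assume ij: "i \<in> B" "j \<in> B"
    have "mm B (mm B (cm E) (\<lambda>i j. of_bool (i = j))) (cm F) i j = (mm B (cm E) (cm F) i j :: ('v, 'k) mpoly)"
      by (rule mm_cong[OF mm_one(2)[OF B] refl]) auto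
    also have "\<dots> = Const (of_bool (i = j))" using EF(1) ij by (simp add: mm_Const inverse_on_def)
    finally have e: "mm B (mm B (cm E) (\<lambda>i j. of_bool (i = j))) (cm F) i j = (Const (of_bool (i = j)) :: ('v, 'k) mpoly)" .
    have "counit (mm B (mm B (cm E) (\<lambda>i j. of_bool (i = j))) (cm F) i j) = of_bool (i = j)"
      unfolding e counit_simps ..
    moreover have "counit (mm B (mm B (cm E) R) (cm F) i j) = counit (mm B (mm B (cm E) (\<lambda>i j. of_bool (i = j))) (cm F) i j)"
      unfolding mm_def counit_simps
      by (intro sum.cong refl arg_cong2[of _ _ _ _ "(*)"]) (simp add: rep_counit[OF R] of_bool_def counit_simps)
    ultimately show "counit (R' i j) = of_bool (i = j)" by (simp add: EF(2)[OF ij])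
    let ?X = "\<lambda>i j. subst pr1 (R i j)" and ?Y = "\<lambda>i j. subst pr2 (R i j)"
    have "eqm ?K (comult (R' i j)) (mm B (mm B (cm E) (mm B ?X ?Y)) (cm F) i j)"
      unfolding EF(2)[OF ij] h
      by (intro eqm_mm[OF K] eqm_refl[OF K]) (use rep_comult[OF R] in \<open>simp add: mm_def[of B ?X]\<close>)
    also have "mm B (mm B (cm E) (mm B ?X ?Y)) (cm F) i j = mm B (mm B (mm B (cm E) ?X) (cm F)) (mm B (mm B (cm E) ?Y) (cm F)) i j"
    proof -
      have "mm B (mm B (mm B (cm E) ?X) (cm F)) (mm B (mm B (cm E) ?Y) (cm F)) i j =
        mm B (cm E) (mm B ?X (mm B (cm (mm B F E)) (mm B ?Y (cm F)))) i j"
        by (simp only: mm_assoc mm_Const[symmetric])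
      also have "\<dots> = mm B (cm E) (mm B ?X (mm B ?Y (cm F))) i j"
        by (intro mm_cong[OF refl] mm_one(1)[OF B] FE)
      finally show ?thesis by (simp only: mm_assoc)
    qed
    also have "\<dots> = mm B (\<lambda>i j. subst pr1 (R' i j)) (\<lambda>i j. subst pr2 (R' i j)) i j"
      by (rule mm_cong) (simp_all add: EF(2) ij h)
    finally show "eqm ?K (comult (R' i j)) (\<Sum>l\<in>B. subst pr1 (R' i l) * subst pr2 (R' l j))"
      by (simp add: mm_def)
  qed
qed

text \<open>Subrepresentations and quotients are covered alike: in both cases one factor of each
  term with \<open>l\<close> outside \<open>D\<close> vanishes on \<open>G\<close>.\<close>

lemma rep_block:
  assumes R: "rep G B R" and D: "D \<subseteq> B" and z: "\<And>i j l. i \<in> D \<Longrightarrow> j \<in> D \<Longrightarrow> l \<in> B - D \<Longrightarrow> R i l \<in> I \<or> R l j \<in> I"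
  shows "rep G D R"
  unfolding rep_def
proof (intro conjI ballI)
  note B = rep_finite[OF R]
  show "finite D" using B D finite_subset by blast
  let ?K = "prod_scheme I I"
  have K: "is_ideal ?K" by simp
  fix i j assume ij: "i \<in> D" "j \<in> D"
  then have ij': "i \<in> B" "j \<in> B" using D by auto
  show "counit (R i j) = of_bool (i = j)" by (rule rep_counit[OF R ij'])
  let ?S = "\<lambda>A. \<Sum>l\<in>A. subst pr1 (R i l) * subst pr2 (R l j)"
  have "?S (B - D) \<in> ?K"
  proof (rule ideal_sum[OF K])
    fix l assume "l \<in> B - D"
    then have "R i l \<in> I \<or> R l j \<in> I" by (rule z[OF ij])
    then show "subst pr1 (R i l) * subst pr2 (R l j) \<in> ?K"
      by (auto intro: ideal_mult2[OF K] ideal_mult[OF K] prod_scheme_pr1 prod_scheme_pr2)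
  qed
  moreover have "?S B = ?S (B - D) + ?S D" by (rule sum.subset_diff[OF D B])
  ultimately have "eqm ?K (?S B) (?S D)" by (simp add: eqm_def)
  then show "eqm ?K (comult (R i j)) (?S D)"
    by (rule eqm_trans[OF K rep_comult[OF R ij']])
qed

text \<open>
  Choose \<open>D \<subseteq> B\<close> maximal such that the coordinate subspace \<open>k\<^sup>D\<close> meets the invariant subspace \<open>Y\<close>
  trivially. For \<open>i \<notin> D\<close> there is a vector of \<open>Y\<close> of the form \<open>e\<^sub>i + \<Sum>\<^sub>d\<^sub>\<in>\<^sub>D t\<^sub>i\<^sub>d e\<^sub>d\<close>; replacing \<open>e\<^sub>i\<close>
  by it is a base change \<open>1 + T\<close> with \<open>T\<^sup>2 = 0\<close>.
\<close>

lemma block_triangular_form: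
  assumes R: "rep G B R" and red: "\<not> irreducible_rep G B R"
  obtains D R' where "D \<subset> B" "D \<noteq> {}" "similar B R R'" "\<And>i j. i \<in> B - D \<Longrightarrow> j \<in> D \<Longrightarrow> R' i j \<in> I"
proof -
  note B = rep_finite[OF R]
  obtain Y where Y: "vec_subspace B Y" and st: "stable G B R Y" and ne: "Y \<noteq> {\<lambda>i. 0}" "Y \<noteq> vecs B"
    using red R by (auto simp: irreducible_rep_def)
  note YD = vec_subspaceD[OF Y]
  let ?P = "\<lambda>D. D \<subseteq> B \<and> (\<forall>y\<in>Y. (\<forall>i. i \<notin> D \<longrightarrow> y i = 0) \<longrightarrow> y = (\<lambda>i. 0))"
  have "?P {}" by auto
  moreover have "\<forall>D. ?P D \<longrightarrow> card D < Suc (card B)" using card_mono[OF B] by (simp add: le_imp_less_Suc)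
  ultimately obtain D where D: "?P D" and max: "\<And>D'. ?P D' \<Longrightarrow> card D' \<le> card D"
    using ex_has_greatest_nat[of ?P "{}" card "Suc (card B)"] by blast
  have DB: "D \<subseteq> B" and D0: "\<And>y. y \<in> Y \<Longrightarrow> (\<And>i. i \<notin> D \<Longrightarrow> y i = 0) \<Longrightarrow> y = (\<lambda>i. 0)" using D by auto
  have finD: "finite D" using finite_subset[OF DB B] .
  have "D \<noteq> B"
  proof
    assume "D = B"
    have "y = (\<lambda>i. 0)" if "y \<in> Y" for y using D0[OF that] YD(1) that \<open>D = B\<close> by (auto simp: vecs_def)
    then show False using ne(1) YD(2) by blast
  qed
  have "\<exists>z\<in>Y. z i = 1 \<and> (\<forall>l. l \<notin> insert i D \<longrightarrow> z l = 0)" if i: "i \<in> B - D" for i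
  proof -
    have "\<not> ?P (insert i D)" using max[of "insert i D"] i finD by auto
    then obtain y where y: "y \<in> Y" "\<And>l. l \<notin> insert i D \<Longrightarrow> y l = 0" "y \<noteq> (\<lambda>i. 0)" using DB i by auto
    have "y i \<noteq> 0"
    proof
      assume "y i = 0"
      then have "y l = 0" if "l \<notin> D" for l using y(2)[of l] that by (cases "l = i") auto
      then show False using D0[OF y(1)] y(3) by blast
    qed
    then show ?thesis using YD(4)[OF y(1), of "inverse (y i)"] y(2)
      by (intro bexI[of _ "\<lambda>l. inverse (y i) * y l"]) auto
  qed
  then obtain z where z: "\<And>i. i \<in> B - D \<Longrightarrow> z i \<in> Y" "\<And>i. i \<in> B - D \<Longrightarrow> z i i = 1"
    "\<And>i l. i \<in> B - D \<Longrightarrow> l \<notin> insert i D \<Longrightarrow> z i l = 0" by metis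
  have Ysum: "(\<lambda>l. \<Sum>i\<in>S. c i * z i l) \<in> Y" if "finite S" "S \<subseteq> B - D" for S c
    using that by (induction S) (auto intro!: YD(3,4) z(1) simp: YD(2))
  \<comment> \<open>Both sides agree off \<open>D\<close>, so their difference is a vector of
    \<open>Y\<close> supported on \<open>D\<close>, hence zero.\<close>
  have expand: "y l = (\<Sum>i\<in>B - D. y i * z i l)" if y: "y \<in> Y" for y l
  proof -
    have "(\<lambda>l. y l - (\<Sum>i\<in>B - D. y i * z i l)) = (\<lambda>l. 0)"
    proof (rule D0)
      show "(\<lambda>l. y l - (\<Sum>i\<in>B - D. y i * z i l)) \<in> Y" using B by (intro YD(5) y Ysum) auto
      fix l assume l: "l \<notin> D"
      show "y l - (\<Sum>i\<in>B - D. y i * z i l) = 0"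
      proof (cases "l \<in> B")
        case True
        have "(\<Sum>i\<in>B - D. y i * z i l) = (\<Sum>i\<in>B - D. y i * of_bool (i = l))"
          using z(2,3) l by (intro sum.cong refl) auto
        then show ?thesis using True l B by (simp add: sum_of_bool)
      next
        case False
        have "(\<Sum>i\<in>B - D. y i * z i l) = 0"
        proof (intro sum.neutral ballI)
          fix i assume i: "i \<in> B - D"
          then have "l \<notin> insert i D" using False l by auto
          then show "y i * z i l = 0" using z(3)[OF i] by simp
        qed
        then show ?thesis using False y YD(1) by (auto simp: vecs_def)
      qed
    qed
    from fun_cong[OF this, of l] show ?thesis by (rule eq_iff_diff_eq_0[THEN iffD2])
  qed
  \<comment> \<open>For empty \<open>D\<close> the vectors \<open>z i\<close> would be the standard
    basis and \<open>Y\<close> the whole space.\<close>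
  have "D \<noteq> {}"
  proof
    assume De: "D = {}"
    have "y \<in> Y" if y: "y \<in> vecs B" for y
    proof -
      have "(\<lambda>l. \<Sum>i\<in>B. y i * z i l) = y"
      proof
        fix l
        have "(\<Sum>i\<in>B. y i * z i l) = (\<Sum>i\<in>B. y i * of_bool (i = l))"
          using z(2,3) De by (intro sum.cong refl) auto
        also have "\<dots> = y l" using y B by (cases "l \<in> B") (auto simp: sum_of_bool vecs_def intro!: sum.neutral)
        finally show "(\<Sum>i\<in>B. y i * z i l) = y l" .
      qed
      then show ?thesis using Ysum[OF B, of y] De by simp
    qed
    then show False using ne(2) YD(1) by blast
  qed
  define T where "T = (\<lambda>i j. if i \<in> B - D \<and> j \<in> D then z i j else 0)"
  define E where "E = (\<lambda>i j. of_bool (i = j) + T i j)"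
  define F where "F = (\<lambda>i j. of_bool (i = j) - T i j)"
  have TT: "(\<Sum>l\<in>B. T i l * T l j) = 0" for i j by (intro sum.neutral) (auto simp: T_def)
  have inv: "inverse_on B E F"
    unfolding inverse_on_def
  proof (intro ballI conjI)
    fix i j assume ij: "i \<in> B" "j \<in> B"
    have "mm B E F i j = (\<Sum>l\<in>B. of_bool (i = l) * F l j) + ((\<Sum>l\<in>B. T i l * of_bool (l = j)) - (\<Sum>l\<in>B. T i l * T l j))"
      by (simp only: mm_def E_def distrib_right sum.distrib F_def right_diff_distrib sum_subtractf) (simp only: algebra_simps)
    then show "mm B E F i j = of_bool (i = j)" by (simp add: sum_of_bool[OF B ij(1)] sum_of_bool[OF B ij(2)] TT F_def)
    have "mm B F E i j = (\<Sum>l\<in>B. of_bool (i = l) * E l j) - ((\<Sum>l\<in>B. T i l * of_bool (l = j)) + (\<Sum>l\<in>B. T i l * T l j))"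
      by (simp only: mm_def F_def left_diff_distrib sum_subtractf E_def distrib_left sum.distrib) (simp only: algebra_simps)
    then show "mm B F E i j = of_bool (i = j)" by (simp add: sum_of_bool[OF B ij(1)] sum_of_bool[OF B ij(2)] TT E_def)
  qed
  have Ez: "E i l = z i l" if "i \<in> B - D" "l \<in> B" for i l
    using that z(2,3) by (auto simp: E_def T_def)
  let ?R = "mm B (mm B (cm E) R) (cm F)"
  \<comment> \<open>Row \<open>i\<close> of \<open>E\<close> is \<open>z i\<close>, so \<alpha>
    sends row \<open>i\<close> of \<open>E R\<close> to a vector \<open>y\<close> of
    \<open>Y\<close>. Multiplication by \<open>F\<close> subtracts from \<open>y j\<close> the value
    determined by the coordinates of \<open>y\<close> off \<open>D\<close>, which by
    \<open>expand\<close> is \<open>y j\<close> itself.\<close>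
  have "?R i j \<in> I" if i: "i \<in> B - D" and j: "j \<in> D" for i j
  proof (rule ccontr)
    assume "?R i j \<notin> I"
    then obtain \<alpha> where \<alpha>: "lin \<alpha>" "\<And>p. p \<in> I \<Longrightarrow> \<alpha> p = 0" "\<alpha> (?R i j) = 1"
      using separating_functional[OF ideal_subspace[OF I_ideal]] by blast
    define y where "y = act B (z i) (\<lambda>i j. \<alpha> (R i j))"
    have yY: "y \<in> Y" using st z(1)[OF i] \<alpha> by (auto simp: y_def stable_def functionals_def)
    have "\<alpha> (?R i j) = (\<Sum>b\<in>B. y b * F b j)"
      unfolding mm_def using i
      by (simp add: lin_sum[OF \<alpha>(1)] lin_scale[OF \<alpha>(1)] lin_scale2[OF \<alpha>(1)] y_def act_def Ez mult.commute)
    also have "\<dots> = y j - (\<Sum>b\<in>B. y b * T b j)"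
      using j DB sum_of_bool(1)[OF B, of j y] by (simp add: F_def right_diff_distrib sum_subtractf subset_iff)
    also have "(\<Sum>b\<in>B. y b * T b j) = (\<Sum>b\<in>B - D. y b * z b j)"
      using B j by (intro sum.mono_neutral_cong_right) (auto simp: T_def)
    also have "\<dots> = y j" using expand[OF yY, of j] by simp
    finally show False using \<alpha>(3) by simp
  qed
  moreover have "similar B R ?R" unfolding similar_def using inv by blast
  ultimately show thesis using that \<open>D \<noteq> {}\<close> \<open>D \<noteq> B\<close> DB by blast
qed

text \<open>The function \<open>h\<close> records an order of the basis. Indices in \<open>D\<close>
  are placed first, so the zero block, with rows outside \<open>D\<close> and columns in
  \<open>D\<close>, lies below the diagonal. The recursion ends at irreducible blocks, which are
  identity matrices modulo \<open>Q\<close>.\<close>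

lemma triangular_form:
  "rep G B R \<Longrightarrow> \<exists>R' h. similar B R R' \<and> inj_on h B \<and>
     (\<forall>i\<in>B. \<forall>j\<in>B. (h j :: nat) \<le> h i \<longrightarrow> eqm Q (R' i j) (of_bool (i = j)))"
proof (induction "card B" arbitrary: B R rule: less_induct)
  case less
  note R = less.prems
  note B = rep_finite[OF R]
  show ?case
  proof (cases "irreducible_rep G B R")
    case True
    then show ?thesis using irreducible_mem_Q similar_refl[OF B]
      by (intro exI[of _ R] exI[of _ id]) auto
  next
    case False
    obtain D S where D: "D \<subset> B" "D \<noteq> {}" and s: "similar B R S" and SI: "\<And>i j. i \<in> B - D \<Longrightarrow> j \<in> D \<Longrightarrow> S i j \<in> I"
      using block_triangular_form[OF R False] by blast
    note S = rep_similar[OF R s]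
    have "rep G D S" "rep G (B - D) S"
      using rep_block[OF S, of D] rep_block[OF S, of "B - D"] D(1) SI by auto
    moreover have "card D < card B" "card (B - D) < card B"
      using D B by (auto intro!: psubset_card_mono)
    ultimately obtain R1 h1 R2 h2 where 1: "similar D S R1" "inj_on h1 D"
        "\<And>i j. i \<in> D \<Longrightarrow> j \<in> D \<Longrightarrow> (h1 j :: nat) \<le> h1 i \<Longrightarrow> eqm Q (R1 i j) (of_bool (i = j))"
      and 2: "similar (B - D) S R2" "inj_on h2 (B - D)"
        "\<And>i j. i \<in> B - D \<Longrightarrow> j \<in> B - D \<Longrightarrow> (h2 j :: nat) \<le> h2 i \<Longrightarrow> eqm Q (R2 i j) (of_bool (i = j))"
      using less.hyps[of D S] less.hyps[of "B - D" S] by blast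
    have DB: "D \<subseteq> B" using D(1) by blast
    obtain R' where R': "similar B S R'" "\<And>i j. i \<in> D \<Longrightarrow> j \<in> D \<Longrightarrow> R' i j = R1 i j"
      "\<And>i j. i \<in> B - D \<Longrightarrow> j \<in> B - D \<Longrightarrow> R' i j = R2 i j"
      "\<And>i j. i \<in> B - D \<Longrightarrow> j \<in> D \<Longrightarrow> R' i j \<in> I"
      using similar_blocks[OF B DB 1(1) 2(1)] SI I_ideal by metis
    obtain M where M: "\<And>i. i \<in> D \<Longrightarrow> h1 i < M"
      using finite_nat_bounded[of "h1 ` D"] finite_subset[OF DB B] by (auto simp: subset_iff)
    define h where "h = (\<lambda>i. if i \<in> D then h1 i else M + h2 i)"
    have "inj_on h B"
    proof (rule inj_onI)
      fix i j assume ij: "i \<in> B" "j \<in> B" "h i = h j"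
      then show "i = j" using inj_onD[OF 1(2), of i j] inj_onD[OF 2(2), of i j] M[of i] M[of j]
        by (auto simp: h_def split: if_splits)
    qed
    moreover have "eqm Q (R' i j) (of_bool (i = j))" if "i \<in> B" "j \<in> B" "h j \<le> h i" for i j
    proof (cases "i \<in> D"; cases "j \<in> D")
      assume "i \<in> D" "j \<in> D"
      then show ?thesis using 1(3) R'(2) that by (simp add: h_def)
    next
      assume "i \<notin> D" "j \<notin> D"
      then show ?thesis using 2(3) R'(3) that by (simp add: h_def)
    next
      assume "i \<notin> D" "j \<in> D"
      then show ?thesis using R'(4)[of i j] that I_subset_Q by (auto simp: eqm_def)
    next
      assume "i \<in> D" "j \<notin> D"
      then show ?thesis using M[of i] that by (simp add: h_def)
    qed
    ultimately show ?thesis using similar_trans[OF B s R'(1)] by blast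
  qed
qed

end

subsection \<open>Unitriangular embeddings\<close>

lemma mat_mult_apply: "mat_mult n A B (i, j) = (\<Sum>l<n. A (i, l) * B (l, j))"
  by (simp add: mat_mult_def)

lemma subst_mat_mult: "subst h (mat_mult n A B u) = mat_mult n (\<lambda>u. subst h (A u)) (\<lambda>u. subst h (B u)) u"
  by (cases u) (simp add: mat_mult_apply subst_simps)

lemma subst_mat_id: "subst h (mat_id n u) = mat_id n u"
  by (cases u) (simp add: mat_id_def subst_simps)

lemma subst_mat_power:
  "subst h ((mat_mult n A ^^ l) (mat_id n) u) = (mat_mult n (\<lambda>u. subst h (A u)) ^^ l) (mat_id n) u"
  by (induction l arbitrary: u) (simp_all add: subst_mat_id subst_mat_mult)

lemma mat_mult_assoc: "mat_mult n (mat_mult n A B) C = mat_mult n A (mat_mult n B C)"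
proof
  fix u
  show "mat_mult n (mat_mult n A B) C u = mat_mult n A (mat_mult n B C) u"
    by (cases u) (simp add: mat_mult_apply sum_distrib_left sum_distrib_right mult.assoc, rule sum.swap)
qed

lemma mat_mult_id: "i < n \<Longrightarrow> mat_mult n (mat_id n) A (i, j) = A (i, j)" "j < n \<Longrightarrow> mat_mult n A (mat_id n) (i, j) = A (i, j)"
proof -
  have e: "mat_id n (i, l) = of_bool (i = l)" if "i < n" for i l using that by (simp add: mat_id_def)
  have e2: "mat_id n (l, j) = of_bool (l = j)" if "j < n" for j l using that by (simp add: mat_id_def)
  show "i < n \<Longrightarrow> mat_mult n (mat_id n) A (i, j) = A (i, j)" "j < n \<Longrightarrow> mat_mult n A (mat_id n) (i, j) = A (i, j)"
    unfolding mat_mult_apply by (simp_all only: e e2 sum_of_bool[OF finite_lessThan lessThan_iff[THEN iffD2]])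
qed

lemma eqm_mat_mult:
  "is_ideal K \<Longrightarrow> (\<And>l. l < n \<Longrightarrow> eqm K (A (i, l)) (A' (i, l))) \<Longrightarrow> (\<And>l. l < n \<Longrightarrow> eqm K (B (l, j)) (B' (l, j))) \<Longrightarrow>
    eqm K (mat_mult n A B (i, j)) (mat_mult n A' B' (i, j))"
  unfolding mat_mult_apply by (intro eqm_sum eqm_mult) auto

text \<open>The sum below is the geometric series inverting \<open>1 - A\<close>.\<close>

lemma unitriangular_inverse:
  assumes J: "is_ideal J"
    and A: "\<And>i j. i \<ge> n \<or> j \<ge> n \<or> j \<le> i \<Longrightarrow> A (i, j) \<in> J"
    and S: "\<And>i j. i < n \<Longrightarrow> j < n \<Longrightarrow> eqm J (mat_mult n S (\<lambda>u. mat_id n u - A u) (i, j)) (mat_id n (i, j))"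
    and S0: "\<And>i j. i \<ge> n \<or> j \<ge> n \<Longrightarrow> S (i, j) \<in> J"
  shows "eqm J (\<Sum>l<n. (mat_mult n A ^^ l) (mat_id n) (i, j)) (S (i, j))"
proof -
  define P where "P = (\<lambda>l. (mat_mult n A ^^ l) (mat_id n))"
  have P0: "P 0 = mat_id n" and PS: "\<And>l. P (Suc l) = mat_mult n A (P l)" by (simp_all add: P_def)
  \<comment> \<open>Modulo \<open>J\<close> the matrix \<open>A\<close> is strictly upper
    triangular, so its power \<open>l\<close> starts \<open>l\<close> places above the diagonal and
    the power \<open>n\<close> vanishes.\<close>
  have Pz: "P l (i, j) \<in> J" if "i \<ge> n \<or> j \<ge> n \<or> j < i + l" for l i j
    using that
  proof (induction l arbitrary: i j)
    case 0
    then show ?case using ideal_0[OF J] by (auto simp: P0 mat_id_def)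
  next
    case (Suc l)
    have "A (i, m) * P l (m, j) \<in> J" for m
    proof (cases "A (i, m) \<in> J")
      case True
      then show ?thesis by (rule ideal_mult2[OF J])
    next
      case False
      then have "i < n" "i < m" using A[of i m] by (meson not_le)+
      then have "P l (m, j) \<in> J" using Suc by (intro Suc.IH) auto
      then show ?thesis by (rule ideal_mult[OF J])
    qed
    then show ?case unfolding PS mat_mult_apply by (intro ideal_sum[OF J])
  qed
  define X where "X = (\<lambda>u. \<Sum>l<n. P l u)"
  have X: "eqm J (mat_mult n (\<lambda>u. mat_id n u - A u) X (i, j)) (mat_id n (i, j))" if "i < n" for i j
  proof -
    have "mat_mult n (\<lambda>u. mat_id n u - A u) X (i, j) = mat_mult n (mat_id n) X (i, j) - mat_mult n A X (i, j)"
      by (simp add: mat_mult_apply left_diff_distrib sum_subtractf)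
    also have "mat_mult n A X (i, j) = (\<Sum>l<n. P (Suc l) (i, j))"
      unfolding mat_mult_apply X_def PS sum_distrib_left by (rule sum.swap)
    also have "mat_mult n (mat_id n) X (i, j) = (\<Sum>l<n. P l (i, j))"
      by (simp add: mat_mult_id(1)[OF that] X_def)
    also have "(\<Sum>l<n. P l (i, j)) - (\<Sum>l<n. P (Suc l) (i, j)) = mat_id n (i, j) - P n (i, j)"
      unfolding sum_subtractf[symmetric] P0[symmetric] by (rule sum_lessThan_telescope')
    finally have "mat_mult n (\<lambda>u. mat_id n u - A u) X (i, j) - mat_id n (i, j) = - P n (i, j)" by simp
    moreover have "P n (i, j) \<in> J" by (rule Pz) linarith
    ultimately show ?thesis using ideal_uminus[OF J] by (simp only: eqm_def)
  qed
  show ?thesis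
  proof (cases "i < n \<and> j < n")
    case True
    \<comment> \<open>\<open>S\<close> is a left inverse and \<open>X\<close> a right inverse of
      \<open>1 - A\<close>; associativity identifies them.\<close>
    have "eqm J (S (i, j)) (mat_mult n S (mat_mult n (\<lambda>u. mat_id n u - A u) X) (i, j))"
    proof -
      have "eqm J (mat_mult n S (mat_mult n (\<lambda>u. mat_id n u - A u) X) (i, j)) (mat_mult n S (mat_id n) (i, j))"
        by (rule eqm_mat_mult[OF J eqm_refl[OF J]]) (rule X)
      then show ?thesis using True eqm_sym[OF J] by (simp add: mat_mult_id)
    qed
    also have "mat_mult n S (mat_mult n (\<lambda>u. mat_id n u - A u) X) (i, j) = mat_mult n (mat_mult n S (\<lambda>u. mat_id n u - A u)) X (i, j)"
      by (simp only: mat_mult_assoc)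
    also have "eqm J \<dots> (mat_mult n (mat_id n) X (i, j))"
      by (rule eqm_mat_mult[OF J _ eqm_refl[OF J]]) (use True in \<open>auto intro: S\<close>)
    also (eqm_trans[OF J]) have "mat_mult n (mat_id n) X (i, j) = X (i, j)" using True by (simp add: mat_mult_id)
    finally show ?thesis using eqm_sym[OF J] by (simp add: X_def P_def)
  next
    case False
    then have "P l (i, j) \<in> J" for l using Pz by auto
    then have "X (i, j) \<in> J" unfolding X_def by (intro ideal_sum[OF J])
    then show ?thesis using S0[of i j] False ideal_diff[OF J] by (auto simp: X_def P_def eqm_def)
  qed
qed

context aff_group
begin

text \<open>The kernel \<open>L\<close> of substitution by \<open>f\<close> is the ideal of the
  image of \<open>J\<close> in the unitriangular group. The polynomials \<open>g\<close> recovering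
  the variables give the inverse isomorphism, and the subgroup axioms for \<open>L\<close> are
  pulled back to those of \<open>J\<close>.\<close>

lemma unipotentI:
  assumes J: "closed_subgroup G J" and f: "unitriangular_rep G J n f" and n: "n \<ge> 1"
    and fu: "\<And>u. counit (f u) = mat_id n u"
  shows "unipotent (subgroup_group G J)"
proof -
  let ?U = "unitriangular n :: (nat \<times> nat, 'k) group_data"
  note J_ideal = closed_subgroupD(1)[OF J] and IJ = closed_subgroupD(2)[OF J] and J_comult = closed_subgroupD(3)[OF J]
  have J_inv: "morphism J J (ginv G)" using J by (simp add: closed_subgroup_def)
  have f0: "f (i, j) \<in> J" if "i \<ge> n \<or> j \<ge> n \<or> j < i" for i j using f that unfolding unitriangular_rep_def by blast
  have f1: "eqm J (f (i, i)) 1" if "i < n" for i using f that unfolding unitriangular_rep_def by blast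
  have f2: "eqm (prod_scheme J J) (comult (f (i, j))) (\<Sum>l<n. subst pr1 (f (i, l)) * subst pr2 (f (l, j)))" for i j
    using f unfolding unitriangular_rep_def by blast
  have "\<forall>v. \<exists>q. eqm J (Var v) (subst f q)" using f unfolding unitriangular_rep_def by blast
  from choice[OF this] obtain g where g': "\<forall>v. eqm J (Var v) (subst f (g v))" by (elim exE)
  have g: "eqm J (subst f (g v)) (Var v)" for v by (rule eqm_sym[OF J_ideal g'[rule_format]])
  define L where "L = {p. subst f p \<in> J}"
  have L_ideal: "is_ideal L" unfolding L_def by (rule is_ideal_vimage[OF rhom_eval_mpoly[OF rhom_Const] J_ideal])
  have fL: "morphism J L f" by (simp add: morphism_def L_def)
  have L_eqm: "eqm L p q \<longleftrightarrow> eqm J (subst f p) (subst f q)" for p q by (simp add: L_def eqm_def subst_simps)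
  let ?gens = "{Var (i, j) | i j. i \<ge> n \<or> j \<ge> n} \<union> {Var (i, j) | i j. j < i \<and> i < n} \<union> {Var (i, i) - 1 | i. i < n} :: (nat \<times> nat, 'k) mpoly set"
  have U_ideal: "defideal ?U = ideal_gen ?gens" by (simp add: unitriangular_def)
  have U_mult: "gmult ?U = mat_mult n pr1 pr2" by (simp add: unitriangular_def)
  have U_unit: "gunit ?U = mat_id n" by (simp add: unitriangular_def)
  have U_inv: "ginv ?U = (\<lambda>ij. \<Sum>l<n. (mat_mult n (\<lambda>ij. mat_id n ij - Var ij) ^^ l) (mat_id n) ij)" by (simp add: unitriangular_def)
  have "?gens \<subseteq> L"
    using f0 f1 by (auto simp: L_def subst_simps eqm_def)
  then have UL: "defideal ?U \<subseteq> L" unfolding U_ideal by (rule ideal_gen_least[OF L_ideal])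
  have fg: "eqm J (subst f (subst g p)) p" for p
    using eqm_subst[OF J_ideal, where f = "\<lambda>v. subst f (g v)" and g = Var and p = p] g by (simp add: subst_subst)
  have gJ: "morphism L J g"
    using eqm_mem[OF J_ideal fg] by (simp add: morphism_def L_def)
  have gf: "eqm L (subst g (f u)) (Var u)" for u
    unfolding L_eqm using fg[of "f u"] by (simp add: subst_simps)
  let ?K = "prod_scheme J J" and ?KL = "prod_scheme L L"
  have K: "is_ideal ?K" and KL: "is_ideal ?KL" by simp_all
  let ?f2 = "case_sum (\<lambda>u. subst pr1 (f u)) (\<lambda>u. subst pr2 (f u))"
  let ?g2 = "case_sum (\<lambda>u. subst pr1 (g u)) (\<lambda>u. subst pr2 (g u))"
  have comp1: "morphism ?KL J (\<lambda>v. subst pr1 (g v))" "morphism ?KL J (\<lambda>v. subst pr2 (g v))"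
    using gJ by (auto simp: morphism_def prod_scheme_pr1 prod_scheme_pr2 simp flip: subst_subst)
  \<comment> \<open>\<open>?g2\<close> inverts \<open>?f2\<close> modulo the ideals, so membership
    in the product ideal of \<open>L\<close> can be tested after pulling back to
    \<open>J\<close>.\<close>
  have reflect: "P \<in> ?KL" if "subst ?f2 P \<in> ?K" for P
  proof -
    have "subst ?g2 (subst ?f2 P) \<in> ?KL"
      using morphism_case_sum[OF KL comp1] that by (simp add: morphism_def)
    moreover have "eqm ?KL (subst ?g2 (subst ?f2 P)) (subst Var P)"
      unfolding subst_subst
    proof (rule eqm_subst[OF KL])
      fix u
      show "eqm ?KL (subst ?g2 (?f2 u)) (Var u)"
      proof (cases u)
        case (Inl w)
        have "subst ?g2 (?f2 u) = subst pr1 (subst g (f w))" by (simp add: Inl subst_subst subst_simps)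
        then show ?thesis using subst_eqm_morphism[OF morphism_pr1 gf, of L w] by (simp add: Inl subst_simps)
      next
        case (Inr w)
        have "subst ?g2 (?f2 u) = subst pr2 (subst g (f w))" by (simp add: Inr subst_subst subst_simps)
        then show ?thesis using subst_eqm_morphism[OF morphism_pr2 gf, of L w] by (simp add: Inr subst_simps)
      qed
    qed
    ultimately show ?thesis using eqm_mem[OF KL] by simp
  qed
  have f2_mult: "eqm ?K (subst ?f2 (subst (gmult ?U) p)) (comult (subst f p))" for p
    unfolding subst_subst U_mult
  proof (rule eqm_subst[OF K])
    fix u :: "nat \<times> nat"
    obtain i j where u: "u = (i, j)" by (cases u)
    have "subst ?f2 (mat_mult n pr1 pr2 u) = (\<Sum>l<n. subst pr1 (f (i, l)) * subst pr2 (f (l, j)))"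
      by (simp add: u mat_mult_apply subst_simps)
    then show "eqm ?K (subst ?f2 (mat_mult n pr1 pr2 u)) (comult (f u))"
      using eqm_sym[OF K f2] by (simp add: u)
  qed
  have L1: "morphism ?KL L (gmult ?U)"
    unfolding morphism_def
  proof (intro ballI reflect)
    fix p assume "p \<in> L"
    then have "comult (subst f p) \<in> ?K" using J_comult by (simp add: L_def morphism_def)
    then show "subst ?f2 (subst (gmult ?U) p) \<in> ?K" using eqm_mem[OF K f2_mult] by simp
  qed
  have L2: "\<forall>p\<in>L. eval_mpoly id (gunit ?U) p = 0"
  proof
    fix p assume "p \<in> L"
    then have "counit (subst f p) = 0" using closed_subgroupD(4)[OF J] by (simp add: L_def)
    then show "eval_mpoly id (gunit ?U) p = 0" unfolding eval_subst fu U_unit .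
  qed
  define A where "A = (\<lambda>u. mat_id n u - f u)"
  define S where "S = (\<lambda>u. subst (ginv G) (f u))"
  \<comment> \<open>The series defining the inverse of a unitriangular matrix and the inverse of
    \<open>G\<close> agree on \<open>J\<close>, as both invert the same matrix.\<close>
  have inv: "eqm J (subst f (ginv ?U u)) (S u)" for u
  proof -
    obtain i j where u: "u = (i, j)" by (cases u)
    have "subst f (ginv ?U u) = (\<Sum>l<n. (mat_mult n A ^^ l) (mat_id n) (i, j))"
      by (simp add: U_inv u subst_simps subst_mat_power subst_mat_id A_def)
    moreover have "eqm J (\<Sum>l<n. (mat_mult n A ^^ l) (mat_id n) (i, j)) (S (i, j))"
    proof (rule unitriangular_inverse[OF J_ideal])
      fix i j
      show "A (i, j) \<in> J" if "i \<ge> n \<or> j \<ge> n \<or> j \<le> i"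
      proof (cases "i = j \<and> i < n")
        case True
        then show ?thesis using eqm_sym[OF J_ideal f1[of i]] by (simp add: A_def mat_id_def eqm_def)
      next
        case False
        then have "f (i, j) \<in> J" using that by (intro f0) auto
        then show ?thesis using False ideal_uminus[OF J_ideal] by (auto simp: A_def mat_id_def)
      qed
      show "S (i, j) \<in> J" if "i \<ge> n \<or> j \<ge> n"
        using f0[of i j] that J_inv by (auto simp: S_def morphism_def)
      assume ij: "i < n" "j < n"
      have VJ: "morphism J I Var" by (rule morphism_mono[OF subset_refl IJ morphism_Var])
      have "mat_mult n S (\<lambda>u. mat_id n u - A u) (i, j) = subst (case_sum (ginv G) Var) (\<Sum>l<n. subst pr1 (f (i, l)) * subst pr2 (f (l, j)))"
        by (simp add: mat_mult_apply A_def S_def subst_simps subst_subst)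
      also have "eqm J \<dots> (subst (case_sum (ginv G) Var) (comult (f (i, j))))"
        by (rule subst_eqm_morphism[OF morphism_case_sum[OF J_ideal J_inv morphism_Var] eqm_sym[OF K f2]])
      also have "subst (case_sum (ginv G) Var) (comult (f (i, j))) = subst (pmult G (pinv G Var) Var) (f (i, j))"
        by (simp add: subst_pmult pinv_Var)
      also have "eqm J \<dots> (subst (punit G) (f (i, j)))"
        by (intro eqm_subst[OF J_ideal] pmult_pinv(1)[OF J_ideal VJ])
      also (eqm_trans[OF J_ideal]) have "subst (punit G) (f (i, j)) = mat_id n (i, j)"
        by (simp add: subst_punit fu mat_id_def)
      finally show "eqm J (mat_mult n S (\<lambda>u. mat_id n u - A u) (i, j)) (mat_id n (i, j))" .
    qed
    ultimately show ?thesis by (simp add: u)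
  qed
  have L3: "morphism L L (ginv ?U)"
    unfolding morphism_def
  proof
    fix p assume "p \<in> L"
    then have "subst (ginv G) (subst f p) \<in> J" using J_inv by (simp add: L_def morphism_def)
    moreover have "eqm J (subst f (subst (ginv ?U) p)) (subst (ginv G) (subst f p))"
      unfolding subst_subst using eqm_subst[OF J_ideal inv] by (simp add: S_def)
    ultimately have "subst f (subst (ginv ?U) p) \<in> J" using eqm_mem[OF J_ideal] by blast
    then show "subst (ginv ?U) p \<in> L" by (simp add: L_def)
  qed
  have closed: "closed_subgroup ?U L"
    unfolding closed_subgroup_def using L_ideal UL L1 L2 L3 by blast
  have comult_sub: "eqm ?K (comult p) (comult q)" if "eqm J p q" for p q
    by (rule subst_eqm_morphism[OF J_comult that])
  have hom_f: "group_morphism (subgroup_group G J) (subgroup_group ?U L) f"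
    unfolding group_morphism_def
  proof
    show "morphism (defideal (subgroup_group G J)) (defideal (subgroup_group ?U L)) f"
      using fL by (simp add: subgroup_group_def)
    have "comult (f u) - pmult (subgroup_group ?U L) (\<lambda>u. subst pr1 (f u)) (\<lambda>u. subst pr2 (f u)) u \<in> ?K" for u
    proof -
      obtain i j where u: "u = (i, j)" by (cases u)
      have gU: "gmult (subgroup_group ?U L) = mat_mult n pr1 pr2" by (simp add: subgroup_group_def U_mult)
      have "pmult (subgroup_group ?U L) (\<lambda>u. subst pr1 (f u)) (\<lambda>u. subst pr2 (f u)) u = (\<Sum>l<n. subst pr1 (f (i, l)) * subst pr2 (f (l, j)))"
        unfolding pmult_apply gU u mat_mult_apply by (simp add: subst_simps)
      then show ?thesis using f2[of i j] by (simp add: u eqm_def)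
    qed
    then show "same_morphism (prod_scheme (defideal (subgroup_group G J)) (defideal (subgroup_group G J)))
       (comp_morphism f (gmult (subgroup_group G J))) (pmult (subgroup_group ?U L) (comp_morphism f pr1) (comp_morphism f pr2))"
      by (simp add: same_morphism_def subgroup_group_def comp_morphism_def)
  qed
  have pmG: "pmult (subgroup_group G J) a b = pmult G a b" for a b :: "'v \<Rightarrow> ('t, 'k) mpoly"
    by (rule ext) (simp add: pmult_apply subgroup_group_def)
  have hom_g: "group_morphism (subgroup_group ?U L) (subgroup_group G J) g"
    unfolding group_morphism_def
  proof
    show "morphism (defideal (subgroup_group ?U L)) (defideal (subgroup_group G J)) g"
      using gJ by (simp add: subgroup_group_def)
    have "subst (gmult ?U) (g v) - pmult G (\<lambda>v. subst pr1 (g v)) (\<lambda>v. subst pr2 (g v)) v \<in> ?KL" for v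
    proof (rule reflect)
      have 1: "eqm ?K (subst ?f2 (subst (gmult ?U) (g v))) (gmult G v)"
        using eqm_trans[OF K f2_mult comult_sub[OF g]] by (simp add: subst_simps)
      have "subst ?f2 (pmult G (\<lambda>v. subst pr1 (g v)) (\<lambda>v. subst pr2 (g v)) v) =
        pmult G (\<lambda>v. subst pr1 (subst f (g v))) (\<lambda>v. subst pr2 (subst f (g v))) v"
        by (simp add: subst_pmult_apply subst_subst subst_simps)
      also have "eqm ?K \<dots> (pmult G (\<lambda>v. subst pr1 (Var v)) (\<lambda>v. subst pr2 (Var v)) v)"
        unfolding pmult_apply
      proof (rule eqm_subst[OF K])
        fix w
        show "eqm ?K (case w of Inl v \<Rightarrow> subst pr1 (subst f (g v)) | Inr v \<Rightarrow> subst pr2 (subst f (g v)))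
           (case w of Inl v \<Rightarrow> subst pr1 (Var v) | Inr v \<Rightarrow> subst pr2 (Var v))"
          using subst_eqm_morphism[OF morphism_pr1 g] subst_eqm_morphism[OF morphism_pr2 g] by (cases w) simp_all
      qed
      also have "pmult G (\<lambda>v. subst pr1 (Var v)) (\<lambda>v. subst pr2 (Var v)) v = gmult G v"
        by (simp add: subst_simps pmult_pr)
      finally have 2: "eqm ?K (subst ?f2 (pmult G (\<lambda>v. subst pr1 (g v)) (\<lambda>v. subst pr2 (g v)) v)) (gmult G v)" .
      show "subst ?f2 (subst (gmult ?U) (g v) - pmult G (\<lambda>v. subst pr1 (g v)) (\<lambda>v. subst pr2 (g v)) v) \<in> ?K"
        using eqm_trans[OF K 1 eqm_sym[OF K 2]] unfolding eqm_def rhom_diff[OF rhom_eval_mpoly[OF rhom_Const]] .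
    qed
    then show "same_morphism (prod_scheme (defideal (subgroup_group ?U L)) (defideal (subgroup_group ?U L)))
       (comp_morphism g (gmult (subgroup_group ?U L))) (pmult (subgroup_group G J) (comp_morphism g pr1) (comp_morphism g pr2))"
      unfolding same_morphism_def pmG by (simp add: subgroup_group_def comp_morphism_def)
  qed
  have "isomorphic_groups (subgroup_group G J) (subgroup_group ?U L)"
    unfolding isomorphic_groups_def
  proof (intro exI conjI)
    show "group_morphism (subgroup_group G J) (subgroup_group ?U L) f" by (rule hom_f)
    show "group_morphism (subgroup_group ?U L) (subgroup_group G J) g" by (rule hom_g)
    show "same_morphism (defideal (subgroup_group G J)) (comp_morphism g f) Var"
      using g by (simp add: same_morphism_def subgroup_group_def comp_morphism_def eqm_def)
    show "same_morphism (defideal (subgroup_group ?U L)) (comp_morphism f g) Var"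
      using gf by (simp add: same_morphism_def subgroup_group_def comp_morphism_def eqm_def)
  qed
  then show ?thesis unfolding unipotent_def using n closed by blast
qed

text \<open>A representation with generating entries is made triangular and its basis renumbered in
  the order of \<open>h\<close>. Undoing the change of basis recovers the original entries, so the
  new ones still generate.\<close>

lemma Q_unitriangular_rep:
  assumes "finite_type I"
  shows "\<exists>n f. n \<ge> 1 \<and> unitriangular_rep G Q n f \<and> (\<forall>u. counit (f u) = mat_id n u)"
proof -
  obtain B R where R: "rep G B R" and ne: "B \<noteq> {}"
    and gen: "\<And>p. \<exists>h. eqm I p (subst (\<lambda>(i, j). if i \<in> B \<and> j \<in> B then R i j else 0) h)"
    using generating_rep_exists[OF assms] by blast
  note B = rep_finite[OF R]
  obtain R' h where s: "similar B R R'" and h: "inj_on h B"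
    and tri: "\<And>i j. i \<in> B \<Longrightarrow> j \<in> B \<Longrightarrow> (h j :: nat) \<le> h i \<Longrightarrow> eqm Q (R' i j) (of_bool (i = j))"
    using triangular_form[OF R] by blast
  note R' = rep_similar[OF R s]
  define n where "n = card B"
  define xs where "xs = sorted_list_of_set (h ` B)"
  have "card (h ` B) = n" unfolding n_def by (rule card_image[OF h])
  then have xs: "length xs = n" "set xs = h ` B" "sorted_wrt (<) xs"
    using B by (simp_all add: xs_def)
  have "bij_betw ((!) xs) {..<n} (h ` B)"
  proof (rule bij_betw_nth)
    show "distinct xs" by (simp add: xs_def)
  qed (simp_all add: xs)
  moreover have "bij_betw (the_inv_into B h) (h ` B) B"
    by (rule bij_betw_the_inv_into) (simp add: bij_betw_def h)
  ultimately have bij: "bij_betw (the_inv_into B h \<circ> (!) xs) {..<n} B" by (rule bij_betw_trans)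
  \<comment> \<open>\<open>e\<close> enumerates \<open>B\<close> in increasing order of
    \<open>h\<close>, which turns the condition in \<open>tri\<close> into
    \<open>j \<le> i\<close>.\<close>
  define e where "e = the_inv_into B h \<circ> (!) xs"
  note bij = bij[folded e_def]
  have eB: "e i \<in> B" if "i < n" for i using bij that by (auto simp: bij_betw_def)
  have einj: "e i = e j \<longleftrightarrow> i = j" if "i < n" "j < n" for i j
    using bij that by (auto simp: bij_betw_def inj_on_def)
  have he: "h (e i) = xs ! i" if "i < n" for i
    using f_the_inv_into_f[OF h, of "xs ! i"] xs that by (metis comp_apply e_def nth_mem)
  have hle: "h (e j) \<le> h (e i)" if "j \<le> i" "i < n" for i j
  proof (cases "j = i")
    case False
    then show ?thesis using sorted_wrt_nth_less[OF xs(3), of j i] xs(1) that he by simp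
  qed simp
  define f where "f = (\<lambda>(i, j). if i < n \<and> j < n then R' (e i) (e j) else 0)"
  have f: "\<And>i j. i < n \<Longrightarrow> j < n \<Longrightarrow> f (i, j) = R' (e i) (e j)" "\<And>i j. \<not> (i < n \<and> j < n) \<Longrightarrow> f (i, j) = 0"
    by (auto simp: f_def)
  let ?K = "prod_scheme Q Q"
  have K: "is_ideal ?K" by simp
  have 1: "f (i, j) \<in> Q" if "i \<ge> n \<or> j \<ge> n \<or> j < i" for i j
  proof (cases "i < n \<and> j < n")
    case True
    then have "eqm Q (R' (e i) (e j)) (of_bool (e i = e j))" using that by (intro tri eB hle) auto
    then show ?thesis using True that by (auto simp: f(1) einj eqm_def)
  next
    case False
    then show ?thesis using ideal_0[OF Q_ideal] by (simp add: f(2))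
  qed
  have 2: "eqm Q (f (i, i)) 1" if "i < n" for i
    using tri[OF eB[OF that] eB[OF that]] that by (simp add: f(1))
  have 3: "eqm ?K (comult (f (i, j))) (\<Sum>l<n. subst pr1 (f (i, l)) * subst pr2 (f (l, j)))" for i j
  proof (cases "i < n \<and> j < n")
    case True
    then have ij: "i < n" "j < n" by auto
    have "eqm ?K (comult (R' (e i) (e j))) (\<Sum>l\<in>B. subst pr1 (R' (e i) l) * subst pr2 (R' l (e j)))"
      by (rule eqm_mono[OF prod_scheme_mono[OF I_subset_Q I_subset_Q] rep_comult[OF R' eB[OF ij(1)] eB[OF ij(2)]]])
    also have "(\<Sum>l\<in>B. subst pr1 (R' (e i) l) * subst pr2 (R' l (e j))) = (\<Sum>l<n. subst pr1 (R' (e i) (e l)) * subst pr2 (R' (e l) (e j)))"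
      by (rule sum.reindex_bij_betw[OF bij, symmetric])
    also have "\<dots> = (\<Sum>l<n. subst pr1 (f (i, l)) * subst pr2 (f (l, j)))"
      using ij by (intro sum.cong refl) (simp add: f(1))
    finally show ?thesis using ij by (simp add: f(1))
  next
    case False
    have "(\<Sum>l<n. subst pr1 (f (i, l)) * subst pr2 (f (l, j))) = 0"
      using False by (intro sum.neutral) (auto simp: f(2) subst_simps)
    then show ?thesis using False by (simp add: f(2) subst_simps eqm_refl)
  qed
  have 4: "\<exists>q. eqm Q (Var v) (subst f q)" for v
  proof -
    obtain E F where EF: "\<And>i j. i \<in> B \<Longrightarrow> j \<in> B \<Longrightarrow> R i j = mm B (mm B (cm E) R') (cm F) i j"
      using similar_sym[OF B s] unfolding similar_def by blast
    define e' where "e' = the_inv_into {..<n} e"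
    have e': "e' a < n" "e (e' a) = a" if "a \<in> B" for a
      using bij that the_inv_into_into[of e "{..<n}" a "{..<n}"] f_the_inv_into_f[of e "{..<n}" a]
      by (auto simp: e'_def bij_betw_def)
    \<comment> \<open>\<open>k\<close> expresses the entries of \<open>R\<close> linearly in the new
      coordinates, by undoing the change of basis.\<close>
    define k where "k = (\<lambda>(i, j). if i \<in> B \<and> j \<in> B then mm B (mm B (cm E) (\<lambda>a b. Var (e' a, e' b))) (cm F) i j else 0)"
    have "subst f (k u) = (\<lambda>(i, j). if i \<in> B \<and> j \<in> B then R i j else 0) u" for u
    proof (cases u)
      case (Pair i j)
      have "subst f (mm B (mm B (cm E) (\<lambda>a b. Var (e' a, e' b))) (cm F) i j) = mm B (mm B (cm E) R') (cm F) i j"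
        unfolding mm_def by (simp add: subst_simps f(1) e')
      then show ?thesis by (simp add: Pair k_def EF subst_simps)
    qed
    then have k: "(\<lambda>(i, j). if i \<in> B \<and> j \<in> B then R i j else 0) = (\<lambda>u. subst f (k u))" by (intro ext) simp
    obtain q where "eqm I (Var v) (subst (\<lambda>(i, j). if i \<in> B \<and> j \<in> B then R i j else 0) q)" using gen by blast
    then have "eqm I (Var v) (subst f (subst k q))" unfolding k subst_subst .
    then show ?thesis using eqm_mono[OF I_subset_Q] by blast
  qed
  have 5: "counit (f u) = mat_id n u" for u
  proof (cases u)
    case (Pair i j)
    show ?thesis
    proof (cases "i < n \<and> j < n")
      case True
      then show ?thesis using rep_counit[OF R' eB eB, of i j] by (simp add: Pair f(1) einj mat_id_def)
    next
      case False
      then show ?thesis by (auto simp: Pair f(2) mat_id_def counit_simps)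
    qed
  qed
  have "n \<ge> 1" using ne B by (simp add: n_def Suc_le_eq card_gt_0_iff)
  then show ?thesis using 1 2 3 4 5 unfolding unitriangular_rep_def by blast
qed

end

lemma unitriangular_rep_base_change:
  fixes \<iota> :: "'k::field \<Rightarrow> 'l::field" and G :: "('v, 'k) group_data"
  assumes \<iota>: "rhom \<iota>" and f: "unitriangular_rep G J n f"
  shows "unitriangular_rep (base_change_group \<iota> G) (bc \<iota> J) n (\<lambda>u. map_coeffs \<iota> (f u))"
proof -
  have 1: "map_coeffs \<iota> (f (i, j)) \<in> bc \<iota> J" if "i \<ge> n \<or> j \<ge> n \<or> j < i" for i j
  proof (rule bc_mem[OF \<iota>])
    show "f (i, j) \<in> J" using f that unfolding unitriangular_rep_def by blast
  qed
  have 2: "eqm (bc \<iota> J) (map_coeffs \<iota> (f (i, i))) 1" if "i < n" for i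
  proof -
    have "eqm J (f (i, i)) 1" using f that unfolding unitriangular_rep_def by blast
    from bc_eqm[OF \<iota> this] show ?thesis by (simp only: map_coeffs_simps[OF \<iota>])
  qed
  have 3: "eqm (prod_scheme (bc \<iota> J) (bc \<iota> J)) (subst (gmult (base_change_group \<iota> G)) (map_coeffs \<iota> (f (i, j))))
     (\<Sum>l<n. subst pr1 (map_coeffs \<iota> (f (i, l))) * subst pr2 (map_coeffs \<iota> (f (l, j))))" for i j
  proof -
    have "eqm (prod_scheme J J) (subst (gmult G) (f (i, j))) (\<Sum>l<n. subst pr1 (f (i, l)) * subst pr2 (f (l, j)))"
      using f unfolding unitriangular_rep_def by blast
    from bc_eqm_prod[OF \<iota> this] show ?thesis
      by (simp only: map_coeffs_simps[OF \<iota>] map_coeffs_subst[OF \<iota>] bc_gmult[OF \<iota>])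
  qed
  have 4: "\<exists>q. eqm (bc \<iota> J) (Var v) (subst (\<lambda>u. map_coeffs \<iota> (f u)) q)" for v
  proof -
    obtain q where "eqm J (Var v) (subst f q)" using f unfolding unitriangular_rep_def by blast
    from bc_eqm[OF \<iota> this] have "eqm (bc \<iota> J) (Var v) (subst (\<lambda>u. map_coeffs \<iota> (f u)) (map_coeffs \<iota> q))"
      by (simp only: map_coeffs_simps[OF \<iota>] map_coeffs_subst[OF \<iota>])
    then show ?thesis by blast
  qed
  show ?thesis using 1 2 3 4 unfolding unitriangular_rep_def by blast
qed

subsection \<open>The unipotent radical\<close>

text \<open>The base change of \<open>Q\<close> is compared directly with unipotent normal subgroups
  over the larger field; irreducible representations over that field never enter.\<close>

lemma largest_unipotent_normal_subgroup_base_change: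
  fixes \<iota> :: "'k::field \<Rightarrow> 'l::field" and G :: "('v, 'k) group_data"
  assumes G: "affine_algebraic_group G" and sep: "separable_algebraic_extension \<iota>"
  shows "largest_unipotent_normal_subgroup (base_change_group \<iota> G) (base_change_scheme \<iota> (rad_ideal G))"
proof -
  note \<iota> = separable_algebraic_extensionD(1)[OF sep]
  have ag: "affine_group G" and ft: "finite_type (defideal G)" using G by (auto simp: affine_algebraic_group_def)
  interpret aff_group G by unfold_locales (rule ag)
  let ?H = "base_change_group \<iota> G"
  interpret H: aff_group ?H by unfold_locales (rule affine_group_base_change[OF \<iota> ag])
  have normal: "normal_subgroup ?H (bc \<iota> Q)" by (rule normal_subgroup_base_change[OF \<iota> normal_subgroup_Q])
  then have closed: "closed_subgroup ?H (bc \<iota> Q)" by (simp add: normal_subgroup_def)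
  obtain n f where n: "n \<ge> 1" and f: "unitriangular_rep G Q n f" and fu: "\<And>u. counit (f u) = mat_id n u"
    using Q_unitriangular_rep[OF ft] by blast
  have "H.counit (map_coeffs \<iota> (f u)) = mat_id n u" for u
    unfolding bc_counit[OF \<iota>] fu by (cases u) (simp add: mat_id_def rhomD[OF \<iota>])
  then have "unipotent (subgroup_group ?H (bc \<iota> Q))"
    by (rule H.unipotentI[OF closed unitriangular_rep_base_change[OF \<iota> f] n])
  moreover have "bc \<iota> Q \<subseteq> N" if N: "unipotent_normal_subgroup ?H N" for N
  proof (rule bc_least[OF \<iota>])
    have N': "normal_subgroup ?H N" "unipotent (subgroup_group ?H N)" using N by (auto simp: unipotent_normal_subgroup_def)
    have c: "closed_subgroup ?H N" using N'(1) by (simp add: normal_subgroup_def)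
    show NI: "is_ideal N" by (rule closed_subgroupD(1)[OF c])
    fix p assume p: "p \<in> Q"
    show "map_coeffs \<iota> p \<in> N"
    proof (rule rhom_ideal_gen_subset[OF rhom_map_coeffs[OF \<iota>] NI _ p[unfolded rad_ideal_def]])
      fix x assume "x \<in> I \<union> {R i j - of_bool (i = j) | B R i j. irreducible_rep G B R \<and> i \<in> B \<and> j \<in> B}"
      then consider "x \<in> I" | B R i j where "x = R i j - of_bool (i = j)" "irreducible_rep G B R" "i \<in> B" "j \<in> B" by blast
      then show "map_coeffs \<iota> x \<in> N"
      proof cases
        case 1
        then show ?thesis using closed_subgroupD(2)[OF c] bc_mem[OF \<iota>, of x I] by (auto simp: bc_defideal[OF \<iota>])
      next
        case 2
        then show ?thesis using irreducible_rep_trivial_on_unipotent[OF 2(2) sep N' 2(3,4)]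
          by (simp only: eqm_def map_coeffs_simps[OF \<iota>])
      qed
    qed
  qed
  ultimately show ?thesis
    using normal by (auto simp: largest_unipotent_normal_subgroup_def unipotent_normal_subgroup_def)
qed

lemma Rad_u_eq:
  assumes "largest_unipotent_normal_subgroup G N"
  shows "Rad_u G = N"
  unfolding Rad_u_def using assms
  by (intro the_equality) (auto simp: largest_unipotent_normal_subgroup_def)

text \<open>Each \<open>a\<close> is a root of \<open>X - a\<close>, whose derivative is 1.\<close>

lemma separable_algebraic_extension_id: "separable_algebraic_extension (id :: 'k::field \<Rightarrow> 'k)"
  unfolding separable_algebraic_extension_def
proof (intro conjI allI exI)
  show "field_embedding (id :: 'k \<Rightarrow> 'k)" by (simp add: field_embedding_def)
  fix a :: 'k
  show "irreducible [:- a, 1:]" by (rule irreducible_linear_field_poly) simp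
  show "coprime [:- a, 1:] (pderiv [:- a, 1:])" by (simp add: pderiv_pCons flip: one_pCons)
  show "poly (map_poly id [:- a, 1:]) a = 0" by (simp add: map_poly_pCons)
qed

lemma map_coeffs_id: "map_coeffs id p = p"
  by (rule poly_mapping_eqI) (simp add: lookup_map_coeffs)

lemma base_change_scheme_id: "is_ideal I \<Longrightarrow> base_change_scheme id I = I"
  using ideal_gen_least[of I I] by (auto simp: base_change_scheme_def map_coeffs_id intro: ideal_gen_base)

lemma base_change_group_id:
  assumes "is_ideal (defideal G)"
  shows "base_change_group id G = G"
  by (simp add: base_change_group_def base_change_scheme_id[OF assms] map_coeffs_id)

theorem theorem1p1:
  fixes G :: "('v, 'k::field) group_data"
  assumes "affine_algebraic_group G"
  shows "largest_unipotent_normal_subgroup G (Rad_u G) \<and>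
    (\<forall>\<iota> :: 'k \<Rightarrow> 'l::field. separable_algebraic_extension \<iota> \<longrightarrow>
       base_change_scheme \<iota> (Rad_u G) = Rad_u (base_change_group \<iota> G))"
proof -
  have ag: "affine_group G" using assms by (simp add: affine_algebraic_group_def)
  interpret aff_group G by unfold_locales (rule ag)
  have "largest_unipotent_normal_subgroup G Q"
    using largest_unipotent_normal_subgroup_base_change[OF assms separable_algebraic_extension_id]
    by (simp add: base_change_group_id[OF I_ideal] base_change_scheme_id[OF Q_ideal])
  moreover note Rad_u_eq[OF this]
  moreover have "Rad_u (base_change_group \<iota> G) = base_change_scheme \<iota> Q"
    if "separable_algebraic_extension \<iota>" for \<iota> :: "'k \<Rightarrow> 'l"
    by (rule Rad_u_eq[OF largest_unipotent_normal_subgroup_base_change[OF assms that]])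
  ultimately show ?thesis by simp
qed

end
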